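(* Let $n\ge4$ and let $K$ and $L$ be star bodies (star-shaped with respect to the origin) in $\mathbb{R}^n$, each having countably many diameters. Assume that there exists $\zeta\in S^{n-1}$ such that $K$ has a diameter $d_K(\zeta)$ containing the origin and parallel to $\zeta$, and such that for every $3$-dimensional subspace $H$ of $\mathbb{R}^n$ containing $\zeta$ the sections $K\cap H$ and $L\cap H$ are directly congruent. Assume also that for every such $H$ the sections $K\cap H$, $L\cap H$ have no $(\zeta,\pi)$-symmetry and no $(u,\pi)$-symmetry for any $u\in\zeta^\perp\cap H\cap S^{n-1}$. Then $K=L+b$ or $K=\mathcal{O}L+b$ for some $b\in\mathbb{R}^n$ parallel to $\zeta$, where $\mathcal{O}=\mathcal{O}_\zeta\in O(n)$ is the orthogonal transformation with $\mathcal{O}|_{\zeta^\perp}=-I$ and $\mathcal{O}(\zeta)=\zeta$.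
   Context: A body in $\mathbb{R}^n$ is a compact set equal to the closure of its non-empty interior. A set $S$ is star-shaped with respect to the origin if the segment from the origin to any point of $S$ is contained in $S$. A star body is a body $K$ that is star-shaped with respect to the origin and whose radial function $\rho_K(x)=\max\{c: cx\in K\}$, $x\ne0$, is continuous. A segment $[z,y]\subset K$ is a diameter of a star body $K$ if $|z-y|=\max_{[a,b]\subset K}|a-b|$ (maximum over segments contained in $K$); $K$ has countably many diameters if the set of such segments is countable. A diameter of $K$ containing the origin and parallel to $\zeta\in S^{n-1}$ is denoted $d_K(\zeta)$. $\zeta^\perp$ is the hyperplane through the origin orthogonal to $\zeta$. For a subspace $H$ of dimension $k$, sets $A,B\subset H$ are directly congruent if there is a rotation $\varphi\in SO(k,H)$ of $H$ such that $\varphi(A)$ is a translate of $B$. If $\dim H=3$ and $\xi\in H\cap S^{n-1}$, then $D\subset H$ has a $(\xi,\pi)$-symmetry if $\varphi(D)=D+a$ for some $a\in H$, where $\varphi\in SO(3,H)$ is the rotation by the angle $\pi$ with $\varphi(\xi)=\xi$. *)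

theory Defs
  imports "HOL-Analysis.Analysis"
begin

definition body :: "'a::euclidean_space set \<Rightarrow> bool" where
  "body K \<longleftrightarrow> compact K \<and> interior K \<noteq> {} \<and> K = closure (interior K)"

definition radial :: "'a::real_vector set \<Rightarrow> 'a \<Rightarrow> real" where
  "radial K x = (GREATEST c. c *\<^sub>R x \<in> K)"

definition star_shaped_origin :: "'a::real_vector set \<Rightarrow> bool" where
  "star_shaped_origin S \<longleftrightarrow> (\<forall>x\<in>S. closed_segment 0 x \<subseteq> S)"

definition star_body :: "'a::euclidean_space set \<Rightarrow> bool" where
  "star_body K \<longleftrightarrow> body K \<and> star_shaped_origin K \<and> continuous_on (- {0}) (radial K)"

text \<open>The greatest element in \<^const>\<open>radial\<close> is attained for star bodies.\<close>

lemma radial_greatest: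
  assumes "star_body K" and "x \<noteq> 0"
  shows "radial K x *\<^sub>R x \<in> K" and "\<And>c. c *\<^sub>R x \<in> K \<Longrightarrow> c \<le> radial K x"
proof -
  let ?C = "{c. c *\<^sub>R x \<in> K}"
  have K: "compact K" "K \<noteq> {}"
    using assms(1) interior_subset by (auto simp: star_body_def body_def)
  then obtain y where "y \<in> K" by auto
  then have "0 \<in> K"
    using assms(1) ends_in_segment(1)[of 0 y]
    by (auto simp: star_body_def star_shaped_origin_def simp del: ends_in_segment)
  then have ne: "?C \<noteq> {}" by (auto intro!: exI[of _ 0])
  obtain B where B: "\<And>y. y \<in> K \<Longrightarrow> norm y \<le> B"
    using compact_imp_bounded[OF K(1)] by (auto simp: bounded_iff)
  have "norm c \<le> B / norm x" if "c \<in> ?C" for c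
    using B[of "c *\<^sub>R x"] that assms(2) by (simp add: pos_le_divide_eq)
  then have "bounded ?C" unfolding bounded_iff by blast
  moreover have "closed ?C"
    using continuous_closed_vimage[OF compact_imp_closed[OF K(1)], of "\<lambda>c. c *\<^sub>R x"]
    by (simp add: vimage_def)
  ultimately have "compact ?C" by (simp add: compact_eq_bounded_closed)
  from compact_attains_sup[OF this ne] obtain s
    where s: "s *\<^sub>R x \<in> K" "\<And>c. c *\<^sub>R x \<in> K \<Longrightarrow> c \<le> s" by auto
  then have "radial K x = s"
    unfolding radial_def by (intro Greatest_equality)
  with s show "radial K x *\<^sub>R x \<in> K" and "\<And>c. c *\<^sub>R x \<in> K \<Longrightarrow> c \<le> radial K x"
    by auto
qed

definition is_diameter :: "'a::euclidean_space set \<Rightarrow> 'a \<Rightarrow> 'a \<Rightarrow> bool" where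
  "is_diameter K z y \<longleftrightarrow> closed_segment z y \<subseteq> K \<and>
     (\<forall>a b. closed_segment a b \<subseteq> K \<longrightarrow> dist a b \<le> dist z y)"

definition diameters :: "'a::euclidean_space set \<Rightarrow> 'a set set" where
  "diameters K = {closed_segment z y | z y. is_diameter K z y}"

definition diameter_through_origin :: "'a::euclidean_space set \<Rightarrow> 'a \<Rightarrow> bool" where
  "diameter_through_origin K \<zeta> \<longleftrightarrow>
     (\<exists>z y. is_diameter K z y \<and> 0 \<in> closed_segment z y \<and> (\<exists>c. y - z = c *\<^sub>R \<zeta>))"

text \<open>A rotation of a subspace \<open>H\<close> is represented by its extension to the whole space that is
  the identity on the orthogonal complement of \<open>H\<close>. Such an extension maps \<open>H\<close> onto itself and
  has the same determinant as its restriction to \<open>H\<close>.\<close>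

definition SO_on :: "(real^'n) set \<Rightarrow> (real^'n \<Rightarrow> real^'n) set" where
  "SO_on H = {\<phi>. orthogonal_transformation \<phi> \<and> det (matrix \<phi>) = 1 \<and>
     (\<forall>x. (\<forall>h\<in>H. orthogonal x h) \<longrightarrow> \<phi> x = x)}"

definition directly_congruent :: "(real^'n) set \<Rightarrow> (real^'n) set \<Rightarrow> (real^'n) set \<Rightarrow> bool" where
  "directly_congruent H A B \<longleftrightarrow> (\<exists>\<phi>\<in>SO_on H. \<exists>a\<in>H. \<phi> ` A = (+) a ` B)"

text \<open>For a three-dimensional \<open>H\<close> and a unit vector \<open>\<xi>\<close> in \<open>H\<close>, the rotation about \<open>\<xi>\<close> by the
  angle \<open>\<pi>\<close> acts as \<open>-I\<close> on the plane of \<open>H\<close> orthogonal to \<open>\<xi>\<close>.\<close>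

definition pi_symmetry :: "(real^'n) set \<Rightarrow> real^'n \<Rightarrow> (real^'n) set \<Rightarrow> bool" where
  "pi_symmetry H \<xi> D \<longleftrightarrow>
     (\<exists>\<phi>\<in>SO_on H. \<phi> \<xi> = \<xi> \<and> (\<forall>x\<in>H. orthogonal x \<xi> \<longrightarrow> \<phi> x = - x) \<and>
        (\<exists>a\<in>H. \<phi> ` D = (+) a ` D))"

definition axial_reflection :: "'a::euclidean_space \<Rightarrow> 'a \<Rightarrow> 'a" where
  "axial_reflection \<zeta> x = (2 * (x \<bullet> \<zeta>)) *\<^sub>R \<zeta> - x"

text \<open>For a unit vector \<open>\<zeta>\<close>, \<^const>\<open>axial_reflection\<close> is the orthogonal transformation that fixes
  \<open>\<zeta>\<close> and is \<open>-I\<close> on the hyperplane orthogonal to \<open>\<zeta>\<close>.\<close>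

lemma axial_reflection_characterization:
  assumes "norm \<zeta> = 1"
  shows "f = axial_reflection \<zeta> \<longleftrightarrow>
    orthogonal_transformation f \<and> f \<zeta> = \<zeta> \<and> (\<forall>x. orthogonal x \<zeta> \<longrightarrow> f x = - x)"
    (is "_ \<longleftrightarrow> ?R f")
proof
  have z: "\<zeta> \<bullet> \<zeta> = 1" using assms by (simp add: dot_square_norm)
  have "linear (axial_reflection \<zeta>)"
    by (rule linearI) (simp_all add: axial_reflection_def algebra_simps)
  moreover have "axial_reflection \<zeta> v \<bullet> axial_reflection \<zeta> w = v \<bullet> w" for v w
    using z by (simp add: axial_reflection_def inner_diff_left inner_diff_right inner_commute
        algebra_simps)
  moreover have "axial_reflection \<zeta> \<zeta> = \<zeta>"
    using z by (simp add: axial_reflection_def scaleR_2)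
  moreover have "axial_reflection \<zeta> x = - x" if "orthogonal x \<zeta>" for x
    using that by (simp add: axial_reflection_def orthogonal_def)
  ultimately have "?R (axial_reflection \<zeta>)"
    by (simp add: orthogonal_transformation_def)
  then show "?R f" if "f = axial_reflection \<zeta>" using that by simp
  assume R: "?R f"
  show "f = axial_reflection \<zeta>"
  proof
    fix x
    have lin: "linear f" using R by (simp add: orthogonal_transformation_def)
    have "orthogonal (x - (x \<bullet> \<zeta>) *\<^sub>R \<zeta>) \<zeta>"
      using z by (simp add: orthogonal_def inner_diff_left)
    then have "f (x - (x \<bullet> \<zeta>) *\<^sub>R \<zeta>) = - (x - (x \<bullet> \<zeta>) *\<^sub>R \<zeta>)" using R by blast
    then have "f x - (x \<bullet> \<zeta>) *\<^sub>R \<zeta> = - (x - (x \<bullet> \<zeta>) *\<^sub>R \<zeta>)"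
      using R by (simp add: linear_diff[OF lin] linear_scale[OF lin])
    then show "f x = axial_reflection \<zeta> x"
      by (simp add: axial_reflection_def algebra_simps flip: scaleR_add_left)
  qed
qed

end

theory Submission
  imports Defs
begin

text \<open>
  Both bodies have exactly one diameter on the line of \<open>\<zeta>\<close>, and since \<open>L\<close> has only countably
  many diameters, a generic three-dimensional section contains no further diameter of \<open>L\<close>. For such a
  section the congruence therefore fixes or reverses \<open>\<zeta>\<close>. After centring the two diameters, the slices
  orthogonal to \<open>\<zeta>\<close> are related by a rotation of the plane \<open>P\<close> in which the section meets the hyperplane
  orthogonal to \<open>\<zeta>\<close>,
  or by a line reflection of \<open>P\<close> together with the reversal of \<open>\<zeta>\<close>. Both conditions are closed,
  and they exclude each other because there is no \<open>(u,\<pi>)\<close>-symmetry. By connectedness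
  one of them holds for all \<open>P\<close> in a given three-dimensional subspace of this hyperplane.

  Reflections in all planes are impossible: since there is no \<open>(\<zeta>,\<pi>)\<close>-symmetry, rotational
  symmetries have uniformly bounded odd order, so a suitable odd power of the reflection is unique
  and yields a nowhere vanishing section of a nontrivial circle bundle over the projective plane.
  For rotations, injectivity of the Funk transform shows that an irrational angle forces
  \<open>(\<zeta>,\<pi>)\<close>-symmetry. If the angle is not \<open>0\<close> or \<open>\<pi>\<close> somewhere, then by Baire's theorem it is constant
  on an open set of planes, which makes the slices locally constant and again symmetric. So every
  angle is \<open>0\<close> or \<open>\<pi>\<close>, and by connectedness it is the same one for all planes.
\<close>

section \<open>Integrals over great circles\<close>

text \<open>The Funk transform acts on real functions, so a slice is replaced by the family of its
  distances to all points \<open>p\<close> of a half plane. Each member is continuous on the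
  hyperplane, and one rotation must serve all \<open>p\<close> at once. The kernel of the transform
  consists of the odd functions, so it only shows that related families f and g have equal even
  parts. The obstacle is the odd part; it is reached by applying the same argument to the squares,
  because the even parts of f and of f^2 determine (f x - f (-x))^2.

  The angle is neither unique nor known to depend continuously on the plane. Hence the arguments use
  closed sets of planes on which a given angle is admissible.

  Only \<open>K\<close> is assumed to have a diameter on the axis. Every segment of \<open>L\<close>
  lies in a three-dimensional section through the axis, so the congruences bound its length by that
  of this diameter, and the image of the diameter in \<open>L\<close> is again a longest segment.

  When the hyperplane has more than three dimensions, the alternatives found for its
  three-dimensional subspaces are compared on a plane common to all of those used.\<close>

lemma continuous_antiderivative:
  fixes h :: "real \<Rightarrow> real"
  assumes "continuous_on UNIV h"
  obtains P where "\<And>x. (P has_real_derivative h x) (at x)"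
proof -
  have "\<exists>F. \<forall>x::real. -\<infinity> < ereal x \<longrightarrow> ereal x < \<infinity> \<longrightarrow> (F has_vector_derivative h x) (at x)"
    by (rule einterval_antiderivative) (use assms in \<open>auto simp: continuous_on_eq_continuous_at\<close>)
  then show ?thesis
    using that by (auto simp: has_real_derivative_iff_has_vector_derivative)
qed

lemma integral_by_antiderivative:
  fixes h :: "real \<Rightarrow> real"
  assumes "a \<le> b" "\<And>x. (P has_real_derivative h x) (at x)"
  shows "integral {a..b} h = P b - P a"
  using assms by (intro integral_unique fundamental_theorem_of_calculus)
    (auto simp: has_real_derivative_iff_has_vector_derivative intro: has_vector_derivative_at_within)

lemma integral_periodic_shift:
  fixes h :: "real \<Rightarrow> real"
  assumes cont: "continuous_on UNIV h" and per: "\<And>x. h (x + T) = h x" and "0 \<le> T"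
  shows "integral {0..T} (\<lambda>x. h (x + b)) = integral {0..T} h"
proof -
  obtain P where P: "\<And>x. (P has_real_derivative h x) (at x)"
    using continuous_antiderivative[OF cont] by blast
  have "((\<lambda>x. P (x + T) - P x) has_real_derivative 0) (at x)" for x
    using DERIV_diff[OF P[of "x + T", unfolded DERIV_shift] P[of x]] per[of x] by simp
  then have "P (b + T) - P b = P (0 + T) - P 0"
    using DERIV_isconst_all[of "\<lambda>x. P (x + T) - P x" b 0] by auto
  moreover have "integral {0..T} (\<lambda>x. h (x + b)) = P (T + b) - P (0 + b)"
    by (rule integral_by_antiderivative[OF \<open>0 \<le> T\<close>]) (use P DERIV_shift in blast)
  moreover have "integral {0..T} h = P T - P 0"
    by (rule integral_by_antiderivative[OF \<open>0 \<le> T\<close> P])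
  ultimately show ?thesis by (simp add: add.commute)
qed

section \<open>Wallis integrals and Archimedes' formula\<close>

lemma integral_cos_power_rec:
  "(real n + 2) * integral {0..2 * pi} (\<lambda>t. cos t ^ (n + 2)) = (real n + 1) * integral {0..2 * pi} (\<lambda>t. cos t ^ n)"
proof -
  have D: "((\<lambda>t. cos t ^ (n+1) * sin t) has_real_derivative
      (real n + 2) * cos t ^ (n+2) - (real n + 1) * cos t ^ n) (at t)" for t
  proof -
    have "((\<lambda>t. cos t ^ (n+1) * sin t) has_real_derivative
      cos t ^ (n+1) * cos t - (real n + 1) * cos t ^ n * (sin t)\<^sup>2) (at t)"
      unfolding Suc_eq_plus1[symmetric]
      by (rule DERIV_cong[OF DERIV_mult[OF DERIV_power_Suc[OF DERIV_cos] DERIV_sin]])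
        (simp add: power2_eq_square algebra_simps)
    then show ?thesis unfolding sin_squared_eq by (simp add: algebra_simps power2_eq_square)
  qed
  have "integral {0..2*pi} (\<lambda>t. (real n + 2) * cos t ^ (n+2) - (real n + 1) * cos t ^ n) = 0"
    using integral_by_antiderivative[OF _ D, of 0 "2*pi"] by simp
  moreover have "(\<lambda>t. c * cos t ^ k) integrable_on {0..2*pi}" for c :: real and k
    by (intro integrable_continuous_real continuous_intros)
  ultimately show ?thesis by (simp add: integral_diff del: add_2_eq_Suc')
qed

lemma integral_sin_power_rec:
  "(real n + 2) * integral {0..pi} (\<lambda>t. sin t ^ (n + 2)) = (real n + 1) * integral {0..pi} (\<lambda>t. sin t ^ n)"
proof -
  have D: "((\<lambda>t. - (sin t ^ (n+1) * cos t)) has_real_derivative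
      (real n + 2) * sin t ^ (n+2) - (real n + 1) * sin t ^ n) (at t)" for t
  proof -
    have "((\<lambda>t. - (sin t ^ (n+1) * cos t)) has_real_derivative
      sin t ^ (n+1) * sin t - (real n + 1) * sin t ^ n * (cos t)\<^sup>2) (at t)"
      unfolding Suc_eq_plus1[symmetric]
      by (rule DERIV_cong[OF DERIV_minus[OF DERIV_mult[OF DERIV_power_Suc[OF DERIV_sin] DERIV_cos]]])
        (simp add: power2_eq_square algebra_simps)
    then show ?thesis unfolding cos_squared_eq by (simp add: algebra_simps power2_eq_square)
  qed
  have "integral {0..pi} (\<lambda>t. (real n + 2) * sin t ^ (n+2) - (real n + 1) * sin t ^ n) = 0"
    using integral_by_antiderivative[OF _ D, of 0 "pi"] by simp
  moreover have "(\<lambda>t. c * sin t ^ k) integrable_on {0..pi}" for c :: real and k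
    by (intro integrable_continuous_real continuous_intros)
  ultimately show ?thesis by (simp add: integral_diff del: add_2_eq_Suc')
qed

text \<open>Multiplying the two Wallis recurrences cancels the factor n + 2 and leaves (n + 3) P (n
  + 2) = (n + 1) P n, which is also the recurrence of the moments of [-1, 1]. It has step 2, hence
  the two base cases.\<close>

lemma integral_sin_cos_power:
  "integral {0..pi} (\<lambda>t. sin t ^ (n + 1)) * integral {0..2 * pi} (\<lambda>t. cos t ^ n)
    = 2 * pi * integral {-1..1} (\<lambda>u. u ^ n)"
proof -
  let ?a = "\<lambda>n. integral {0..pi} (\<lambda>t. sin t ^ (n + 1))"
  let ?c = "\<lambda>n. integral {0..2 * pi} (\<lambda>t. cos t ^ n)"
  have u: "integral {-1..1} (\<lambda>u::real. u ^ n) = (1 - (-1) ^ (n + 1)) / (real n + 1)" for n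
  proof -
    have "((\<lambda>u::real. u ^ (n+1) / (real n + 1)) has_real_derivative u ^ n) (at u)" for u
      unfolding Suc_eq_plus1[symmetric]
      by (rule DERIV_cong[OF DERIV_cdivide[OF DERIV_power_Suc[OF DERIV_ident]]]) (simp add: field_simps)
    from integral_by_antiderivative[OF _ this, of "-1" 1] show ?thesis
      by (simp add: add_divide_distrib)
  qed
  have base: "?a 0 = 2" "?c 0 = 2 * pi" "?c 1 = 0"
  proof -
    have "((\<lambda>t. - cos t) has_real_derivative sin t ^ (0 + 1)) (at t)" for t
      by (auto intro!: derivative_eq_intros)
    from integral_by_antiderivative[OF _ this, of 0 pi] show "?a 0 = 2" by simp
    have "(sin has_real_derivative cos t ^ 1) (at t)" for t
      by (auto intro!: derivative_eq_intros)
    from integral_by_antiderivative[OF _ this, of 0 "2*pi"] show "?c 1 = 0" by simp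
  qed auto
  have rec: "(real n + 3) * (?a (n+2) * ?c (n+2)) = (real n + 1) * (?a n * ?c n)" for n
  proof -
    have "(real n + 2) * ((real n + 3) * (?a (n+2) * ?c (n+2)))
       = ((real n + 3) * ?a (n+2)) * ((real n + 2) * ?c (n+2))" by simp
    also have "(real n + 3) * ?a (n+2) = (real n + 2) * ?a n"
      using integral_sin_power_rec[of "n+1"] by (simp add: algebra_simps numeral_3_eq_3)
    also have "(real n + 2) * ?c (n+2) = (real n + 1) * ?c n"
      by (rule integral_cos_power_rec)
    finally have "(real n + 2) * ((real n + 3) * (?a (n+2) * ?c (n+2)))
        = (real n + 2) * ((real n + 1) * (?a n * ?c n))" by simp
    then show ?thesis
      by (subst (asm) mult_cancel_left) linarith
  qed
  show ?thesis
  proof (induction n rule: induct_nat_012)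
    case 0
    show ?case using base u[of 0] by simp
  next
    case 1
    show ?case using base u[of 1] by simp
  next
    case (ge2 n)
    have "(real n + 3) * (?a (n+2) * ?c (n+2)) = (real n + 1) * (2 * pi * integral {-1..1} (\<lambda>u. u ^ n))"
      using rec[of n] ge2(1) by simp
    also have "\<dots> = (real n + 3) * (2 * pi * integral {-1..1} (\<lambda>u. u ^ (n+2)))"
      unfolding u[of n] u[of "n+2"] by (simp add: field_simps)
    finally have "?a (n+2) * ?c (n+2) = 2 * pi * integral {-1..1} (\<lambda>u. u ^ (n+2))"
      by (subst (asm) mult_cancel_left) linarith
    then show ?case by simp
  qed
qed

text \<open>For \<open>F u = u\<^sup>n\<close> this is Wallis' product, and the general case follows by the Weierstrass
  theorem. Geometrically, \<open>sin s * cos t\<close> is a coordinate on the unit sphere, which by Archimedes is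
  uniformly distributed.\<close>

lemma archimedes_integral:
  fixes F :: "real \<Rightarrow> real"
  assumes F: "continuous_on {-1..1} F"
  shows "integral {0..pi} (\<lambda>s. integral {0..2*pi} (\<lambda>t. sin s * F (sin s * cos t)))
      = 2 * pi * integral {-1..1} F"
proof -
  let ?B = "cbox (0::real, 0::real) (pi, 2*pi)"
  let ?k = "\<lambda>F (s,t). sin s * F (sin s * cos t) :: real"
  define D where "D = (\<lambda>F. integral ?B (?k F) - 2 * pi * integral {-1..1} F)"
  have range: "sin s * cos t \<in> {-1..1}" for s t :: real
    using mult_mono[of "\<bar>sin s\<bar>" 1 "\<bar>cos t\<bar>" 1] by (auto simp: abs_le_iff simp flip: abs_mult)
  have kc: "continuous_on ?B (?k F)" if "continuous_on {-1..1} F" for F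
    unfolding split_beta
    by (intro continuous_intros continuous_on_compose2[OF that]) (use range in auto)
  have ki: "?k F integrable_on ?B" if "continuous_on {-1..1} F" for F
    using kc[OF that] by (rule integrable_continuous)
  have Fi: "F integrable_on {-1..1}" if "continuous_on {-1..1} F" for F :: "real \<Rightarrow> real"
    using that by (rule integrable_continuous_real)
  have D_diff: "D (\<lambda>x. F x - G x) = D F - D G"
    if "continuous_on {-1..1} F" "continuous_on {-1..1} G" for F G
  proof -
    have "?k (\<lambda>x. F x - G x) = (\<lambda>x. ?k F x - ?k G x)" by (auto simp: algebra_simps)
    then have "integral ?B (?k (\<lambda>x. F x - G x)) = integral ?B (?k F) - integral ?B (?k G)"
      using that by (simp only: integral_diff ki)
    then show ?thesis
      unfolding D_def using that by (simp add: integral_diff Fi right_diff_distrib del: split_paired_All)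
  qed
  \<comment> \<open>A crude constant: the rectangle has area 2 pi^2, at most 8 pi because pi < 4,
    and the second term contributes at most 2 pi * 2. Only linearity in \<open>e\<close>
    matters.\<close>
  have D_bound: "\<bar>D G\<bar> \<le> 12 * pi * e"
    if G: "continuous_on {-1..1} G" and e: "\<And>x. x \<in> {-1..1} \<Longrightarrow> \<bar>G x\<bar> \<le> e" for G e
  proof -
    have "0 \<le> e" using e[of 0] by auto
    have "norm (integral {-1..1} G) \<le> e * Henstock_Kurzweil_Integration.content (cbox (-1) (1::real))"
      using integrable_bound[OF \<open>0 \<le> e\<close>, of G "-1" 1] Fi[OF G] e by (simp add: cbox_interval)
    then have 1: "\<bar>integral {-1..1} G\<bar> \<le> 2 * e" by simp
    have "norm (integral ?B (?k G)) \<le> e * Henstock_Kurzweil_Integration.content ?B"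
    proof (rule integrable_bound[OF \<open>0 \<le> e\<close> ki[OF G]])
      fix x :: "real \<times> real"
      have "\<bar>sin (fst x)\<bar> * \<bar>G (sin (fst x) * cos (snd x))\<bar> \<le> 1 * e"
        by (intro mult_mono e range) auto
      then show "norm (?k G x) \<le> e" by (auto simp: split_beta abs_mult)
    qed
    also have "Henstock_Kurzweil_Integration.content ?B = pi * (2 * pi)" by (simp add: content_Pair)
    finally have 2: "\<bar>integral ?B (?k G)\<bar> \<le> e * (pi * (2 * pi))" by simp
    have "2 * pi * (e * pi) \<le> 8 * (e * pi)"
      using pi_less_4 \<open>0 \<le> e\<close> by (intro mult_right_mono) auto
    then have "e * (pi * (2 * pi)) \<le> 8 * (pi * e)" by (simp only: mult_ac)
    with 2 have "\<bar>integral ?B (?k G)\<bar> \<le> 8 * (pi * e)" by (rule order_trans)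
    moreover have "\<bar>2 * pi * integral {-1..1} G\<bar> \<le> 4 * (pi * e)"
      using 1 by (simp add: abs_mult)
    ultimately have "\<bar>integral ?B (?k G) - 2 * pi * integral {-1..1} G\<bar> \<le> 8 * (pi * e) + 4 * (pi * e)"
      by (rule order_trans[OF abs_triangle_ineq4 add_mono])
    then show ?thesis unfolding D_def by simp
  qed
  have D_poly: "D p = 0" if poly: "real_polynomial_function p" for p
  proof -
    obtain a n where p: "p = (\<lambda>x. \<Sum>i\<le>n. a i * x ^ i)"
      using poly unfolding real_polynomial_function_iff_sum by (elim exE)
    have ci: "continuous_on {-1..1} (\<lambda>x::real. a i * x ^ i)" for i by (intro continuous_intros)
    have "?k p = (\<lambda>x. \<Sum>i\<le>n. ?k (\<lambda>x. a i * x ^ i) x)"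
      unfolding p split_beta sum_distrib_left ..
    then have "integral ?B (?k p) = (\<Sum>i\<le>n. integral ?B (?k (\<lambda>x. a i * x ^ i)))"
      by (simp only: integral_sum[OF finite_atMost ki[OF ci]])
    moreover have "integral {-1..1} p = (\<Sum>i\<le>n. integral {-1..1} (\<lambda>x. a i * x ^ i))"
      unfolding p by (rule integral_sum[OF finite_atMost Fi[OF ci]])
    ultimately have "D p = (\<Sum>i\<le>n. D (\<lambda>x. a i * x ^ i))"
      unfolding D_def by (simp only: sum_subtractf sum_distrib_left)
    also have "\<dots> = 0"
    proof (intro sum.neutral ballI)
      fix i
      have "integral ?B (?k (\<lambda>x. a i * x ^ i))
          = integral {0..pi} (\<lambda>s. integral {0..2*pi} (\<lambda>t. sin s * (a i * (sin s * cos t) ^ i)))"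
        using integral_prod_continuous[OF kc[OF ci[of i]]] by simp
      also have "\<dots> = integral {0..pi} (\<lambda>s. a i * integral {0..2*pi} (\<lambda>t. cos t ^ i) * sin s ^ (i + 1))"
        by (intro integral_cong) (simp add: power_mult_distrib mult_ac)
      also have "\<dots> = a i * (integral {0..pi} (\<lambda>t. sin t ^ (i + 1)) * integral {0..2 * pi} (\<lambda>t. cos t ^ i))"
        by (simp only: integral_mult_right integral_mult_left mult_ac)
      also have "\<dots> = 2 * pi * integral {-1..1} (\<lambda>x. a i * x ^ i)"
        unfolding integral_sin_cos_power by simp
      finally show "D (\<lambda>x. a i * x ^ i) = 0" unfolding D_def by simp
    qed
    finally show ?thesis .
  qed
  have "\<bar>D F\<bar> \<le> 0"
  proof (rule field_le_epsilon)
    fix e :: real assume "0 < e"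
    define d where "d = e / (12 * pi)"
    have "d > 0" using \<open>0 < e\<close> by (simp add: d_def)
    obtain p where p: "real_polynomial_function p" "\<And>x. x \<in> {-1..1} \<Longrightarrow> \<bar>F x - p x\<bar> < d"
      using Stone_Weierstrass_real_polynomial_function[OF _ F \<open>d > 0\<close>] by auto
    have pc: "continuous_on {-1..1} p" using p(1) continuous_on_polymonial_function
      by (simp add: continuous_real_polymonial_function continuous_at_imp_continuous_on)
    have "\<bar>D (\<lambda>x. F x - p x)\<bar> \<le> 12 * pi * d"
      by (rule D_bound) (use p(2) F pc in \<open>auto intro!: continuous_intros less_imp_le\<close>)
    also have "\<dots> = e" by (simp add: d_def)
    finally show "\<bar>D F\<bar> \<le> 0 + e" using D_diff[OF F pc] D_poly[OF p(1)] by simp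
  qed
  then have "integral ?B (?k F) = 2 * pi * integral {-1..1} F" unfolding D_def by simp
  then show ?thesis using integral_prod_continuous[OF kc[OF F]] by simp
qed

text \<open>This solves an integral equation of Abel type. Put q = r * sin s and integrate over s
  with weight sin s: by Archimedes' formula the integral of \<open>G\<close> over [-r, r] vanishes
  for every r in (0, 1]. Differentiating at r = 1 gives the claim; the derivative is one-sided
  because \<open>G\<close> is controlled on [-1, 1] only.\<close>

lemma even_part_zero_if_cos_integrals_zero:
  fixes G :: "real \<Rightarrow> real"
  assumes G: "continuous_on {-1..1} G"
    and zero: "\<And>q. 0 \<le> q \<Longrightarrow> q \<le> 1 \<Longrightarrow> integral {0..2*pi} (\<lambda>t. G (q * cos t)) = 0"
  shows "G 1 + G (-1) = 0"
proof -
  let ?E = "\<lambda>u. G u + G (-u)"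
  have *: "integral {-r..r} G = 0" if r: "0 < r" "r \<le> 1" for r
  proof -
    have "r * u \<in> {-1..1}" if "u \<in> {-1..1}" for u
      using mult_mono[of r 1 "\<bar>u\<bar>" 1] r that abs_mult[of r u] by (auto simp: abs_le_iff)
    then have rr: "(*) r ` {-1..1} \<subseteq> {-1..1}" by auto
    have Gr: "continuous_on {-1..1} (\<lambda>u. G (r * u))"
      using r by (intro continuous_on_compose2[OF G] continuous_intros)
        (use rr in auto)
    have "integral {0..2*pi} (\<lambda>t. sin s * G (r * (sin s * cos t))) = 0" if "s \<in> {0..pi}" for s
    proof -
      have "0 \<le> r * sin s" "r * sin s \<le> 1"
        using that r sin_ge_zero[of s] by (auto intro!: mult_le_one mult_nonneg_nonneg)
      from zero[OF this] show ?thesis by (simp add: mult.assoc)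
    qed
    then have "integral {0..pi} (\<lambda>s. integral {0..2*pi} (\<lambda>t. sin s * G (r * (sin s * cos t))))
        = integral {0..pi} (\<lambda>s. 0)"
      by (rule integral_cong)
    then have "integral {0..pi} (\<lambda>s. integral {0..2*pi} (\<lambda>t. sin s * G (r * (sin s * cos t)))) = 0"
      by simp
    then have "integral {-1..1} (\<lambda>u. G (r * u)) = 0"
      using archimedes_integral[OF Gr] by simp
    moreover have hi: "((\<lambda>x. G (r *\<^sub>R x + 0)) has_integral (1 / (\<bar>r\<bar> ^ DIM(real))) *\<^sub>R integral {-r..r} G)
        ((\<lambda>x. (1 / r) *\<^sub>R x + - ((1 / r) *\<^sub>R 0)) ` cbox (-r) r)"
    proof (rule has_integral_affinity)
      have "continuous_on {-r..r} G"
        by (rule continuous_on_subset[OF G]) (use r in auto)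
      then show "(G has_integral integral {-r..r} G) (cbox (-r) r)"
        unfolding cbox_interval by (intro integrable_integral integrable_continuous_real)
    qed (use r in auto)
    moreover have im: "(\<lambda>x. (1 / r) *\<^sub>R x + - ((1 / r) *\<^sub>R 0)) ` cbox (-r) r = {-1..1}"
      using r unfolding image_affinity_cbox by (simp add: cbox_interval)
    moreover have "integral {-1..1} (\<lambda>x. G (r *\<^sub>R x + 0)) = (1 / (\<bar>r\<bar> ^ DIM(real))) *\<^sub>R integral {-r..r} G"
      using hi unfolding im by (rule integral_unique)
    ultimately show ?thesis using r by simp
  qed
  have E: "continuous_on {0..1} ?E"
    by (intro continuous_intros continuous_on_compose2[OF G]) auto
  have EI: "integral {0..r} ?E = 0" if r: "0 < r" "r \<le> 1" for r
  proof -
    have i: "G integrable_on {a..b}" if "-1 \<le> a" "b \<le> 1" for a b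
      using that by (intro integrable_continuous_real continuous_on_subset[OF G]) auto
    have i': "(\<lambda>u. G (-u)) integrable_on {0..r}"
      by (intro integrable_continuous_real continuous_on_compose2[OF G] continuous_on_minus continuous_on_id)
        (use r in auto)
    have "integral {-r..r} G = integral {-r..0} G + integral {0..r} G"
      using r i[of "-r" r] by (intro Henstock_Kurzweil_Integration.integral_combine[symmetric]) auto
    also have "integral {-r..0} G = integral {0..r} (\<lambda>u. G (-u))"
      using Henstock_Kurzweil_Integration.integral_reflect_real[of r 0 "\<lambda>u. G (-u)"] by simp
    finally have "integral {0..r} G + integral {0..r} (\<lambda>u. G (- u)) = 0" using *[OF r] by simp
    then show ?thesis using integral_add[OF i[of 0 r] i'] r by simp
  qed
  have EI': "integral {0..r} ?E = 0" if "r \<in> {0..1}" for r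
    using EI[of r] that by (cases "r = 0") auto
  have D1: "((\<lambda>r. integral {0..r} ?E) has_vector_derivative ?E 1) (at 1 within {0..1})"
    by (rule integral_has_vector_derivative[OF E]) simp
  have "((\<lambda>r. 0) has_vector_derivative 0) (at (1::real) within {0..1})" by simp
  then have D2: "((\<lambda>r. integral {0..r} ?E) has_vector_derivative 0) (at 1 within {0..1})"
    by (rule has_vector_derivative_transform[rotated 2]) (use EI' in auto)
  have "at (1::real) within {0..1} \<noteq> bot" by (simp add: at_within_Icc_at_left)
  from vector_derivative_unique_within[OF this D1 D2] show ?thesis .
qed

section \<open>Injectivity of the Funk transform on even functions\<close>

lemma polar_coordinates_exist:
  fixes a b :: real
  obtains r t where "r = sqrt (a\<^sup>2 + b\<^sup>2)" "a = r * cos t" "b = r * sin t"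
proof -
  let ?z = "Complex a b"
  have "?z = complex_of_real (cmod ?z) * cis (Arg ?z)"
    using rcis_cmod_Arg[of ?z] by (simp add: rcis_def)
  from arg_cong[OF this, of Re] arg_cong[OF this, of Im] show ?thesis
    by (intro that[of "cmod ?z" "Arg ?z"]) (auto simp: complex_norm)
qed

text \<open>Averaging over the rotations about \<open>x\<close> reduces the claim to functions of the height over the
  plane orthogonal to \<open>x\<close>.\<close>

lemma funk_injective:
  fixes f :: "'a::real_inner \<Rightarrow> real"
  assumes cont: "continuous_on UNIV f"
    and circ: "\<And>u v. norm u = 1 \<Longrightarrow> norm v = 1 \<Longrightarrow> u \<bullet> v = 0 \<Longrightarrow>
      u \<in> span {x, a, b} \<Longrightarrow> v \<in> span {x, a, b} \<Longrightarrow>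
      integral {0..2*pi} (\<lambda>t. f (cos t *\<^sub>R u + sin t *\<^sub>R v)) = 0"
    and on: "norm x = 1" "norm a = 1" "norm b = 1" "x \<bullet> a = 0" "x \<bullet> b = 0" "a \<bullet> b = 0"
  shows "f x + f (- x) = 0"
proof -
  define e where "e \<alpha> = cos \<alpha> *\<^sub>R a + sin \<alpha> *\<^sub>R b" for \<alpha>
  \<comment> \<open>\<open>G p\<close> integrates \<open>f\<close> by angle over the parallel at
    height \<open>p\<close> in the direction of \<open>x\<close>. At the heights 1 and -1 the
    parallel degenerates to a point, so there \<open>G\<close> is 2 pi times a value of
    \<open>f\<close>.\<close>
  define G where "G p = integral {0..2*pi} (\<lambda>\<alpha>. f (p *\<^sub>R x + sqrt (1 - p\<^sup>2) *\<^sub>R e \<alpha>))" for p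
  have sq: "x \<bullet> x = 1" "a \<bullet> a = 1" "b \<bullet> b = 1" "a \<bullet> x = 0" "b \<bullet> x = 0" "b \<bullet> a = 0"
    using on by (simp_all add: norm_eq_1 inner_commute)
  have ce: "continuous_on S (\<lambda>y. e (g y))" if "continuous_on S g" for S :: "'b::t2_space set" and g
    unfolding e_def using that by (intro continuous_intros)
  have cf: "continuous_on S (\<lambda>y. f (g y))" if "continuous_on S g" for S :: "'b::t2_space set" and g
    using continuous_on_compose2[OF cont that] by auto
  have "continuous_on {-1..1} G"
  proof -
    have "continuous_on ({-1..1} \<times> cbox 0 (2*pi)) (\<lambda>(p, \<alpha>). f (p *\<^sub>R x + sqrt (1 - p\<^sup>2) *\<^sub>R e \<alpha>))"
      unfolding split_beta by (intro cf ce continuous_intros)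
    from integral_continuous_on_param[OF this] show ?thesis
      unfolding G_def cbox_interval .
  qed
  moreover have "integral {0..2*pi} (\<lambda>t. G (q * cos t)) = 0" if q: "0 \<le> q" "q \<le> 1" for q
  proof -
    define s where "s = sqrt (1 - q\<^sup>2)"
    have "q\<^sup>2 \<le> 1" using q by (simp add: power_le_one)
    then have s2: "s\<^sup>2 = 1 - q\<^sup>2" unfolding s_def by simp
    \<comment> \<open>For fixed \<alpha> this is the great circle spanned by two orthogonal unit
      vectors, with greatest height \<open>q\<close>; its point at \<open>t\<close> has height q *
      cos t. For fixed \<open>t\<close> and varying \<alpha> it sweeps out the parallel of that
      height. Exchanging the two integrals thus brings in \<open>circ\<close>.\<close>
    let ?P = "\<lambda>\<alpha> t. cos t *\<^sub>R (q *\<^sub>R x + s *\<^sub>R e \<alpha>) + sin t *\<^sub>R e (\<alpha> + pi / 2)"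
    have "G (q * cos t) = integral {0..2*pi} (\<lambda>\<alpha>. f (?P \<alpha> t))" for t
    proof -
      \<comment> \<open>The component of \<open>?P \<alpha> t\<close> orthogonal to \<open>x\<close>
        has length \<open>r\<close> and is turned by \<beta> against \<open>e \<alpha>\<close>. As
        \<beta> does not depend on \<alpha>, it disappears by periodicity.\<close>
      obtain r \<beta> where r: "r = sqrt ((s * cos t)\<^sup>2 + (sin t)\<^sup>2)"
        and rb: "s * cos t = r * cos \<beta>" "sin t = r * sin \<beta>"
        using polar_coordinates_exist by blast
      have "(s * cos t)\<^sup>2 + (sin t)\<^sup>2 = 1 - (q * cos t)\<^sup>2"
        by (simp add: power_mult_distrib s2 sin_squared_eq algebra_simps)
      then have r: "r = sqrt (1 - (q * cos t)\<^sup>2)" using r by simp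
      have "?P \<alpha> t = (q * cos t) *\<^sub>R x + r *\<^sub>R e (\<alpha> + \<beta>)" for \<alpha>
      proof -
        have "?P \<alpha> t = (q * cos t) *\<^sub>R x + ((s * cos t) *\<^sub>R e \<alpha> + sin t *\<^sub>R e (\<alpha> + pi / 2))"
          by (simp add: algebra_simps)
        also have "(s * cos t) *\<^sub>R e \<alpha> + sin t *\<^sub>R e (\<alpha> + pi / 2) = r *\<^sub>R e (\<alpha> + \<beta>)"
          unfolding rb e_def by (simp add: cos_add sin_add algebra_simps)
        finally show ?thesis .
      qed
      moreover have "integral {0..2*pi} (\<lambda>\<alpha>. f ((q * cos t) *\<^sub>R x + r *\<^sub>R e (\<alpha> + \<beta>)))
          = integral {0..2*pi} (\<lambda>\<alpha>. f ((q * cos t) *\<^sub>R x + r *\<^sub>R e \<alpha>))"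
        by (intro integral_periodic_shift cf ce continuous_intros) (simp_all add: e_def)
      ultimately show ?thesis unfolding G_def r by simp
    qed
    then have "integral {0..2*pi} (\<lambda>t. G (q * cos t))
        = integral {0..2*pi} (\<lambda>t. integral {0..2*pi} (\<lambda>\<alpha>. f (?P \<alpha> t)))" by simp
    also have "\<dots> = integral {0..2*pi} (\<lambda>\<alpha>. integral {0..2*pi} (\<lambda>t. f (?P \<alpha> t)))"
      unfolding cbox_interval[symmetric]
      by (rule integral_swap_continuous) (unfold split_beta, intro cf ce continuous_intros)
    also have "\<dots> = integral {0..2*pi} (\<lambda>\<alpha>. 0)"
    proof (rule integral_cong)
      fix \<alpha> :: real
      have trig: "cos \<alpha> * cos \<alpha> + sin \<alpha> * sin \<alpha> = 1"
        using sin_cos_squared_add3 by blast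
      have ee: "e \<alpha> \<bullet> e \<alpha> = 1" "e (\<alpha> + pi/2) \<bullet> e (\<alpha> + pi/2) = 1" "e \<alpha> \<bullet> e (\<alpha> + pi/2) = 0"
          "e \<alpha> \<bullet> x = 0" "x \<bullet> e \<alpha> = 0" "x \<bullet> e (\<alpha> + pi/2) = 0"
        using trig unfolding e_def
        by (simp_all add: inner_add_left inner_add_right sq on cos_add sin_add algebra_simps)
      have sp: "e \<beta> \<in> span {x, a, b}" for \<beta>
        unfolding e_def by (intro span_add span_scale span_base) auto
      show "integral {0..2*pi} (\<lambda>t. f (?P \<alpha> t)) = 0"
      proof (rule circ)
        show "norm (q *\<^sub>R x + s *\<^sub>R e \<alpha>) = 1"
          using s2 by (simp add: norm_eq_1 inner_add_left inner_add_right ee sq power2_eq_square)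
        show "norm (e (\<alpha> + pi/2)) = 1" using ee by (simp add: norm_eq_1)
        show "(q *\<^sub>R x + s *\<^sub>R e \<alpha>) \<bullet> e (\<alpha> + pi/2) = 0" by (simp add: inner_add_left ee)
        show "q *\<^sub>R x + s *\<^sub>R e \<alpha> \<in> span {x, a, b}"
          by (intro span_add span_scale sp span_base) auto
      qed (rule sp)
    qed
    finally show ?thesis by simp
  qed
  ultimately have "G 1 + G (-1) = 0" by (rule even_part_zero_if_cos_integrals_zero)
  then have "2 * pi * (f x + f (- x)) = 0" unfolding G_def by (simp add: algebra_simps)
  then show ?thesis by simp
qed

section \<open>Rotations of planes through the origin of three-space\<close>

text \<open>Rodrigues' formula without the term along \<open>w\<close>. That term vanishes on the
  plane orthogonal to \<open>w\<close>, where for a unit \<open>w\<close> this is the rotation by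
  \<open>t\<close>, oriented by \<open>w\<close>.\<close>

definition rot :: "real^3 \<Rightarrow> real \<Rightarrow> real^3 \<Rightarrow> real^3" where
  "rot w t x = cos t *\<^sub>R x + sin t *\<^sub>R cross3 w x"

lemma cross3_cross3_orthogonal:
  assumes "norm w = 1" "x \<bullet> w = 0"
  shows "cross3 w (cross3 w x) = - x"
  using assms by (simp add: Lagrange norm_eq_1 inner_commute)

lemma inner_cross3_self [simp]: "cross3 w x \<bullet> w = 0" "w \<bullet> cross3 w x = 0" "cross3 w x \<bullet> x = 0" "x \<bullet> cross3 w x = 0"
  by (simp_all add: dot_cross_self inner_commute)

lemma norm_cross3_orthogonal:
  assumes "norm w = 1" "x \<bullet> w = 0"
  shows "norm (cross3 w x) = norm x"
  using norm_cross[of w x] assms by (simp add: inner_commute)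

lemma rot_orthogonal: "x \<bullet> w = 0 \<Longrightarrow> rot w t x \<bullet> w = 0"
  by (simp add: rot_def inner_add_left)

lemma rot_rot:
  assumes "norm w = 1" "x \<bullet> w = 0"
  shows "rot w s (rot w t x) = rot w (s + t) x"
  unfolding rot_def
  by (simp add: cross_add_right cross_mult_right cross3_cross3_orthogonal[OF assms] cos_add sin_add algebra_simps)

lemma rot_0 [simp]: "rot w 0 x = x" by (simp add: rot_def)

lemma rot_pi: "rot w pi x = - x" by (simp add: rot_def)

lemma rot_minus: "rot w t (- x) = - rot w t x" by (simp add: rot_def)

lemma rot_scaleR: "rot w t (c *\<^sub>R x) = c *\<^sub>R rot w t x"
  by (simp add: rot_def cross_mult_right scaleR_right_distrib algebra_simps)

lemma rot_periodic: "rot w (t + 2 * pi * of_int k) x = rot w t x"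
  by (simp add: rot_def cos_add sin_add sin_int_2pin cos_int_2pin)

lemma continuous_on_rot [continuous_intros]:
  fixes x :: "'a::t2_space \<Rightarrow> real^3"
  assumes "continuous_on S w" "continuous_on S t" "continuous_on S x"
  shows "continuous_on S (\<lambda>y. rot (w y) (t y) (x y))"
  unfolding rot_def using assms by (intro continuous_intros continuous_on_cross)

lemma orthonormal_frame3:
  fixes w :: "real^3"
  assumes "norm w = 1"
  obtains a where "norm a = 1" "a \<bullet> w = 0"
proof -
  obtain i :: 3 where "cross3 w (axis i 1) \<noteq> 0" using cross_basis_nonzero[of w] assms by fastforce
  then show ?thesis
    by (intro that[of "cross3 w (axis i 1) /\<^sub>R norm (cross3 w (axis i 1))"]) auto
qed

lemma funk_injective3:
  fixes f :: "real^3 \<Rightarrow> real"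
  assumes cont: "continuous_on UNIV f"
    and circ: "\<And>w x. norm w = 1 \<Longrightarrow> norm x = 1 \<Longrightarrow> x \<bullet> w = 0 \<Longrightarrow> integral {0..2*pi} (\<lambda>t. f (rot w t x)) = 0"
    and "norm x = 1"
  shows "f x + f (- x) = 0"
proof -
  obtain a where a: "norm a = 1" "a \<bullet> x = 0" using orthonormal_frame3[OF \<open>norm x = 1\<close>] by blast
  have b: "norm (cross3 x a) = 1" using norm_cross3_orthogonal[OF \<open>norm x = 1\<close> a(2)] a by simp
  show ?thesis
  proof (rule funk_injective[OF cont _ \<open>norm x = 1\<close> a(1) b])
    fix u v :: "real^3" assume uv: "norm u = 1" "norm v = 1" "u \<bullet> v = 0"
    \<comment> \<open>With \<open>cross3 u v\<close> as normal, \<open>v\<close> is \<open>u\<close>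
      turned by a right angle, so the circle through \<open>u\<close> and \<open>v\<close> is an
      orbit of \<open>rot\<close>.\<close>
    have "cross3 (cross3 u v) u = v"
      using uv cross_skew[of "cross3 u v" u] by (simp add: Lagrange norm_eq_1)
    moreover have "norm (cross3 u v) = 1"
      using norm_cross3_orthogonal[of u v] uv by (simp add: inner_commute)
    ultimately show "integral {0..2*pi} (\<lambda>t. f (cos t *\<^sub>R u + sin t *\<^sub>R v)) = 0"
      using circ[of "cross3 u v" u] uv by (simp add: rot_def)
  qed (use a in \<open>auto simp: inner_commute\<close>)
qed

section \<open>Sections related by rotations\<close>

text \<open>Rotating a circle about its centre does not change the integral over it, so on every
  sphere around the origin f - g has zero integral over all great circles and is therefore odd.
  Scaling by \<open>r\<close> reduces a sphere to the unit sphere; the centre is treated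
  separately.\<close>

lemma even_part_eq_if_circles_rotated:
  fixes f g :: "real^3 \<Rightarrow> real"
  assumes cont: "continuous_on UNIV f" "continuous_on UNIV g"
    and rel: "\<And>w. norm w = 1 \<Longrightarrow> \<exists>t. \<forall>x. x \<bullet> w = 0 \<longrightarrow> f (rot w t x) = g x"
  shows "f x + f (- x) = g x + g (- x)"
proof (cases "x = 0")
  case True
  have "norm (axis 1 1 :: real^3) = 1" by (simp add: norm_axis_1)
  from rel[OF this] obtain t where "f (rot (axis 1 1) t 0) = g 0" by (metis inner_zero_left)
  then show ?thesis using True by (simp add: rot_def)
next
  case False
  define r where "r = norm x"
  have "r \<noteq> 0" using False by (simp add: r_def)
  have c: "continuous_on S (\<lambda>y. h (k y))" if "continuous_on UNIV h" "continuous_on S k"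
    for S :: "real set" and h :: "real^3 \<Rightarrow> real" and k
    using continuous_on_compose2[OF that] by auto
  let ?F = "\<lambda>y. f (r *\<^sub>R y) - g (r *\<^sub>R y)"
  have "?F (x /\<^sub>R r) + ?F (- (x /\<^sub>R r)) = 0"
  proof (rule funk_injective3)
    show "continuous_on UNIV ?F"
      by (intro continuous_intros continuous_on_compose2[OF cont(1)] continuous_on_compose2[OF cont(2)]) auto
    fix w y :: "real^3" assume w: "norm w = 1" and y: "y \<bullet> w = 0"
    obtain t where t: "\<And>x. x \<bullet> w = 0 \<Longrightarrow> f (rot w t x) = g x" using rel[OF w] by blast
    have "g (r *\<^sub>R rot w s y) = f (r *\<^sub>R rot w (s + t) y)" for s
      using t[of "r *\<^sub>R rot w s y"] y
      by (simp add: rot_orthogonal rot_scaleR rot_rot[OF w y] add.commute)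
    then have "integral {0..2*pi} (\<lambda>s. g (r *\<^sub>R rot w s y))
        = integral {0..2*pi} (\<lambda>s. f (r *\<^sub>R rot w (s + t) y))" by simp
    also have "\<dots> = integral {0..2*pi} (\<lambda>s. f (r *\<^sub>R rot w s y))"
      using rot_periodic[of w _ 1 y]
      by (intro integral_periodic_shift c[OF cont(1)] continuous_intros) auto
    finally show "integral {0..2*pi} (\<lambda>s. ?F (rot w s y)) = 0"
      by (subst integral_diff) (auto intro!: integrable_continuous_real c cont continuous_intros)
  qed (use \<open>r \<noteq> 0\<close> in \<open>simp add: r_def\<close>)
  then show ?thesis using \<open>r \<noteq> 0\<close> by simp
qed

text \<open>Kronecker's theorem: the integer combinations of the two periods are dense, so the value
  at \<open>x\<close> is attained arbitrarily close to \<open>y\<close>.\<close>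

lemma constant_if_incommensurable_periods:
  fixes e :: "real \<Rightarrow> real"
  assumes cont: "continuous_on UNIV e" and per: "\<And>x. e (x + a) = e x" "\<And>x. e (x + b) = e x"
    and irr: "a / b \<notin> \<rat>"
  shows "e x = e y"
proof (rule ccontr)
  assume ne: "e x \<noteq> e y"
  have "b \<noteq> 0" using irr by auto
  interpret a: periodic_fun_simple e a by standard (rule per)
  interpret b: periodic_fun_simple e b by standard (rule per)
  from cont have "isCont e y" by (simp add: continuous_on_eq_continuous_at)
  then obtain d where d: "d > 0" "\<And>z. \<bar>z - y\<bar> < d \<Longrightarrow> \<bar>e z - e y\<bar> < \<bar>e x - e y\<bar>"
    using ne unfolding continuous_at_eps_delta by (metis zero_less_abs_iff right_minus_eq real_norm_def dist_norm)
  have "d / \<bar>b\<bar> > 0" using d(1) \<open>b \<noteq> 0\<close> by simp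
  then obtain h k where hk: "\<bar>of_int k * (a / b) - of_int h - (y - x) / b\<bar> < d / \<bar>b\<bar>"
    by (rule sequence_of_fractional_parts_is_dense[OF irr])
  let ?z = "x + of_int k * a - of_int h * b"
  have "?z - y = b * (of_int k * (a / b) - of_int h - (y - x) / b)"
    using \<open>b \<noteq> 0\<close> by (simp add: field_simps)
  then have "\<bar>?z - y\<bar> = \<bar>b\<bar> * \<bar>of_int k * (a / b) - of_int h - (y - x) / b\<bar>"
    by (simp only: abs_mult)
  also have "\<dots> < d" using hk \<open>b \<noteq> 0\<close> by (simp add: pos_less_divide_eq mult.commute)
  finally have "\<bar>e ?z - e y\<bar> < \<bar>e x - e y\<bar>" by (rule d)
  moreover have "e ?z = e x" using b.minus_of_int a.plus_of_int by simp
  ultimately show False by simp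
qed

text \<open>Along the circle, the sum \<open>e\<close> and the sum of squares \<open>q\<close> over
  antipodal points are invariant under shifts by \<open>t\<close> and by pi, hence constant. So h^2
  = 2 q - e^2 is constant too, where \<open>h\<close> is the difference over antipodal points. But
  \<open>h\<close> changes sign after a half turn, so it has a zero and vanishes.\<close>

lemma even_on_circle_if_irrational_angle:
  fixes f g :: "real^3 \<Rightarrow> real"
  assumes cont: "continuous_on UNIV f"
    and rel: "\<And>x. x \<bullet> w = 0 \<Longrightarrow> f (rot w t x) = g x"
    and sums: "\<And>x. f x + f (- x) = g x + g (- x)" "\<And>x. (f x)\<^sup>2 + (f (- x))\<^sup>2 = (g x)\<^sup>2 + (g (- x))\<^sup>2"
    and irr: "t / pi \<notin> \<rat>" and w: "norm w = 1" and x: "x \<bullet> w = 0"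
  shows "f (- x) = f x"
proof -
  have cr: "continuous_on UNIV (\<lambda>s. f (c *\<^sub>R rot w s x))" for c
    by (rule continuous_on_compose2[OF cont]) (auto intro!: continuous_intros)
  have c: "continuous_on UNIV (\<lambda>s. f (rot w s x))" "continuous_on UNIV (\<lambda>s. f (- rot w s x))"
    using cr[of 1] cr[of "-1"] by auto
  have st: "f (rot w (s + t) x) = g (rot w s x)" "f (- rot w (s + t) x) = g (- rot w s x)" for s
    using rel[of "rot w s x"] rel[of "- rot w s x"] x
    by (simp_all add: rot_orthogonal rot_minus rot_rot[OF w x] add.commute)
  have sp: "rot w (s + pi) x = - rot w s x" for s
    using rot_rot[OF w x, of pi s] by (simp add: rot_pi add.commute)
  define e where "e s = f (rot w s x) + f (- rot w s x)" for s
  define q where "q s = (f (rot w s x))\<^sup>2 + (f (- rot w s x))\<^sup>2" for s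
  define h where "h s = f (rot w s x) - f (- rot w s x)" for s
  have e: "e s = e 0" for s
  proof (rule constant_if_incommensurable_periods[where e = e, OF _ _ _ irr])
    show "continuous_on UNIV e" unfolding e_def by (intro continuous_intros c)
    show "e (s + t) = e s" for s by (simp add: e_def st sums)
    show "e (s + pi) = e s" for s by (simp add: e_def sp)
  qed
  have q: "q s = q 0" for s
  proof (rule constant_if_incommensurable_periods[where e = q, OF _ _ _ irr])
    show "continuous_on UNIV q" unfolding q_def by (intro continuous_intros c)
    show "q (s + t) = q s" for s by (simp add: q_def st sums)
    show "q (s + pi) = q s" for s by (simp add: q_def sp)
  qed
  have h2: "(h s)\<^sup>2 = 2 * q s - (e s)\<^sup>2" for s
    unfolding h_def q_def e_def by (simp add: power2_eq_square algebra_simps)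
  have "h pi = - h 0" using sp[of 0] by (simp add: h_def)
  moreover have "continuous_on {0..pi} h" unfolding h_def
    by (intro continuous_intros continuous_on_subset[OF c(1)] continuous_on_subset[OF c(2)]) auto
  ultimately have "\<exists>s. h s = 0"
    using IVT'[of h 0 0 pi] IVT2'[of h pi 0 0] by (cases "h 0 \<le> 0") force+
  then obtain s where "h s = 0" ..
  then have "(h 0)\<^sup>2 = 0" using h2[of s] h2[of 0] e[of s] q[of s] by simp
  then show ?thesis by (simp add: h_def)
qed

section \<open>A constant angle on an open set of planes\<close>

text \<open>The sign of \<open>sin t\<close> is part of \<open>W\<close>: it orients the normal so
  that the turn from \<open>X\<close> to \<open>y\<close> is by \<open>t\<close> and not by
  \<open>- t\<close>.\<close>

lemma rot_to:
  assumes "norm X = 1" "norm y = 1" "X \<bullet> y = cos t" "sin t \<noteq> 0"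
  defines "W \<equiv> cross3 X y /\<^sub>R sin t"
  shows "norm W = 1" "X \<bullet> W = 0" "rot W t X = y"
proof -
  have "(norm (cross3 X y))\<^sup>2 = (sin t)\<^sup>2"
    using assms(1-3) by (simp add: norm_cross sin_squared_eq)
  then have "sqrt ((norm (cross3 X y))\<^sup>2) = sqrt ((sin t)\<^sup>2)" by (rule arg_cong)
  then have "norm (cross3 X y) = \<bar>sin t\<bar>" by simp
  then show "norm W = 1" using \<open>sin t \<noteq> 0\<close> by (simp add: W_def)
  show "X \<bullet> W = 0" by (simp add: W_def dot_cross_self)
  have "cross3 (cross3 X y) X = y - cos t *\<^sub>R X"
    using cross_skew[of "cross3 X y" X] assms(1,3) by (simp add: Lagrange norm_eq_1)
  then show "rot W t X = y" using \<open>sin t \<noteq> 0\<close> by (simp add: rot_def W_def cross_mult_left)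
qed

text \<open>One of the two unit vectors that have inner product \<open>cos t\<close> with both \<open>y\<close> and \<open>z\<close>.\<close>

definition apex :: "real \<Rightarrow> real^3 \<Rightarrow> real^3 \<Rightarrow> real^3" where
  "apex t y z = (cos t / (1 + y \<bullet> z)) *\<^sub>R (y + z)
     + (sgn (sin t) * sqrt (1 - 2 * (cos t)\<^sup>2 / (1 + y \<bullet> z)) / norm (cross3 y z)) *\<^sub>R cross3 y z"

lemma apex:
  assumes yz: "norm y = 1" "norm z = 1" "cross3 y z \<noteq> 0" and c: "2 * (cos t)\<^sup>2 < 1 + y \<bullet> z"
    and "sin t \<noteq> 0"
  shows "norm (apex t y z) = 1" "apex t y z \<bullet> y = cos t" "apex t y z \<bullet> z = cos t"
proof -
  let ?d = "1 + y \<bullet> z" and ?n = "cross3 y z"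
  let ?b = "sgn (sin t) * sqrt (1 - 2 * (cos t)\<^sup>2 / ?d)"
  have d: "?d > 0" using c zero_le_power2[of "cos t"] by linarith
  have sq: "y \<bullet> y = 1" "z \<bullet> z = 1" using yz by (simp_all add: norm_eq_1)
  have n: "?n \<bullet> y = 0" "?n \<bullet> z = 0" "y \<bullet> ?n = 0" "z \<bullet> ?n = 0" by (simp_all add: dot_cross_self)
  have nn: "?n \<bullet> ?n = (norm ?n)\<^sup>2" by (simp add: power2_norm_eq_inner)
  show "apex t y z \<bullet> y = cos t" "apex t y z \<bullet> z = cos t"
    using d by (simp_all add: apex_def inner_add_left n sq inner_commute[of z y] add.commute)
  have b2: "?b\<^sup>2 = 1 - 2 * (cos t)\<^sup>2 / ?d"
    using c d \<open>sin t \<noteq> 0\<close> by (simp add: power_mult_distrib sgn_if)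
  have "apex t y z \<bullet> apex t y z = (cos t / ?d)\<^sup>2 * ((y + z) \<bullet> (y + z)) + (?b / norm ?n)\<^sup>2 * (?n \<bullet> ?n)"
  proof -
    have "(a *\<^sub>R v + b *\<^sub>R ?n) \<bullet> (a *\<^sub>R v + b *\<^sub>R ?n) = a\<^sup>2 * (v \<bullet> v) + b\<^sup>2 * (?n \<bullet> ?n)"
      if "v \<bullet> ?n = 0" for a b v
      using that by (simp add: inner_add_left inner_add_right inner_commute[of ?n v] power2_eq_square)
    moreover have "(y + z) \<bullet> ?n = 0" by (simp add: inner_add_left n)
    ultimately show ?thesis unfolding apex_def by blast
  qed
  also have "(y + z) \<bullet> (y + z) = 2 * ?d" by (simp add: inner_add_left inner_add_right sq inner_commute)
  also have "(?b / norm ?n)\<^sup>2 * (?n \<bullet> ?n) = ?b\<^sup>2" using yz(3) unfolding nn by (simp add: power_divide)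
  also have "(cos t / ?d)\<^sup>2 * (2 * ?d) = 2 * (cos t)\<^sup>2 / ?d"
  proof -
    have "(c / d)\<^sup>2 * (2 * d) = 2 * c\<^sup>2 / d" if "d > 0" for c d :: real
      using that by (simp add: power2_eq_square)
    then show ?thesis using d by blast
  qed
  finally show "norm (apex t y z) = 1" unfolding b2 by (simp add: norm_eq_1)
qed

lemma eventually_nhds_isCont:
  assumes "isCont f a" "open S" "f a \<in> S"
  shows "eventually (\<lambda>x. f x \<in> S) (nhds a)"
  using assms by (simp add: eventually_nhds_conv_at continuous_at topological_tendstoD)

text \<open>By assumption \<open>f\<close> is constant on the arcs \<open>{rot w t x | w \<in> Q, w \<bottom> x}\<close>. If \<open>z\<close> is obtained from
  \<open>y\<close> by a small move towards \<open>w0\<close>, then every \<open>y'\<close> near \<open>y\<close> lies on such an arc together with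
  \<open>z\<close>, the centre \<open>x\<close> of the arc being \<open>apex t y' z\<close>.\<close>

lemma locally_constant_if_rotated_on_open:
  fixes f g :: "real^3 \<Rightarrow> real"
  assumes Q: "open Q" "w0 \<in> Q" "norm w0 = 1" and s: "sin t \<noteq> 0"
    and rel: "\<And>w x. w \<in> Q \<Longrightarrow> norm w = 1 \<Longrightarrow> x \<bullet> w = 0 \<Longrightarrow> f (rot w t x) = g x"
    and y: "norm y = 1" "y \<bullet> w0 = 0"
  shows "eventually (\<lambda>y'. norm y' = 1 \<longrightarrow> f y' = f y) (nhds y)"
proof -
  have sq: "y \<bullet> y = 1" "w0 \<bullet> w0 = 1" "w0 \<bullet> y = 0" using y Q(3) by (simp_all add: norm_eq_1 inner_commute)
  define z where "z d = cos d *\<^sub>R y + sin d *\<^sub>R w0" for d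
  have z1: "norm (z d) = 1" for d
    by (simp add: norm_eq_1 z_def inner_add_left inner_add_right sq y flip: power2_eq_square)
  have yz: "y \<bullet> z d = cos d" for d by (simp add: z_def inner_add_right sq y)
  have n1: "norm (cross3 y w0) = 1"
    using norm_cross3_orthogonal[of y w0] y Q(3) by (simp add: inner_commute)
  have cz: "cross3 y (z d) = sin d *\<^sub>R cross3 y w0" for d
    by (simp add: z_def cross_add_right cross_mult_right)
  \<comment> \<open>This is \<open>apex t y (z d)\<close> with the normalised cross product replaced
    by \<open>cross3 y w0\<close>, with which it agrees for \<open>sin d > 0\<close>. Unlike the
    original, it is continuous at d = 0, where z = y and the cross product vanishes.\<close>
  define A where "A d = (cos t / (1 + cos d)) *\<^sub>R (y + z d)
     + (sgn (sin t) * sqrt (1 - 2 * (cos t)\<^sup>2 / (1 + cos d))) *\<^sub>R cross3 y w0" for d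
  have apexA: "apex t y (z d) = A d" if "sin d > 0" for d
    using that unfolding apex_def A_def yz cz by (simp add: n1)
  have "0 < (sin t)\<^sup>2" using s by simp
  then have c1: "(cos t)\<^sup>2 < 1" unfolding sin_squared_eq by simp
  have s': "sgn (sin t) * sqrt (1 - (cos t)\<^sup>2) = sin t"
    by (simp add: sgn_mult_abs flip: sin_squared_eq)
  have A0: "A 0 = cos t *\<^sub>R y + sin t *\<^sub>R cross3 y w0"
    by (simp add: A_def z_def s' flip: scaleR_2)
  have "cross3 (A 0) y = sin t *\<^sub>R w0"
    using cross_skew[of "cross3 y w0" y]
    by (simp add: A0 cross_add_left cross_mult_left Lagrange sq y)
  \<comment> \<open>In the limit d = 0 the axes of both rotations, to \<open>y\<close> and to
    \<open>z d\<close>, are \<open>w0\<close>. So for small d > 0 they lie in the open set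
    \<open>Q\<close>.\<close>
  then have A0y: "cross3 (A 0) y /\<^sub>R sin t = w0" "cross3 (A 0) (z 0) /\<^sub>R sin t = w0"
    using s by (simp_all add: z_def)
  have zc: "isCont z 0" unfolding z_def by (intro continuous_intros)
  have Ac: "isCont A 0" unfolding A_def by (intro continuous_intros zc) auto
  have ev: "eventually (\<lambda>d. h d \<in> S) (at_right 0)" if "isCont h 0" "open S" "h 0 \<in> S"
    for h :: "real \<Rightarrow> 'b::topological_space" and S
    using eventually_nhds_isCont[OF that] by (rule filter_leD[OF at_within_le_nhds])
  have "eventually (\<lambda>d. cross3 (A d) y /\<^sub>R sin t \<in> Q) (at_right 0)"
    "eventually (\<lambda>d. cross3 (A d) (z d) /\<^sub>R sin t \<in> Q) (at_right 0)"
  proof -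
    have 1: "isCont (\<lambda>d. cross3 (A d) y /\<^sub>R sin t) 0" "isCont (\<lambda>d. cross3 (A d) (z d) /\<^sub>R sin t) 0"
      by (intro continuous_intros continuous_cross Ac zc)+
    show "eventually (\<lambda>d. cross3 (A d) y /\<^sub>R sin t \<in> Q) (at_right 0)"
      by (rule ev[OF 1(1) Q(1)]) (use A0y Q(2) in simp)
    show "eventually (\<lambda>d. cross3 (A d) (z d) /\<^sub>R sin t \<in> Q) (at_right 0)"
      by (rule ev[OF 1(2) Q(1)]) (use A0y Q(2) in simp)
  qed
  moreover have "eventually (\<lambda>d. 1 + cos d \<in> {2 * (cos t)\<^sup>2<..}) (at_right 0)"
    by (rule ev) (use c1 in simp_all)
  moreover have "eventually (\<lambda>d. d \<in> {0<..<pi}) (at_right 0)"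
    by (rule eventually_at_right_real) simp
  ultimately have "eventually (\<lambda>d. cross3 (A d) y /\<^sub>R sin t \<in> Q \<and> cross3 (A d) (z d) /\<^sub>R sin t \<in> Q
      \<and> 1 + cos d \<in> {2 * (cos t)\<^sup>2<..} \<and> d \<in> {0<..<pi}) (at_right 0)"
    by (intro eventually_conj)
  from eventually_happens'[OF trivial_limit_at_right_real this]
  obtain d where d: "cross3 (A d) y /\<^sub>R sin t \<in> Q" "cross3 (A d) (z d) /\<^sub>R sin t \<in> Q"
      "2 * (cos t)\<^sup>2 < 1 + cos d" "d \<in> {0<..<pi}"
    unfolding greaterThan_iff by (elim exE conjE)
  have sd: "sin d > 0" using d(4) by (auto intro: sin_gt_zero)
  let ?z = "z d"
  let ?A = "\<lambda>y'. apex t y' ?z"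
  have ne: "cross3 y ?z \<noteq> 0" using sd n1 unfolding cz by auto
  have pos: "1 + y \<bullet> ?z \<noteq> 0" using d(3) zero_le_power2[of "cos t"] unfolding yz by linarith
  have cc: "isCont (\<lambda>y'. cross3 y' ?z) y" by (intro continuous_cross continuous_intros)
  have Ac: "isCont ?A y"
    unfolding apex_def using ne pos by (intro continuous_intros cc) auto
  have "eventually (\<lambda>y'. cross3 (?A y') y' /\<^sub>R sin t \<in> Q) (nhds y)"
  proof -
    have "isCont (\<lambda>y'. cross3 (?A y') y' /\<^sub>R sin t) y" by (intro continuous_intros continuous_cross Ac)
    then show ?thesis
      by (rule eventually_nhds_isCont[OF _ Q(1)]) (use d(1) apexA[OF sd] in simp)
  qed
  moreover have "eventually (\<lambda>y'. cross3 (?A y') ?z /\<^sub>R sin t \<in> Q) (nhds y)"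
  proof -
    have "isCont (\<lambda>y'. cross3 (?A y') ?z /\<^sub>R sin t) y" by (intro continuous_intros continuous_cross Ac)
    then show ?thesis
      by (rule eventually_nhds_isCont[OF _ Q(1)]) (use d(2) apexA[OF sd] in simp)
  qed
  moreover have "eventually (\<lambda>y'. cross3 y' ?z \<in> - {0}) (nhds y)"
    by (rule eventually_nhds_isCont[OF cc]) (use ne in auto)
  moreover have "eventually (\<lambda>y'. 1 + y' \<bullet> ?z \<in> {2 * (cos t)\<^sup>2<..}) (nhds y)"
  proof -
    have "isCont (\<lambda>y'. 1 + y' \<bullet> ?z) y" by (intro continuous_intros)
    then show ?thesis
      by (rule eventually_nhds_isCont) (use d(3) yz in auto)
  qed
  ultimately have *: "eventually (\<lambda>y'. norm y' = 1 \<longrightarrow> f y' = f ?z) (nhds y)"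
  proof eventually_elim
    case (elim y')
    show ?case
    proof
      assume y': "norm y' = 1"
      note A = apex[OF y' z1 _ _ s, of d]
      have A': "norm (?A y') = 1" "?A y' \<bullet> y' = cos t" "?A y' \<bullet> ?z = cos t"
        using A elim by auto
      note 1 = rot_to[OF A'(1) y' A'(2) s] and 2 = rot_to[OF A'(1) z1 A'(3) s]
      have "f y' = g (?A y')" using rel[OF elim(1) 1(1,2)] 1(3) by simp
      also have "\<dots> = f ?z" using rel[OF elim(2) 2(1,2)] 2(3) by simp
      finally show "f y' = f ?z" .
    qed
  qed
  from eventually_nhds_x_imp_x[OF this] y have "f y = f ?z" by simp
  with * show ?thesis by simp
qed

text \<open>On each sphere around the origin \<open>f\<close> is locally constant at the points of
  the circle of \<open>w0\<close>. Along this circle its derivative is therefore zero, and a half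
  turn leads from \<open>x\<close> to \<open>- x\<close>.\<close>

lemma even_on_circle_if_rotated_on_open:
  fixes f g :: "real^3 \<Rightarrow> real"
  assumes Q: "open Q" "w0 \<in> Q" "norm w0 = 1" and s: "sin t \<noteq> 0"
    and rel: "\<And>w x. w \<in> Q \<Longrightarrow> norm w = 1 \<Longrightarrow> x \<bullet> w = 0 \<Longrightarrow> f (rot w t x) = g x"
    and x: "x \<bullet> w0 = 0"
  shows "f (- x) = f x"
proof (cases "x = 0")
  case False
  define r u where "r = norm x" and "u = x /\<^sub>R r"
  have r: "r \<noteq> 0" "x = r *\<^sub>R u" and u: "norm u = 1" "u \<bullet> w0 = 0"
    using False x by (simp_all add: r_def u_def)
  let ?h = "\<lambda>s. f (r *\<^sub>R rot w0 s u)"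
  have "(?h has_real_derivative 0) (at v)" for v
  proof -
    have nr: "norm (rot w0 v u) = 1" for v
    proof -
      have "norm (rot w0 v u)^2 = 1" unfolding power2_norm_eq_inner rot_def
        using u norm_cross3_orthogonal[OF Q(3) u(2)]
        by (simp add: inner_add_left inner_add_right norm_eq_1[symmetric])
           (simp add: norm_eq_1 flip: power2_eq_square)
      then show ?thesis by (simp add: power2_eq_1_iff) (metis norm_ge_zero neg_0_le_iff_le not_one_le_zero)
    qed
    have "eventually (\<lambda>y'. norm y' = 1 \<longrightarrow> f (r *\<^sub>R y') = f (r *\<^sub>R rot w0 v u)) (nhds (rot w0 v u))"
    proof (rule locally_constant_if_rotated_on_open[OF Q s, where g = "\<lambda>x. g (r *\<^sub>R x)"])
      show "f (r *\<^sub>R rot w t x) = g (r *\<^sub>R x)" if "w \<in> Q" "norm w = 1" "x \<bullet> w = 0" for w x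
        using rel[of w "r *\<^sub>R x"] that by (simp add: rot_scaleR)
    qed (use nr u in \<open>auto simp: rot_orthogonal\<close>)
    moreover have "isCont (\<lambda>v. rot w0 v u) v"
      unfolding rot_def by (intro continuous_intros)
    then have "((\<lambda>v. rot w0 v u) \<longlongrightarrow> rot w0 v u) (nhds v)"
      by (simp add: continuous_at tendsto_nhds_iff)
    ultimately have "eventually (\<lambda>v'. ?h v' = ?h v) (nhds v)"
      using nr by (auto simp: filterlim_iff)
    then show ?thesis
      by (subst DERIV_cong_ev[OF refl _ refl, where g = "\<lambda>_. ?h v"]) auto
  qed
  then have "?h pi = ?h 0" using DERIV_isconst_all[of ?h pi 0] by blast
  then show ?thesis using r by (simp add: rot_pi)
qed simp

section \<open>Sections related by reflections\<close>

lemma norm_cis_diff_le: "cmod (cis a - cis b) \<le> \<bar>a - b\<bar>"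
proof -
  have "cis a - cis b = cis b * (exp (\<i> * of_real (a - b)) - 1)"
    unfolding cis_conv_exp[symmetric] by (simp add: right_diff_distrib cis_mult)
  then have "cmod (cis a - cis b) = 2 * \<bar>sin ((a - b) / 2)\<bar>"
    by (simp only: norm_mult norm_cis dist_exp_i_1 mult_1)
  also have "\<dots> \<le> 2 * \<bar>(a - b) / 2\<bar>" by (intro mult_left_mono abs_sin_x_le_abs_x) auto
  finally show ?thesis by simp
qed

text \<open>The powers of a number with small nonzero angle \<theta> advance in steps of size at
  most \<bar>\<theta>\<bar> and so pass -1 within that distance. The exponent \<open>j\<close> is
  the last one before the angle pi.\<close>

lemma close_to_1_eq_1:
  fixes X :: "complex set"
  assumes powers: "\<And>\<zeta> k. \<zeta> \<in> X \<Longrightarrow> \<zeta> ^ k \<in> X"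
    and far: "\<And>\<zeta>. \<zeta> \<in> X \<Longrightarrow> e \<le> dist \<zeta> (-1)"
    and \<theta>: "cis \<theta> \<in> X" "\<bar>\<theta>\<bar> < e"
  shows "cis \<theta> = 1"
proof (cases "\<theta> = 0")
  case False
  define j where "j = nat \<lfloor>pi / \<bar>\<theta>\<bar>\<rfloor>"
  have "real j = of_int \<lfloor>pi / \<bar>\<theta>\<bar>\<rfloor>" by (simp add: j_def)
  then have j: "real j \<le> pi / \<bar>\<theta>\<bar>" "pi / \<bar>\<theta>\<bar> < real j + 1" by linarith+
  then have "real j * \<bar>\<theta>\<bar> \<le> pi" "pi < (real j + 1) * \<bar>\<theta>\<bar>"
    using False by (simp_all add: field_simps)
  then have "\<bar>real j * \<bar>\<theta>\<bar> - pi\<bar> \<le> \<bar>\<theta>\<bar>" by (simp add: abs_le_iff algebra_simps)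
  then have *: "\<bar>real j * \<theta> - sgn \<theta> * pi\<bar> \<le> \<bar>\<theta>\<bar>" by (auto simp: sgn_if abs_if split: if_splits)
  have m1: "cis (sgn \<theta> * pi) = -1" using False by (simp add: sgn_if complex_eq_iff)
  have "e \<le> dist (cis \<theta> ^ j) (-1)" using far powers \<theta>(1) by blast
  also have "\<dots> = cmod (cis (real j * \<theta>) - cis (sgn \<theta> * pi))" by (simp only: m1 dist_norm Complex.DeMoivre)
  also have "\<dots> \<le> \<bar>real j * \<theta> - sgn \<theta> * pi\<bar>"
    by (rule norm_cis_diff_le)
  finally show ?thesis using * \<theta>(2) by simp
qed simp

text \<open>By Dirichlet's approximation some power with exponent at most \<open>M\<close> is so
  close to 1 that it equals 1, whence \<open>fact M\<close> is a common exponent. Its even part can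
  be removed: an element other than 1 of 2-power order has -1 among its powers.\<close>

lemma uniform_odd_exponent:
  fixes X :: "complex set"
  assumes X: "X \<subseteq> sphere 0 1" and powers: "\<And>\<zeta> k. \<zeta> \<in> X \<Longrightarrow> \<zeta> ^ k \<in> X"
    and "closed X" "-1 \<notin> X"
  obtains N :: nat where "odd N" "\<And>\<zeta>. \<zeta> \<in> X \<Longrightarrow> \<zeta> ^ N = 1"
proof -
  obtain e where e: "e > 0" "\<And>\<zeta>. \<zeta> \<in> X \<Longrightarrow> e \<le> dist \<zeta> (-1)"
    using separate_point_closed[OF \<open>closed X\<close> \<open>-1 \<notin> X\<close>] by (metis dist_commute)
  obtain M :: nat where M: "M > 0" "2 * pi / M < e"
    using reals_Archimedean2[of "2 * pi / e"] e(1)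
    by (metis divide_less_eq mult.commute pos_divide_less_eq less_divide_eq of_nat_0_less_iff
        divide_pos_pos order_less_trans pi_gt_zero zero_less_mult_iff zero_less_numeral)
  have 1: "\<zeta> ^ fact M = 1" if "\<zeta> \<in> X" for \<zeta>
  proof -
    have \<zeta>: "\<zeta> = cis (Arg \<zeta>)" using X that cis_Arg[of \<zeta>] by (cases "\<zeta> = 0") (auto simp: sgn_eq)
    obtain h k where hk: "0 < k" "k \<le> int M" "\<bar>of_int k * (Arg \<zeta> / (2 * pi)) - of_int h\<bar> < 1 / M"
      using Dirichlet_approx[OF M(1)] by blast
    let ?\<alpha> = "of_int k * Arg \<zeta> - 2 * pi * of_int h"
    have "?\<alpha> = 2 * pi * (of_int k * (Arg \<zeta> / (2 * pi)) - of_int h)" by (simp add: right_diff_distrib)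
    then have "\<bar>?\<alpha>\<bar> = 2 * pi * \<bar>of_int k * (Arg \<zeta> / (2 * pi)) - of_int h\<bar>" by (simp add: abs_mult)
    also have "\<dots> \<le> 2 * pi * (1 / M)" by (intro mult_left_mono) (use hk in auto)
    also have "\<dots> < e" using M by simp
    finally have small: "\<bar>?\<alpha>\<bar> < e" .
    have "cis ?\<alpha> = cis (real (nat k) * Arg \<zeta>)"
      using hk(1) by (simp flip: cis_divide)
    also have "\<dots> = \<zeta> ^ nat k" by (subst (2) \<zeta>) (simp add: Complex.DeMoivre)
    finally have k: "cis ?\<alpha> = \<zeta> ^ nat k" .
    then have "cis ?\<alpha> = 1" using close_to_1_eq_1[OF powers e(2) _ small] powers[OF that] by simp
    then have "\<zeta> ^ nat k = 1" using k by simp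
    moreover have "nat k dvd fact M" using hk by (intro dvd_fact) auto
    ultimately show ?thesis by (metis dvdE power_mult power_one)
  qed
  define N :: nat where "N = fact M div 2 ^ multiplicity 2 (fact M :: nat)"
  have N: "fact M = N * (2 :: nat) ^ multiplicity 2 (fact M :: nat)"
    unfolding N_def by (simp add: multiplicity_dvd)
  have "odd N" unfolding N_def by (rule multiplicity_decompose) auto
  moreover have "\<eta> = 1" if "\<eta> \<in> X" "\<eta> ^ (2 ^ a) = 1" for \<eta> :: complex and a
    using that
  proof (induction a)
    case (Suc a)
    let ?\<mu> = "\<eta> ^ (2 ^ a)"
    have "?\<mu> ^ 2 = 1" using Suc.prems(2) by (simp add: power_mult[symmetric] mult.commute)
    moreover have "?\<mu> \<noteq> -1" using powers[OF Suc.prems(1)] \<open>-1 \<notin> X\<close> by metis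
    ultimately have "?\<mu> = 1" by (simp add: power2_eq_1_iff)
    then show ?case using Suc by blast
  qed simp
  then have "\<zeta> ^ N = 1" if "\<zeta> \<in> X" for \<zeta>
    using powers[OF that, of N] 1[OF that] N by (metis power_mult)
  ultimately show ?thesis by (rule that)
qed

lemma integer_valued_continuous_constant:
  fixes \<phi> :: "real \<Rightarrow> real"
  assumes "continuous_on UNIV \<phi>" "\<And>t. \<phi> t \<in> \<int>"
  shows "\<phi> s = \<phi> t"
proof -
  have "\<phi> constant_on UNIV"
  proof (rule continuous_discrete_range_constant[OF connected_UNIV assms(1)])
    fix x
    have "1 \<le> norm (\<phi> y - \<phi> x)" if "\<phi> y \<noteq> \<phi> x" for y
      using Ints_nonzero_abs_ge1[of "\<phi> y - \<phi> x"] assms(2) that by auto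
    then show "\<exists>e>0. \<forall>y. y \<in> UNIV \<and> \<phi> y \<noteq> \<phi> x \<longrightarrow> e \<le> norm (\<phi> y - \<phi> x)"
      by (intro exI[of _ 1]) auto
  qed
  then show ?thesis by (auto simp: constant_on_def)
qed

text \<open>The disc parametrises the upper hemisphere of planes through \<open>0\<close>, each identified with the
  complex plane by a frame; \<open>equator\<close> compares the frames of a vertical plane at its two
  parameters \<open>z\<close> and \<open>-z\<close>. The reflection \<open>\<eta> \<mapsto> Y * cnj \<eta>\<close> need not be unique, but some odd power
  \<open>Y ^ N\<close> is, and its winding number along the boundary circle is incompatible with a continuous
  extension to the disc.\<close>

lemma no_reflection_field_disc:
  fixes F G :: "'p \<Rightarrow> complex \<Rightarrow> complex \<Rightarrow> real"
  assumes contF: "\<And>p. continuous_on (cball 0 1 \<times> UNIV) (\<lambda>x. F p (fst x) (snd x))"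
    and contG: "\<And>p. continuous_on (cball 0 1 \<times> UNIV) (\<lambda>x. G p (fst x) (snd x))"
    and rel: "\<And>z. z \<in> cball 0 1 \<Longrightarrow> \<exists>Y. cmod Y = 1 \<and> (\<forall>p \<eta>. F p z (Y * cnj \<eta>) = G p z \<eta>)"
    and nosym: "\<And>z. z \<in> cball 0 1 \<Longrightarrow> \<exists>p \<eta>. F p z (- \<eta>) \<noteq> F p z \<eta>"
    and equator: "\<And>p z \<eta>. cmod z = 1 \<Longrightarrow> F p (- z) (- (z\<^sup>2) * cnj \<eta>) = F p z \<eta>"
      "\<And>p z \<eta>. cmod z = 1 \<Longrightarrow> G p (- z) (- (z\<^sup>2) * cnj \<eta>) = G p z \<eta>"
  shows False
proof -
  let ?D = "cball 0 1 :: complex set" and ?C = "sphere 0 1 :: complex set"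
  let ?S = "?D \<times> ?C"
  have closed_eq: "closed {x \<in> ?S. \<forall>p \<eta>. h p \<eta> x = k p \<eta> x}"
    if "\<And>p \<eta>. continuous_on ?S (h p \<eta>)" "\<And>p \<eta>. continuous_on ?S (k p \<eta>)"
    for h k :: "'p \<Rightarrow> complex \<Rightarrow> complex \<times> complex \<Rightarrow> real"
  proof -
    have "closed {x \<in> ?S. h p \<eta> x - k p \<eta> x = 0}" for p \<eta>
      by (intro continuous_closed_preimage_constant continuous_intros that closed_Times) auto
    then have "closed (\<Inter>p. \<Inter>\<eta>. {x \<in> ?S. h p \<eta> x - k p \<eta> x = 0})" by (intro closed_INT ballI)
    moreover have "(\<Inter>p. \<Inter>\<eta>. {x \<in> ?S. h p \<eta> x - k p \<eta> x = 0}) = {x \<in> ?S. \<forall>p \<eta>. h p \<eta> x = k p \<eta> x}"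
      by auto
    ultimately show ?thesis by simp
  qed
  have compact: "compact {x \<in> ?S. P x}" if "closed {x \<in> ?S. P x}" for P
  proof -
    have "compact (?S \<inter> {x \<in> ?S. P x})" using that by (intro compact_Int_closed compact_Times) auto
    moreover have "?S \<inter> {x \<in> ?S. P x} = {x \<in> ?S. P x}" by blast
    ultimately show ?thesis by simp
  qed
  have cF: "continuous_on ?S (\<lambda>x. F p (fst x) (k x))" "continuous_on ?S (\<lambda>x. G p (fst x) (k x))"
    if "continuous_on ?S k" for p k
    using continuous_on_compose2[OF contF[of p], of ?S "\<lambda>x. (fst x, k x)"]
      continuous_on_compose2[OF contG[of p], of ?S "\<lambda>x. (fst x, k x)"] that
    by (force intro: continuous_intros)+

  \<comment> \<open>Pairs of a parameter and a rotational symmetry of \<open>F\<close> there.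
    Compactness makes the set of all symmetries, over all parameters together, closed, so one
    exponent \<open>N\<close> serves every plane.\<close>
  define Sym where "Sym = {x \<in> ?S. \<forall>p \<eta>. F p (fst x) (snd x * \<eta>) = F p (fst x) \<eta>}"
  have "compact Sym" unfolding Sym_def
    by (intro compact closed_eq cF continuous_intros)
  have powers: "\<zeta> ^ k \<in> snd ` Sym" if "\<zeta> \<in> snd ` Sym" for \<zeta> k
  proof -
    obtain z where z: "z \<in> ?D" "cmod \<zeta> = 1" "\<And>p \<eta>. F p z (\<zeta> * \<eta>) = F p z \<eta>"
      using \<open>\<zeta> \<in> snd ` Sym\<close> by (auto simp: Sym_def)
    have "F p z (\<zeta> ^ k * \<eta>) = F p z \<eta>" for p \<eta>
      by (induction k) (simp_all add: z(3) mult.assoc)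
    then have "(z, \<zeta> ^ k) \<in> Sym" using z by (auto simp: Sym_def norm_power)
    then show ?thesis by force
  qed
  have "closed (snd ` Sym)"
    using \<open>compact Sym\<close> by (intro compact_imp_closed compact_continuous_image continuous_intros)
  moreover have "-1 \<notin> snd ` Sym"
  proof
    assume "-1 \<in> snd ` Sym"
    then obtain z where "z \<in> ?D" "\<And>p \<eta>. F p z (-1 * \<eta>) = F p z \<eta>" by (auto simp: Sym_def)
    then show False using nosym[of z] by simp
  qed
  moreover have "snd ` Sym \<subseteq> ?C" by (auto simp: Sym_def)
  ultimately obtain N :: nat where N: "odd N" "\<And>\<zeta>. \<zeta> \<in> snd ` Sym \<Longrightarrow> \<zeta> ^ N = 1"
    using uniform_odd_exponent[of "snd ` Sym"] powers by metis

  \<comment> \<open>All admissible reflections. Two of them at the same parameter differ by a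
    rotational symmetry, which disappears in the power \<open>N\<close>.\<close>
  define R where "R = {x \<in> ?S. \<forall>p \<eta>. F p (fst x) (snd x * cnj \<eta>) = G p (fst x) \<eta>}"
  have "compact R" unfolding R_def
    by (intro compact closed_eq cF continuous_intros)
  have unique: "Y ^ N = Y' ^ N" if Y: "(z, Y) \<in> R" "(z, Y') \<in> R" for z Y Y'
  proof -
    have "Y' \<noteq> 0" using Y(2) by (auto simp: R_def)
    have "F p z (Y / Y' * \<mu>) = F p z \<mu>" for p \<mu>
    proof -
      have R: "\<And>\<eta>. F p z (Y * cnj \<eta>) = G p z \<eta>" "\<And>\<eta>. F p z (Y' * cnj \<eta>) = G p z \<eta>"
        using Y unfolding R_def by simp_all
      have "F p z (Y * cnj (cnj (\<mu> / Y'))) = F p z (Y' * cnj (cnj (\<mu> / Y')))"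
        by (simp only: R)
      then show ?thesis using \<open>Y' \<noteq> 0\<close> by simp
    qed
    then have "(z, Y / Y') \<in> Sym" using Y by (auto simp: Sym_def R_def norm_divide)
    then have "(Y / Y') ^ N = 1" using N(2) by force
    then show ?thesis using \<open>Y' \<noteq> 0\<close> by (simp add: power_divide)
  qed
  define y where "y z = (SOME Y. (z, Y) \<in> R) ^ N" for z
  have y: "y z = Y ^ N" if "(z, Y) \<in> R" for z Y
    unfolding y_def by (rule unique[OF someI[of "\<lambda>Y. (z, Y) \<in> R", OF that] that])
  have ex: "\<exists>Y. (z, Y) \<in> R" if "z \<in> ?D" for z
    using rel[OF that] that by (auto simp: R_def)
  have ynorm: "cmod (y z) = 1" if z: "z \<in> ?D" for z
  proof -
    obtain Y where "(z, Y) \<in> R" using ex[OF z] by blast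
    then show ?thesis using y by (auto simp: R_def norm_power)
  qed
  \<comment> \<open>\<open>SOME\<close> may choose \<open>Y\<close> discontinuously, but the graph
    of \<open>y\<close> is the image of the compact set \<open>R\<close> under taking powers, hence
    closed.\<close>
  have "continuous_on ?D y"
  proof (rule continuous_from_closed_graph[where T = ?C])
    have "(\<lambda>z. (z, y z)) ` ?D = (\<lambda>x. (fst x, snd x ^ N)) ` R"
    proof (intro set_eqI iffI)
      fix v assume "v \<in> (\<lambda>z. (z, y z)) ` ?D"
      then obtain z where z: "z \<in> ?D" "v = (z, y z)" by blast
      obtain Y where "(z, Y) \<in> R" using ex[OF z(1)] by blast
      then show "v \<in> (\<lambda>x. (fst x, snd x ^ N)) ` R" using y z by force
    next
      fix v assume "v \<in> (\<lambda>x. (fst x, snd x ^ N)) ` R"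
      then obtain z Y where "(z, Y) \<in> R" "v = (z, Y ^ N)" by auto
      then show "v \<in> (\<lambda>z. (z, y z)) ` ?D" using y by (auto simp: R_def)
    qed
    then show "closed ((\<lambda>z. (z, y z)) ` ?D)"
      using \<open>compact R\<close> by (auto intro!: compact_imp_closed compact_continuous_image continuous_intros)
  qed (use ynorm in auto)
  then obtain l where l: "continuous_on ?D l" "\<And>z. z \<in> ?D \<Longrightarrow> y z = exp (l z)"
    using continuous_logarithm_on_cball[of 0 1 y] ynorm by (metis norm_zero zero_neq_one)
  define b where "b t = Im (l (cis t))" for t
  have ycis: "y (cis t) = cis (b t)" for t
  proof -
    have "cmod (exp (l (cis t))) = 1" using ynorm[of "cis t"] l(2)[of "cis t"] by simp
    then have "Re (l (cis t)) = 0" by simp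
    then show ?thesis using l(2)[of "cis t"] by (simp add: exp_eq_polar b_def)
  qed
  have cb: "continuous_on UNIV (\<lambda>t. b (k t))" if "continuous_on UNIV k" for k :: "real \<Rightarrow> real"
    unfolding b_def by (intro continuous_intros continuous_on_compose2[OF l(1)] that) auto
  have antipode: "y (- z) = z ^ (4 * N) * cnj (y z)" if z: "cmod z = 1" for z
  proof -
    obtain Y where Y: "(z, Y) \<in> R" using ex[of z] z by auto
    have zz: "z\<^sup>2 * (cnj z)\<^sup>2 = 1" using z complex_norm_square[of z] by (simp flip: power_mult_distrib)
    \<comment> \<open>Conjugating the reflection \<eta> \<mapsto> Y * cnj \<eta> by the change of
      frame \<eta> \<mapsto> - (z^2) * cnj \<eta>, which is an involution, gives the reflection with
      multiplier z^4 * cnj Y.\<close>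
    have "F p (- z) (z ^ 4 * cnj Y * cnj \<eta>) = G p (- z) \<eta>" for p \<eta>
    proof -
      let ?\<eta> = "- (z\<^sup>2) * cnj \<eta>"
      have "F p (- z) (z ^ 4 * cnj Y * cnj \<eta>) = F p (- z) (- (z\<^sup>2) * cnj (Y * cnj ?\<eta>))"
        by (rule arg_cong[where f = "F p (- z)"]) (simp add: power2_eq_square eval_nat_numeral)
      also have "\<dots> = F p z (Y * cnj ?\<eta>)" using equator(1)[OF z] by blast
      also have "\<dots> = G p z ?\<eta>"
        using Y unfolding R_def mem_Collect_eq fst_conv snd_conv by blast
      also have "\<dots> = G p (- z) (- (z\<^sup>2) * cnj ?\<eta>)" using equator(2)[OF z, of p ?\<eta>] by simp
      also have "- (z\<^sup>2) * cnj ?\<eta> = z\<^sup>2 * (cnj z)\<^sup>2 * \<eta>" by simp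
      finally show ?thesis by (simp add: zz)
    qed
    then have "(- z, z ^ 4 * cnj Y) \<in> R" using Y z by (auto simp: R_def norm_mult norm_power)
    from y[OF this] y[OF Y] show ?thesis by (simp add: power_mult_distrib power_mult)
  qed
  \<comment> \<open>\<open>antipode\<close> says that the winding number d of \<open>y\<close> on
    the boundary circle satisfies d = 4 N - d, that is d = 2 N, whereas the logarithm on the disc
    forces d = 0. In terms of the lift \<open>b\<close>: \<phi> takes integer values and is
    constant, but by the periodicity of \<open>b\<close> its values at 0 and pi differ by 2
    N.\<close>
  define \<phi> where "\<phi> t = (b (t + pi) + b t - 4 * real N * t) / (2 * pi)" for t
  have "\<phi> 0 = \<phi> pi"
  proof (rule integer_valued_continuous_constant[where \<phi> = \<phi>])
    show "continuous_on UNIV \<phi>" unfolding \<phi>_def by (intro continuous_intros cb) auto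
    fix t
    have "cis (t + pi) = - cis t" by (simp add: complex_eq_iff)
    then have "cis (b (t + pi)) = cis t ^ (4 * N) * cnj (cis (b t))"
      using antipode[of "cis t"] ycis[of t] ycis[of "t + pi"] by simp
    also have "cis t ^ (4 * N) = cis (4 * real N * t)" by (simp add: Complex.DeMoivre)
    also have "cnj (cis (b t)) = cis (- b t)" by (simp add: complex_eq_iff)
    finally have "cis (b (t + pi)) * cis (b t - 4 * real N * t)
        = cis (4 * real N * t) * cis (- b t) * cis (b t - 4 * real N * t)" by simp
    then have "cis (b (t + pi) + b t - 4 * real N * t) = 1" by (simp add: cis_mult algebra_simps)
    then have "cos (b (t + pi) + b t - 4 * real N * t) = 1" by (simp add: complex_eq_iff)
    then obtain k :: int where "b (t + pi) + b t - 4 * real N * t = of_int k * 2 * pi"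
      using cos_one_2pi_int by blast
    then show "\<phi> t \<in> \<int>" unfolding \<phi>_def by simp
  qed
  moreover have "b (pi + pi) = b 0" unfolding b_def by (simp add: cis.ctr)
  ultimately show False using \<open>odd N\<close> by (simp add: \<phi>_def odd_pos)
qed

section \<open>Relations between families of functions on a plane\<close>

text \<open>The angle is the same for all \<open>p\<close>, since the members of a family jointly
  describe one slice.\<close>

definition rot_related :: "('p \<Rightarrow> real^3 \<Rightarrow> real) \<Rightarrow> ('p \<Rightarrow> real^3 \<Rightarrow> real) \<Rightarrow> real^3 \<Rightarrow> real \<Rightarrow> bool" where
  "rot_related f g w t \<longleftrightarrow> (\<forall>p x. x \<bullet> w = 0 \<longrightarrow> f p (rot w t x) = g p x)"

definition flip_related :: "('p \<Rightarrow> real^3 \<Rightarrow> real) \<Rightarrow> ('p \<Rightarrow> real^3 \<Rightarrow> real) \<Rightarrow> real^3 \<Rightarrow> real^3 \<Rightarrow> bool" where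
  "flip_related f g w u \<longleftrightarrow> (\<forall>p x. x \<bullet> w = 0 \<longrightarrow> f p (axial_reflection u x) = g p x)"

lemma orthogonal_plane_eq_range_cross3:
  assumes "norm w = 1"
  shows "{x. x \<bullet> w = 0} = range (cross3 w)"
proof -
  have "x \<in> range (cross3 w)" if "x \<bullet> w = 0" for x
    using cross3_cross3_orthogonal[OF assms that] by (intro range_eqI[of _ _ "- cross3 w x"]) simp
  then show ?thesis by auto
qed

text \<open>The quantifier on the right no longer ranges over a set depending on \<open>w\<close>.
  This exhibits the relations as intersections of closed conditions in \<open>w\<close> and the
  angle or axis.\<close>

lemma ball_orthogonal_plane:
  assumes "norm w = 1"
  shows "(\<forall>x. x \<bullet> w = 0 \<longrightarrow> P x) \<longleftrightarrow> (\<forall>y. P (cross3 w y))"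
  using orthogonal_plane_eq_range_cross3[OF assms] by (auto simp: set_eq_iff image_iff)

lemma norm_rot:
  assumes "norm w = 1" "x \<bullet> w = 0"
  shows "norm (rot w t x) = norm x"
proof -
  have "cross3 w x \<bullet> cross3 w x = x \<bullet> x"
    using norm_cross3_orthogonal[OF assms] by (simp add: norm_eq)
  then have "rot w t x \<bullet> rot w t x = cos t * cos t * (x \<bullet> x) + sin t * sin t * (x \<bullet> x)"
    by (simp add: rot_def inner_add_left inner_add_right)
  also have "\<dots> = (cos t * cos t + sin t * sin t) * (x \<bullet> x)" by (simp only: distrib_right)
  finally have "rot w t x \<bullet> rot w t x = x \<bullet> x" by simp
  then show ?thesis by (simp add: norm_eq)
qed

lemma closed_rot_related:
  assumes "\<And>p. continuous_on UNIV (f p)" "\<And>p. continuous_on UNIV (g p)"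
  shows "closed {x. norm (fst x) = 1 \<and> rot_related f g (fst x) (snd x)}"
proof -
  have c: "continuous_on S (\<lambda>x. f p (k x))" "continuous_on S (\<lambda>x. g p (k x))"
    if "continuous_on S k" for S :: "((real^3) \<times> real) set" and k p
    using continuous_on_compose2[OF assms(1)[of p] that] continuous_on_compose2[OF assms(2)[of p] that] by auto
  have "{x. norm (fst x) = 1 \<and> rot_related f g (fst x) (snd x)} =
      {x. norm (fst x) = 1 \<and> (\<forall>p y. f p (rot (fst x) (snd x) (cross3 (fst x) y)) = g p (cross3 (fst x) y))}"
    by (intro Collect_cong conj_cong refl) (simp only: rot_related_def ball_orthogonal_plane)
  also have "closed \<dots>"
    by (intro closed_Collect_conj closed_Collect_all closed_Collect_eq c continuous_on_cross continuous_intros)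
  finally show ?thesis .
qed

lemma closed_flip_related:
  assumes "\<And>p. continuous_on UNIV (f p)" "\<And>p. continuous_on UNIV (g p)"
  shows "closed {x. norm (fst x) = 1 \<and> norm (snd x) = 1 \<and> snd x \<bullet> fst x = 0 \<and> flip_related f g (fst x) (snd x)}"
proof -
  have c: "continuous_on S (\<lambda>x. f p (k x))" "continuous_on S (\<lambda>x. g p (k x))"
    if "continuous_on S k" for S :: "((real^3) \<times> (real^3)) set" and k p
    using continuous_on_compose2[OF assms(1)[of p] that] continuous_on_compose2[OF assms(2)[of p] that] by auto
  have "{x. norm (fst x) = 1 \<and> norm (snd x) = 1 \<and> snd x \<bullet> fst x = 0 \<and> flip_related f g (fst x) (snd x)} =
      {x. norm (fst x) = 1 \<and> norm (snd x) = 1 \<and> snd x \<bullet> fst x = 0 \<and>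
        (\<forall>p y. f p (axial_reflection (snd x) (cross3 (fst x) y)) = g p (cross3 (fst x) y))}"
    by (intro Collect_cong conj_cong refl) (simp only: flip_related_def ball_orthogonal_plane)
  also have "closed \<dots>"
    unfolding axial_reflection_def
    by (intro closed_Collect_conj closed_Collect_all closed_Collect_eq c continuous_on_cross continuous_intros)
  finally show ?thesis .
qed

lemma rotation_case:
  fixes f g :: "'p \<Rightarrow> real^3 \<Rightarrow> real"
  assumes cont: "\<And>p. continuous_on UNIV (f p)" "\<And>p. continuous_on UNIV (g p)"
    and rel: "\<And>w. norm w = 1 \<Longrightarrow> \<exists>t. rot_related f g w t"
    and nosym: "\<And>w. norm w = 1 \<Longrightarrow> \<exists>p x. x \<bullet> w = 0 \<and> f p (- x) \<noteq> f p x"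
  shows "(\<forall>p x. f p x = g p x) \<or> (\<forall>p x. f p (- x) = g p x)"
proof -
  let ?S = "sphere 0 1 :: (real^3) set"
  \<comment> \<open>Angles are measured in units of pi, so \<open>B 0\<close> and \<open>B 1\<close>
    are the two alternatives of the conclusion.\<close>
  define B where "B q = {w \<in> ?S. rot_related f g w (q * pi)}" for q :: real
  have closedB: "closed (B q)" for q
  proof -
    have "closed ((\<lambda>w. (w, q * pi)) -` {x. norm (fst x) = 1 \<and> rot_related f g (fst x) (snd x)})"
      by (intro closed_vimage closed_rot_related cont continuous_intros)
    then show ?thesis by (simp add: B_def vimage_def sphere_def dist_norm)
  qed
  have sums: "f p x + f p (- x) = g p x + g p (- x)" "(f p x)\<^sup>2 + (f p (- x))\<^sup>2 = (g p x)\<^sup>2 + (g p (- x))\<^sup>2" for p x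
  proof -
    show "f p x + f p (- x) = g p x + g p (- x)"
      by (rule even_part_eq_if_circles_rotated[OF cont]) (use rel in \<open>metis rot_related_def\<close>)
    show "(f p x)\<^sup>2 + (f p (- x))\<^sup>2 = (g p x)\<^sup>2 + (g p (- x))\<^sup>2"
      by (rule even_part_eq_if_circles_rotated[where f = "\<lambda>x. (f p x)\<^sup>2" and g = "\<lambda>x. (g p x)\<^sup>2"])
        (use rel in \<open>auto simp: rot_related_def intro!: continuous_intros cont, metis\<close>)
  qed
  have B01: "w \<in> B 0 \<union> B 1" if "w \<in> B (of_int k)" for w k
  proof (cases "even k")
    case True
    then obtain j where "k = 2 * j" by blast
    then have "rot w (of_int k * pi) x = rot w (0 * pi) x" for x
      using rot_periodic[of w 0 j x] by (simp add: mult_ac)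
    then show ?thesis using that by (simp add: B_def rot_related_def)
  next
    case False
    then obtain j where "k = 2 * j + 1" by (rule oddE)
    then have "rot w (of_int k * pi) x = rot w (1 * pi) x" for x
      using rot_periodic[of w pi j x] by (simp add: algebra_simps)
    then show ?thesis using that by (simp add: B_def rot_related_def)
  qed
  have cover: "?S \<subseteq> B 0 \<union> B 1"
  proof (rule ccontr)
    assume "\<not> ?S \<subseteq> B 0 \<union> B 1"
    then obtain w0 where w0: "w0 \<in> ?S" "w0 \<notin> B 0 \<union> B 1" by blast
    \<comment> \<open>\<open>w0\<close> has neither the angle 0 nor pi. Once all \<open>T q\<close>
      with \<open>q\<close> rational and not an integer are known to be dense, Baire's theorem
      yields a normal near \<open>w0\<close> that admits no rational multiple of pi at all, so its
      angle would be irrational.\<close>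
    define T where "T q = ?S - B q" for q
    define \<G> where "\<G> = T ` (\<rat> - \<int>)"
    have "?S \<subseteq> closure (\<Inter>\<G>)"
    proof (rule Baire)
      show "countable \<G>" unfolding \<G>_def by (intro countable_image countable_Diff countable_rat)
      fix V assume "V \<in> \<G>"
      then obtain q where q: "V = T q" "q \<notin> \<int>" by (auto simp: \<G>_def)
      have s: "sin (q * pi) \<noteq> 0"
        using q(2) by (auto simp: sin_zero_iff_int2)
      have op: "openin (top_of_set ?S) (?S \<inter> - B q)" using closedB by (intro openin_open_Int) auto
      have T: "T q = ?S \<inter> - B q" by (auto simp: T_def)
      have "w \<in> closure (T q)" if w: "w \<in> ?S" for w
      proof (rule ccontr)
        \<comment> \<open>Here the single angle q * pi is admissible at all unit normals near
          \<open>w\<close>. Its sine is not zero, so the functions are even on the circle of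
          \<open>w\<close>.\<close>
        assume n: "w \<notin> closure (T q)"
        let ?O = "- closure (T q)"
        have inB: "v \<in> B q" if "v \<in> ?O" "norm v = 1" for v
          using that closure_subset[of "T q"] by (auto simp: T_def)
        have "f p (- x) = f p x" if "x \<bullet> w = 0" for p x
        proof (rule even_on_circle_if_rotated_on_open[OF _ _ _ s _ that, of ?O])
          show "f p (rot v (q * pi) y) = g p y" if "v \<in> ?O" "norm v = 1" "y \<bullet> v = 0" for v y
            using inB[OF that(1,2)] that(3) by (simp add: B_def rot_related_def)
        qed (use n w in auto)
        then show False using nosym[of w] w by auto
      qed
      then show "openin (top_of_set ?S) V \<and> ?S \<subseteq> closure V" using op q(1) T by auto
    qed simp
    then have "w0 \<in> closure (\<Inter>\<G>)" using w0 by blast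
    moreover have "open (- (B 0 \<union> B 1))" using closedB by auto
    ultimately obtain w where w: "w \<in> \<Inter>\<G>" "w \<notin> B 0 \<union> B 1"
      using w0(2) closure_iff_nhds_not_empty[of w0 "\<Inter>\<G>"] by (metis ComplD ComplI disjoint_iff order_refl)
    \<comment> \<open>A member of \<G> has to be exhibited: it shows that the point \<open>w\<close>
      of the intersection is on the sphere.\<close>
    have "1/2 \<notin> (\<int> :: real set)" by (simp add: fraction_not_in_Ints)
    moreover have "1/2 \<in> (\<rat> :: real set)" by simp
    ultimately have "T (1/2) \<in> \<G>" unfolding \<G>_def by blast
    then have wS: "norm w = 1" using w(1) by (auto simp: T_def)
    then obtain t where t: "rot_related f g w t" using rel by blast
    have "t / pi \<in> \<rat>"
    proof (rule ccontr)
      assume "t / pi \<notin> \<rat>"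
      then have "f p (- x) = f p x" if "x \<bullet> w = 0" for p x
        using even_on_circle_if_irrational_angle[OF cont(1) _ sums _ wS that] t
        by (auto simp: rot_related_def)
      then show False using nosym[OF wS] by auto
    qed
    moreover have "w \<in> B (t / pi)" using t wS by (simp add: B_def)
    moreover have "t / pi \<notin> \<int>"
    proof
      assume "t / pi \<in> \<int>"
      then obtain k where "t / pi = of_int k" by (elim Ints_cases)
      then have "w \<in> B (of_int k)" using \<open>w \<in> B (t / pi)\<close> by metis
      then show False using B01 w(2) by blast
    qed
    ultimately have "w \<in> B (t / pi)" "T (t / pi) \<in> \<G>" unfolding \<G>_def by blast+
    then show False using w(1) unfolding T_def by blast
  qed
  have "B 0 \<inter> B 1 = {}"
  proof (rule ccontr)
    assume "B 0 \<inter> B 1 \<noteq> {}"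
    then obtain w where w: "norm w = 1" "rot_related f g w 0" "rot_related f g w pi"
      by (auto simp: B_def)
    then have "f p (- x) = f p x" if "x \<bullet> w = 0" for p x
      using that by (simp add: rot_related_def rot_pi)
    then show False using nosym[OF w(1)] by auto
  qed
  moreover have "connected ?S" by (rule connected_sphere) simp
  ultimately have "?S \<subseteq> B 0 \<or> ?S \<subseteq> B 1"
    using connected_closedD[of ?S "B 0" "B 1"] closedB cover by blast
  then show ?thesis
  proof
    have orth: "\<exists>w. norm w = 1 \<and> x \<bullet> w = 0" for x :: "real^3"
    proof (cases "x = 0")
      case True
      then show ?thesis by (intro exI[of _ "axis 1 1"]) (simp add: norm_axis_1)
    next
      case False
      then obtain a where "norm a = 1" "a \<bullet> (x /\<^sub>R norm x) = 0"
        using orthonormal_frame3[of "x /\<^sub>R norm x"] by auto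
      then show ?thesis using False by (auto simp: inner_commute)
    qed
    show ?thesis if "?S \<subseteq> B 0"
    proof -
      have "f p x = g p x" for p x
        using orth[of x] that by (force simp: B_def rot_related_def)
      then show ?thesis by blast
    qed
    show ?thesis if "?S \<subseteq> B 1"
    proof -
      have "f p (- x) = g p x" for p x
        using orth[of x] that by (force simp: B_def rot_related_def rot_pi)
      then show ?thesis by blast
    qed
  qed
qed

section \<open>Plane reflections and complex coordinates on planes\<close>

lemma plane_decomposition:
  assumes "norm w = 1" "norm u = 1" "u \<bullet> w = 0" "x \<bullet> w = 0"
  shows "x = (x \<bullet> u) *\<^sub>R u + (x \<bullet> cross3 w u) *\<^sub>R cross3 w u"
proof -
  let ?v = "cross3 w u"
  let ?r = "x - ((x \<bullet> u) *\<^sub>R u + (x \<bullet> ?v) *\<^sub>R ?v)"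
  have uv: "cross3 u ?v = w" using assms by (simp add: Lagrange norm_eq_1)
  have v: "?v \<bullet> ?v = 1" using norm_cross3_orthogonal[of w u] assms by (simp add: norm_eq_1)
  have "cross3 ?r (cross3 u ?v) = 0"
    unfolding Lagrange[of ?r u ?v] using assms v by (simp add: inner_diff_left inner_add_left norm_eq_1)
  moreover have "?r \<bullet> w = 0" using assms by (simp add: inner_diff_left inner_add_left)
  ultimately have "?r = 0" using norm_and_cross_eq_0[of ?r w] assms(1) unfolding uv by fastforce
  then show ?thesis by simp
qed

text \<open>A rotation passes through a reflection with its sign reversed, so conjugating by the
  rotation by \<open>a\<close> amounts to one rotation by - 2 a. Read backwards, a rotation by - t
  followed by a reflection is a reflection whose axis is turned by t / 2.\<close>

lemma axial_reflection_rot: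
  assumes "norm w = 1" "norm u = 1" "u \<bullet> w = 0" "x \<bullet> w = 0"
  shows "axial_reflection (rot w a u) x = axial_reflection u (rot w (- (2 * a)) x)"
proof -
  let ?v = "cross3 w u"
  define \<alpha> \<beta> where "\<alpha> = x \<bullet> u" and "\<beta> = x \<bullet> ?v"
  have x: "x = \<alpha> *\<^sub>R u + \<beta> *\<^sub>R ?v"
    unfolding \<alpha>_def \<beta>_def by (rule plane_decomposition[OF assms])
  have uu: "u \<bullet> u = 1" "?v \<bullet> ?v = 1" "u \<bullet> ?v = 0" "?v \<bullet> u = 0"
    using norm_cross3_orthogonal[of w u] assms by (simp_all add: norm_eq_1)
  have wv: "cross3 w ?v = - u" using cross3_cross3_orthogonal assms by blast
  have "axial_reflection (rot w a u) x
      = (2 * (\<alpha> * cos a + \<beta> * sin a)) *\<^sub>R (cos a *\<^sub>R u + sin a *\<^sub>R ?v) - (\<alpha> *\<^sub>R u + \<beta> *\<^sub>R ?v)"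
    unfolding axial_reflection_def rot_def by (subst (1 2) x) (simp add: inner_add_left inner_add_right uu)
  also have "\<dots> = (\<alpha> * (2 * (cos a)\<^sup>2 - 1) + \<beta> * (2 * sin a * cos a)) *\<^sub>R u
      + (\<alpha> * (2 * sin a * cos a) + \<beta> * (2 * (sin a)\<^sup>2 - 1)) *\<^sub>R ?v"
    by (simp add: algebra_simps power2_eq_square scaleR_2)
  also have "\<dots> = (\<alpha> * cos (2 * a) + \<beta> * sin (2 * a)) *\<^sub>R u + (\<alpha> * sin (2 * a) - \<beta> * cos (2 * a)) *\<^sub>R ?v"
  proof -
    have "2 * (cos a)\<^sup>2 - 1 = cos (2 * a)" "2 * (sin a)\<^sup>2 - 1 = - cos (2 * a)" "2 * sin a * cos a = sin (2 * a)"
      using cos_double_cos[of a] cos_double_sin[of a] sin_double[of a] by auto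
    then show ?thesis by (simp only:) simp
  qed
  also have "\<dots> = axial_reflection u (rot w (- (2 * a)) x)"
  proof -
    define P Q where "P = \<alpha> * cos (2 * a) + \<beta> * sin (2 * a)" and "Q = \<beta> * cos (2 * a) - \<alpha> * sin (2 * a)"
    have "rot w (- (2 * a)) x = P *\<^sub>R u + Q *\<^sub>R ?v"
      unfolding rot_def P_def Q_def
      by (subst (1 2) x) (simp add: cross_add_right cross_mult_right wv algebra_simps)
    moreover have "(P *\<^sub>R u + Q *\<^sub>R ?v) \<bullet> u = P" by (simp add: inner_add_left uu)
    moreover have "(2 * P) *\<^sub>R u = P *\<^sub>R u + P *\<^sub>R u" by (simp only: mult_2 scaleR_left_distrib)
    ultimately have "axial_reflection u (rot w (- (2 * a)) x) = P *\<^sub>R u - Q *\<^sub>R ?v"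
      unfolding axial_reflection_def by simp
    moreover have "\<alpha> * sin (2 * a) - \<beta> * cos (2 * a) = - Q" by (simp add: Q_def)
    ultimately show ?thesis unfolding P_def[symmetric] by simp
  qed
  finally show ?thesis .
qed

text \<open>The hemisphere of unit vectors with nonnegative last coordinate, and the frames of the
  orthogonal planes obtained by parallel transport from the pole along great circles.\<close>

definition hemi :: "complex \<Rightarrow> real^3" where
  "hemi z = vector [Re z, Im z, sqrt (1 - (cmod z)\<^sup>2)]"

definition frame1 :: "complex \<Rightarrow> real^3" where
  "frame1 z = vector [1 - (Re z)\<^sup>2 / (1 + sqrt (1 - (cmod z)\<^sup>2)),
     - (Re z * Im z / (1 + sqrt (1 - (cmod z)\<^sup>2))), - Re z]"

definition frame2 :: "complex \<Rightarrow> real^3" where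
  "frame2 z = vector [- (Re z * Im z / (1 + sqrt (1 - (cmod z)\<^sup>2))),
     1 - (Im z)\<^sup>2 / (1 + sqrt (1 - (cmod z)\<^sup>2)), - Im z]"

lemma hemi_frame:
  assumes "cmod z \<le> 1"
  shows "norm (hemi z) = 1" "norm (frame1 z) = 1" "frame1 z \<bullet> hemi z = 0"
    "frame2 z = cross3 (hemi z) (frame1 z)"
proof -
  define x y h where "x = Re z" and "y = Im z" and "h = sqrt (1 - (cmod z)\<^sup>2)"
  have "(cmod z)\<^sup>2 \<le> 1" using assms by (simp add: power_le_one)
  then have h0: "h \<ge> 0" and "h\<^sup>2 = 1 - (cmod z)\<^sup>2" unfolding h_def by auto
  then have xy: "x\<^sup>2 + y\<^sup>2 = (1 - h) * (1 + h)"
    unfolding x_def y_def cmod_power2 by (simp add: power2_eq_square algebra_simps)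
  \<comment> \<open>All entries are polynomial in x, y, h and k. The relations k (1 + h) = 1 and k
    (x^2 + y^2) = 1 - h then replace every manipulation of the denominator.\<close>
  define k where "k = 1 / (1 + h)"
  have k: "k * (1 + h) = 1" using h0 by (simp add: k_def)
  have xyk: "k * (x\<^sup>2 + y\<^sup>2) = 1 - h" unfolding xy using arg_cong[OF k, of "\<lambda>a. (1 - h) * a"] by (simp add: mult_ac)
  have e: "frame1 z = vector [1 - k * x\<^sup>2, - (k * x * y), - x]" "frame2 z = vector [- (k * x * y), 1 - k * y\<^sup>2, - y]"
      "hemi z = vector [x, y, h]"
    unfolding frame1_def frame2_def hemi_def x_def[symmetric] y_def[symmetric] h_def[symmetric] k_def by simp_all
  have "hemi z \<bullet> hemi z = 1" unfolding e using xy by (simp add: inner_vec_def sum_3 algebra_simps power2_eq_square)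
  then show "norm (hemi z) = 1" by (simp add: norm_eq_1)
  have "frame1 z \<bullet> frame1 z = 1 - 2 * (k * x\<^sup>2) + k * x\<^sup>2 * (k * (x\<^sup>2 + y\<^sup>2)) + x\<^sup>2 * (k * (1 + h))"
    unfolding e k by (simp add: inner_vec_def sum_3 algebra_simps power2_eq_square)
  also have "\<dots> = 1" unfolding xyk by (simp add: algebra_simps)
  finally show "norm (frame1 z) = 1" by (simp add: norm_eq_1)
  have "frame1 z \<bullet> hemi z = x * (1 - h - k * (x\<^sup>2 + y\<^sup>2))"
    unfolding e by (simp add: inner_vec_def sum_3 algebra_simps power2_eq_square)
  then show "frame1 z \<bullet> hemi z = 0" unfolding xyk by simp
  have c1: "h * (k * x * y) - y * x = - (k * x * y)" using arg_cong[OF k, of "\<lambda>a. a * x * y"] by (simp add: algebra_simps)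
  have c2: "h * (1 - k * x\<^sup>2) + x * x = 1 - k * y\<^sup>2"
    using xyk arg_cong[OF k, of "\<lambda>a. a * x * x"] by (simp add: algebra_simps power2_eq_square)
  have c3: "- (x * (k * x * y)) - y * (1 - k * x\<^sup>2) = - y" by (simp add: algebra_simps power2_eq_square)
  show "frame2 z = cross3 (hemi z) (frame1 z)"
    unfolding e using c1 c2 c3 by (simp add: cross3_def vec_eq_iff forall_3 algebra_simps power2_eq_square)
qed

lemma continuous_on_frame:
  "continuous_on (cball 0 1) frame1" "continuous_on (cball 0 1) frame2" "continuous_on (cball 0 1) hemi"
proof -
  have v: "continuous_on S (\<lambda>z. vector [a z, b z, c z] :: real^3)"
    if "continuous_on S a" "continuous_on S b" "continuous_on S c" for S :: "complex set" and a b c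
  proof (subst continuous_on_componentwise, intro ballI)
    fix i :: "real^3" assume "i \<in> Basis"
    then obtain j where j: "i = axis j 1" by (auto simp: Basis_vec_def)
    show "continuous_on S (\<lambda>z. (vector [a z, b z, c z] :: real^3) \<bullet> i)"
      unfolding j inner_axis using exhaust_3[of j] that by auto
  qed
  have n: "1 + sqrt (1 - (cmod z)\<^sup>2) \<noteq> 0" if "z \<in> cball 0 1" for z
  proof -
    have "(cmod z)\<^sup>2 \<le> 1" using that by (simp add: power_le_one)
    then have "sqrt (1 - (cmod z)\<^sup>2) \<ge> 0" by simp
    then show ?thesis by linarith
  qed
  show "continuous_on (cball 0 1) frame1" "continuous_on (cball 0 1) frame2" "continuous_on (cball 0 1) hemi"
    unfolding frame1_def frame2_def hemi_def by (intro v continuous_intros ballI n; simp)+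
qed

text \<open>Complex coordinates on the plane orthogonal to \<open>hemi z\<close>, in which the
  reflection in the line of a unit \<xi> is \<eta> \<mapsto> \<xi>^2 * cnj \<eta>.\<close>

definition plane_pt :: "complex \<Rightarrow> complex \<Rightarrow> real^3" where
  "plane_pt z \<eta> = Re \<eta> *\<^sub>R frame1 z + Im \<eta> *\<^sub>R frame2 z"

lemma plane_pt:
  assumes "cmod z \<le> 1"
  shows "plane_pt z \<eta> \<bullet> hemi z = 0" "norm (plane_pt z \<eta>) = cmod \<eta>"
    "cmod \<xi> = 1 \<Longrightarrow> axial_reflection (plane_pt z \<xi>) (plane_pt z \<eta>) = plane_pt z (\<xi>\<^sup>2 * cnj \<eta>)"
    "x \<bullet> hemi z = 0 \<Longrightarrow> \<exists>\<eta>. x = plane_pt z \<eta>"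
proof -
  note H = hemi_frame[OF assms]
  have f: "frame1 z \<bullet> frame1 z = 1" "frame2 z \<bullet> frame2 z = 1" "frame1 z \<bullet> frame2 z = 0" "frame2 z \<bullet> frame1 z = 0"
    "frame2 z \<bullet> hemi z = 0"
  proof -
    have "norm (frame2 z) = 1" using norm_cross3_orthogonal[OF H(1,3)] H(2,4) by simp
    then show "frame2 z \<bullet> frame2 z = 1" by (simp add: norm_eq_1)
  qed (use H in \<open>simp_all add: norm_eq_1\<close>)
  show "plane_pt z \<eta> \<bullet> hemi z = 0" unfolding plane_pt_def by (simp add: inner_add_left H(3) f)
  have ip: "plane_pt z \<eta> \<bullet> plane_pt z \<xi> = Re (\<eta> * cnj \<xi>)" for \<eta> \<xi>
    unfolding plane_pt_def by (simp add: inner_add_left inner_add_right f)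
  show "norm (plane_pt z \<eta>) = cmod \<eta>"
    by (simp add: norm_eq_sqrt_inner[of "plane_pt z \<eta>"] ip cmod_def power2_eq_square)
  show "axial_reflection (plane_pt z \<xi>) (plane_pt z \<eta>) = plane_pt z (\<xi>\<^sup>2 * cnj \<eta>)" if "cmod \<xi> = 1"
  proof -
    have "\<xi> * cnj \<xi> = 1" using that complex_norm_square[of \<xi>] by simp
    have "of_real (2 * Re (\<eta> * cnj \<xi>)) = \<eta> * cnj \<xi> + \<xi> * cnj \<eta>"
      using complex_add_cnj[of "\<eta> * cnj \<xi>"] by (simp add: mult.commute)
    then have "of_real (2 * Re (\<eta> * cnj \<xi>)) * \<xi> - \<eta> = \<eta> * (\<xi> * cnj \<xi>) + \<xi>\<^sup>2 * cnj \<eta> - \<eta>"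
      by (simp only:) (simp add: algebra_simps power2_eq_square)
    then have eq: "of_real (2 * Re (\<eta> * cnj \<xi>)) * \<xi> - \<eta> = \<xi>\<^sup>2 * cnj \<eta>" by (simp add: \<open>\<xi> * cnj \<xi> = 1\<close>)
    have "axial_reflection (plane_pt z \<xi>) (plane_pt z \<eta>) = plane_pt z (of_real (2 * Re (\<eta> * cnj \<xi>)) * \<xi> - \<eta>)"
      unfolding axial_reflection_def ip by (simp add: plane_pt_def algebra_simps)
    then show ?thesis unfolding eq .
  qed
  show "\<exists>\<eta>. x = plane_pt z \<eta>" if "x \<bullet> hemi z = 0"
    using plane_decomposition[OF H(1,2,3) that]
    by (intro exI[of _ "Complex (x \<bullet> frame1 z) (x \<bullet> frame2 z)"]) (simp add: plane_pt_def H(4))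
qed

text \<open>On the boundary circle \<open>hemi (- z)\<close> is \<open>- hemi z\<close>, so both
  parameters describe the same plane. Its horizontal direction has coordinate \<i> * z in both
  frames, while the coordinate of the vertical one changes sign. The change of coordinates is thus
  the reflection in the line of \<i> * z, with multiplier (\<i> * z)^2 = - (z^2).\<close>

lemma plane_pt_equator:
  assumes "cmod z = 1"
  shows "plane_pt (- z) (- (z\<^sup>2) * cnj \<eta>) = plane_pt z \<eta>"
proof -
  define x y a b where "x = Re z" and "y = Im z" and "a = Re \<eta>" and "b = Im \<eta>"
  have xy: "x\<^sup>2 + y\<^sup>2 = 1" using assms cmod_power2[of z] by (simp add: x_def y_def)
  have z: "z = Complex x y" "\<eta> = Complex a b" by (simp_all add: x_def y_def a_def b_def)
  have z2: "- (z\<^sup>2) * cnj \<eta> = Complex (- ((x\<^sup>2 - y\<^sup>2) * a + 2 * x * y * b)) (- (2 * x * y * a - (x\<^sup>2 - y\<^sup>2) * b))"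
    unfolding z by (simp add: complex_eq_iff power2_eq_square algebra_simps)
  have f: "frame1 z = vector [1 - x\<^sup>2, - (x * y), - x]" "frame2 z = vector [- (x * y), 1 - y\<^sup>2, - y]"
      "frame1 (- z) = vector [1 - x\<^sup>2, - (x * y), x]" "frame2 (- z) = vector [- (x * y), 1 - y\<^sup>2, y]"
    using assms by (simp_all add: frame1_def frame2_def x_def y_def)
  define A B where "A = - ((x\<^sup>2 - y\<^sup>2) * a + 2 * x * y * b)" and "B = - (2 * x * y * a - (x\<^sup>2 - y\<^sup>2) * b)"
  have "A * (1 - x\<^sup>2) - B * (x * y) = a * (1 - x\<^sup>2) - b * (x * y)"
    "- A * (x * y) + B * (1 - y\<^sup>2) = - a * (x * y) + b * (1 - y\<^sup>2)"
    "A * x + B * y = - a * x - b * y"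
    unfolding A_def B_def using xy by algebra+
  then show ?thesis
    unfolding plane_pt_def z2 f A_def[symmetric] B_def[symmetric]
    by (simp add: vec_eq_iff forall_3 a_def b_def algebra_simps)
qed

lemma no_flip_field:
  fixes f g :: "'p \<Rightarrow> real^3 \<Rightarrow> real"
  assumes cont: "\<And>p. continuous_on UNIV (f p)" "\<And>p. continuous_on UNIV (g p)"
    and rel: "\<And>w. norm w = 1 \<Longrightarrow> \<exists>u. norm u = 1 \<and> u \<bullet> w = 0 \<and> flip_related f g w u"
    and nosym: "\<And>w. norm w = 1 \<Longrightarrow> \<exists>p x. x \<bullet> w = 0 \<and> f p (- x) \<noteq> f p x"
  shows False
proof (rule no_reflection_field_disc[of "\<lambda>p z \<eta>. f p (plane_pt z \<eta>)" "\<lambda>p z \<eta>. g p (plane_pt z \<eta>)"])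
  have c: "continuous_on (cball 0 1 \<times> UNIV) (\<lambda>x. plane_pt (fst x) (snd x))"
    unfolding plane_pt_def
    by (intro continuous_intros continuous_on_compose2[OF continuous_on_frame(1)]
        continuous_on_compose2[OF continuous_on_frame(2)]) auto
  show "continuous_on (cball 0 1 \<times> UNIV) (\<lambda>x. f p (plane_pt (fst x) (snd x)))"
      "continuous_on (cball 0 1 \<times> UNIV) (\<lambda>x. g p (plane_pt (fst x) (snd x)))" for p
    using continuous_on_compose2[OF cont(1) c] continuous_on_compose2[OF cont(2) c] by auto
  fix z :: complex assume "z \<in> cball 0 1"
  then have z: "cmod z \<le> 1" by simp
  note H = hemi_frame[OF z] and P = plane_pt[OF z]
  obtain u where u: "norm u = 1" "u \<bullet> hemi z = 0" "flip_related f g (hemi z) u" using rel[OF H(1)] by blast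
  then obtain \<xi> where \<xi>: "u = plane_pt z \<xi>" using P(4) by blast
  then have "cmod \<xi> = 1" using u P(2) by simp
  moreover have "f p (plane_pt z (\<xi>\<^sup>2 * cnj \<eta>)) = g p (plane_pt z \<eta>)" for p \<eta>
    using u(3) P(3)[OF \<open>cmod \<xi> = 1\<close>, of \<eta>] P(1)[of \<eta>] unfolding flip_related_def \<xi> by metis
  \<comment> \<open>The multiplier \<xi>^2 does not change when the axis \<xi> is replaced by -
    \<xi>.\<close>
  ultimately show "\<exists>Y. cmod Y = 1 \<and> (\<forall>p \<eta>. f p (plane_pt z (Y * cnj \<eta>)) = g p (plane_pt z \<eta>))"
    by (intro exI[of _ "\<xi>\<^sup>2"]) (auto simp: norm_power)
  obtain p x where px: "x \<bullet> hemi z = 0" "f p (- x) \<noteq> f p x" using nosym[OF H(1)] by blast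
  then obtain \<eta> where "x = plane_pt z \<eta>" using P(4) by blast
  moreover have "- plane_pt z \<eta> = plane_pt z (- \<eta>)" by (simp add: plane_pt_def)
  ultimately show "\<exists>p \<eta>. f p (plane_pt z (- \<eta>)) \<noteq> f p (plane_pt z \<eta>)" using px(2) by metis
qed (simp_all only: plane_pt_equator)

section \<open>Separating rotations from reflections\<close>

text \<open>The involution \<sigma> is the effect on the index \<open>p\<close> of reversing the
  axis that all sections share; it accompanies a reflection of the plane. The dense set
  \<open>D\<close> stands for the generic planes, from which closedness of both alternatives leads
  to all planes.\<close>

theorem rotated_or_flipped_sections:
  fixes f g :: "'p \<Rightarrow> real^3 \<Rightarrow> real"
  assumes cont: "\<And>p. continuous_on UNIV (f p)" "\<And>p. continuous_on UNIV (g p)"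
    and \<sigma>: "\<And>p. \<sigma> (\<sigma> p) = p"
    and D: "sphere 0 1 \<subseteq> closure D" "D \<subseteq> sphere 0 1"
    and rel: "\<And>w. w \<in> D \<Longrightarrow> (\<exists>t. rot_related f g w t) \<or>
      (\<exists>u. norm u = 1 \<and> u \<bullet> w = 0 \<and> flip_related f (\<lambda>p. g (\<sigma> p)) w u)"
    and nosym: "\<And>w. norm w = 1 \<Longrightarrow> \<exists>p x. x \<bullet> w = 0 \<and> f p (- x) \<noteq> f p x"
    and nosym': "\<And>w u. norm w = 1 \<Longrightarrow> norm u = 1 \<Longrightarrow> u \<bullet> w = 0 \<Longrightarrow>
      \<exists>p x. x \<bullet> w = 0 \<and> f p (axial_reflection u x) \<noteq> f (\<sigma> p) x"
  shows "(\<forall>p x. f p x = g p x) \<or> (\<forall>p x. f p (- x) = g p x)"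
proof -
  let ?S = "sphere 0 1 :: (real^3) set" and ?g = "\<lambda>p. g (\<sigma> p)"
  define R where "R = {w \<in> ?S. \<exists>t. rot_related f g w t}"
  define F where "F = {w \<in> ?S. \<exists>u. norm u = 1 \<and> u \<bullet> w = 0 \<and> flip_related f ?g w u}"
  have "closed R"
  proof -
    let ?A = "{x. norm (fst x) = 1 \<and> rot_related f g (fst x) (snd x)}"
    have "compact ((?S \<times> {0..2*pi}) \<inter> ?A)"
      by (intro compact_Int_closed compact_Times closed_rot_related cont) auto
    then have "compact (fst ` ((?S \<times> {0..2*pi}) \<inter> ?A))"
      by (intro compact_continuous_image continuous_intros)
    moreover have "fst ` ((?S \<times> {0..2*pi}) \<inter> ?A) = R"
    proof (intro equalityI subsetI)
      fix w assume "w \<in> R"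
      then obtain t where w: "w \<in> ?S" "rot_related f g w t" by (auto simp: R_def)
      \<comment> \<open>Reducing the angle to [0, 2 pi] makes the set of pairs compact, so that its
        projection to the normals is closed.\<close>
      define s where "s = t + 2 * pi * of_int (- \<lfloor>t / (2 * pi)\<rfloor>)"
      have "rot_related f g w s" using w(2) unfolding rot_related_def s_def rot_periodic .
      moreover have "s = 2 * pi * frac (t / (2 * pi))" by (simp add: s_def frac_def algebra_simps)
      then have "s \<in> {0..2*pi}" using frac_lt_1[of "t / (2*pi)"] frac_ge_0[of "t / (2*pi)"] by auto
      ultimately show "w \<in> fst ` ((?S \<times> {0..2*pi}) \<inter> ?A)"
        using w(1) by (intro image_eqI[of _ _ "(w, s)"]) auto
    qed (auto simp: R_def)
    ultimately show ?thesis using compact_imp_closed by metis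
  qed
  have "closed F"
  proof -
    let ?A = "{x. norm (fst x) = 1 \<and> norm (snd x) = 1 \<and> snd x \<bullet> fst x = 0 \<and> flip_related f ?g (fst x) (snd x)}"
    have "compact ((?S \<times> ?S) \<inter> ?A)"
      by (intro compact_Int_closed compact_Times closed_flip_related cont) auto
    then have "compact (fst ` ((?S \<times> ?S) \<inter> ?A))"
      by (intro compact_continuous_image continuous_intros)
    moreover have "fst ` ((?S \<times> ?S) \<inter> ?A) = F"
    proof (intro equalityI subsetI)
      fix w assume "w \<in> F"
      then obtain u where "w \<in> ?S" "norm u = 1" "u \<bullet> w = 0" "flip_related f ?g w u" by (auto simp: F_def)
      then show "w \<in> fst ` ((?S \<times> ?S) \<inter> ?A)" by (intro image_eqI[of _ _ "(w, u)"]) auto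
    qed (auto simp: F_def)
    ultimately show ?thesis using compact_imp_closed by metis
  qed
  have "D \<subseteq> R \<union> F" using rel D(2) by (auto simp: R_def F_def)
  then have "closure D \<subseteq> R \<union> F" using \<open>closed R\<close> \<open>closed F\<close> by (intro closure_minimal closed_Un)
  then have cover: "?S \<subseteq> R \<union> F" using D(1) by blast
  have "R \<inter> F = {}"
  proof (rule ccontr)
    assume "R \<inter> F \<noteq> {}"
    then obtain w t u where w: "norm w = 1" and t: "rot_related f g w t"
      and u: "norm u = 1" "u \<bullet> w = 0" "flip_related f ?g w u"
      by (auto simp: R_def F_def)
    \<comment> \<open>If both relations hold, then undoing the rotation before the reflection
      relates \<open>f\<close> to itself, with the index changed by \<sigma>. The composite is the
      reflection whose axis is \<open>u\<close> turned by t / 2, which \<open>nosym'\<close>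
      forbids.\<close>
    have "f p (axial_reflection (rot w (t/2) u) x) = f (\<sigma> p) x" if x: "x \<bullet> w = 0" for p x
    proof -
      let ?x = "rot w (- t) x"
      have x': "?x \<bullet> w = 0" using x by (rule rot_orthogonal)
      have "f p (axial_reflection (rot w (t/2) u) x) = f p (axial_reflection u ?x)"
        using axial_reflection_rot[OF w u(1,2) x, of "t/2"] by simp
      also have "\<dots> = g (\<sigma> p) ?x" using u(3) x' by (simp add: flip_related_def)
      also have "\<dots> = f (\<sigma> p) (rot w t ?x)" using t x' by (simp add: rot_related_def)
      finally show ?thesis using rot_rot[OF w x, of t "-t"] by simp
    qed
    moreover have "norm (rot w (t/2) u) = 1" using norm_rot[OF w u(2)] u(1) by simp
    moreover have "rot w (t/2) u \<bullet> w = 0" using u(2) by (rule rot_orthogonal)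
    ultimately show False using nosym'[OF w, of "rot w (t/2) u"] by blast
  qed
  moreover have "connected ?S" by (rule connected_sphere) simp
  ultimately have "?S \<subseteq> R \<or> ?S \<subseteq> F"
    using connected_closedD[of ?S R F] \<open>closed R\<close> \<open>closed F\<close> cover by blast
  then show ?thesis
  proof
    assume "?S \<subseteq> R"
    then show ?thesis by (intro rotation_case cont nosym) (auto simp: R_def)
  next
    assume "?S \<subseteq> F"
    then have "\<exists>u. norm u = 1 \<and> u \<bullet> w = 0 \<and> flip_related f ?g w u" if "norm w = 1" for w
      using that by (auto simp: F_def)
    then show ?thesis using no_flip_field[OF cont(1) cont(2) _ nosym, of "\<lambda>p. \<sigma> p" ] by blast
  qed
qed

section \<open>Rotations of three-dimensional sections\<close>

text \<open>For a unit \<open>v\<close> this is the reflection in the hyperplane orthogonal to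
  \<open>v\<close>. Writing orthogonal maps as products of these makes their determinant a matter of
  parity.\<close>

definition reflect_along :: "'a::real_inner \<Rightarrow> 'a \<Rightarrow> 'a" where
  "reflect_along v x = x - (2 * (x \<bullet> v)) *\<^sub>R v"

lemma orthogonal_transformation_reflect_along:
  assumes "norm v = 1"
  shows "orthogonal_transformation (reflect_along v)"
proof -
  have "linear (reflect_along v)"
    by (rule linearI) (simp_all add: reflect_along_def inner_add_left algebra_simps)
  moreover have "reflect_along v x \<bullet> reflect_along v y = x \<bullet> y" for x y
    using assms by (simp add: reflect_along_def inner_diff_left inner_diff_right norm_eq_1
        inner_commute[of v y])
  ultimately show ?thesis by (simp add: orthogonal_transformation_def)
qed

text \<open>An orthogonal map taking a coordinate vector to \<open>v\<close> conjugates the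
  reflection to a diagonal one with a single entry -1.\<close>

lemma det_reflect_along:
  fixes v :: "real^'n"
  assumes "norm v = 1"
  shows "det (matrix (reflect_along v)) = -1"
proof -
  obtain k :: 'n where True by simp
  define e :: "real^'n" where "e = axis k 1"
  have e: "norm e = 1" by (simp add: e_def norm_axis_1)
  then obtain \<phi> where \<phi>: "orthogonal_transformation \<phi>" "\<phi> e = v"
    using orthogonal_transformation_exists[of e v] assms by metis
  have lin: "linear \<phi>" "linear (reflect_along v)" "linear (reflect_along e)"
    using \<phi>(1) orthogonal_transformation_reflect_along e assms
    by (auto simp: orthogonal_transformation_def)
  have "reflect_along v \<circ> \<phi> = \<phi> \<circ> reflect_along e"
  proof
    fix x
    have "\<phi> x \<bullet> v = x \<bullet> e" using \<phi> by (auto simp: orthogonal_transformation_def)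
    then show "(reflect_along v \<circ> \<phi>) x = (\<phi> \<circ> reflect_along e) x"
      by (simp add: reflect_along_def linear_diff[OF lin(1)] linear_scale[OF lin(1)] \<phi>(2))
  qed
  then have "det (matrix (reflect_along v)) * det (matrix \<phi>)
      = det (matrix \<phi>) * det (matrix (reflect_along e))"
    using matrix_compose[OF lin(1,2)] matrix_compose[OF lin(3,1)] by (metis det_mul)
  moreover have "det (matrix \<phi>) \<noteq> 0" using orthogonal_transformation_det[OF \<phi>(1)] by auto
  moreover have "det (matrix (reflect_along e)) = -1"
  proof -
    have m: "matrix (reflect_along e) $ i $ j = (if i = j then if i = k then -1 else 1 else 0)" for i j
      by (simp add: matrix_def reflect_along_def e_def inner_axis_axis) (auto simp: axis_def)
    have "det (matrix (reflect_along e)) = (\<Prod>i\<in>UNIV. if i = k then -1 else 1 :: real)"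
      by (subst det_diagonal) (simp_all add: m)
    then show ?thesis by simp
  qed
  ultimately have "det (matrix (reflect_along v)) * det (matrix \<phi>) = -1 * det (matrix \<phi>)"
    and "det (matrix \<phi>) \<noteq> 0" by simp_all
  then show ?thesis by (metis mult_right_cancel)
qed

lemma det_compose_reflect_along:
  fixes v :: "real^'n"
  assumes "norm v = 1" "linear \<phi>"
  shows "det (matrix (reflect_along v \<circ> \<phi>)) = - det (matrix \<phi>)"
  using matrix_compose[OF assms(2), of "reflect_along v"] assms
    orthogonal_transformation_reflect_along[OF assms(1)]
  by (simp add: det_mul det_reflect_along orthogonal_transformation_def)

lemma linear_eq_if_eq_on_subspace_and_complement:
  fixes \<phi> \<psi> :: "'a::euclidean_space \<Rightarrow> 'b::real_vector"
  assumes "subspace H" "linear \<phi>" "linear \<psi>" "\<And>h. h \<in> H \<Longrightarrow> \<phi> h = \<psi> h"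
    and "\<And>k. (\<And>h. h \<in> H \<Longrightarrow> orthogonal k h) \<Longrightarrow> \<phi> k = \<psi> k"
  shows "\<phi> = \<psi>"
proof
  fix x
  obtain h k where hk: "h \<in> span H" "\<And>w. w \<in> span H \<Longrightarrow> orthogonal k w" "x = h + k"
    using orthogonal_subspace_decomp_exists by blast
  then show "\<phi> x = \<psi> x" using assms by (simp add: linear_add span_eq_iff[THEN iffD2])
qed

lemma in_subspace_if_orthogonal_to_complement:
  fixes x :: "'a::euclidean_space"
  assumes "subspace H" "\<And>k. (\<And>h. h \<in> H \<Longrightarrow> orthogonal k h) \<Longrightarrow> orthogonal x k"
  shows "x \<in> H"
proof -
  have sH: "span H = H" using assms(1) by (simp add: span_eq_iff)
  obtain h k where hk: "h \<in> span H" "\<And>w. w \<in> span H \<Longrightarrow> orthogonal k w" "x = h + k"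
    using orthogonal_subspace_decomp_exists by blast
  then have "orthogonal x k" "orthogonal k h" using assms sH by auto
  then have "k \<bullet> k = 0" using hk(3) by (simp add: orthogonal_def inner_add_left inner_add_right inner_commute)
  then show ?thesis using hk sH by simp
qed

lemma SO_on_maps_into:
  assumes "subspace H" "\<phi> \<in> SO_on H" "h \<in> H"
  shows "\<phi> h \<in> H"
proof (rule in_subspace_if_orthogonal_to_complement[OF assms(1)])
  fix k assume k: "\<And>h. h \<in> H \<Longrightarrow> orthogonal k h"
  then have "\<phi> k = k" using assms(2) by (simp add: SO_on_def)
  then have "\<phi> h \<bullet> k = h \<bullet> k" using assms(2) by (metis (mono_tags) SO_on_def mem_Collect_eq orthogonal_transformation_def)
  then show "orthogonal (\<phi> h) k" using k[OF assms(3)] by (simp add: orthogonal_def inner_commute)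
qed

lemma axial_reflection_involution:
  assumes "norm u = 1"
  shows "axial_reflection u (axial_reflection u x) = x"
  using assms by (simp add: axial_reflection_def inner_diff_left norm_eq_1)

lemma norm_axial_reflection:
  assumes "norm u = 1"
  shows "norm (axial_reflection u x) = norm x"
  using axial_reflection_characterization[OF assms, of "axial_reflection u"]
  by (simp add: orthogonal_transformation)

lemma axial_reflection_combination:
  assumes "norm u = 1" "v \<bullet> u = 0"
  shows "axial_reflection u (a *\<^sub>R u + b *\<^sub>R v) = a *\<^sub>R u - b *\<^sub>R v"
proof -
  have "(a *\<^sub>R u + b *\<^sub>R v) \<bullet> u = a" using assms by (simp add: inner_add_left norm_eq_1)
  moreover have "(2 * a) *\<^sub>R u = a *\<^sub>R u + a *\<^sub>R u" by (simp only: mult_2 scaleR_left_distrib)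
  ultimately show ?thesis by (simp add: axial_reflection_def)
qed

section \<open>Three-dimensional subspaces containing the axis\<close>

text \<open>\<iota> is an isometric copy of three-space inside the hyperplane orthogonal to \<zeta>.
  It makes the cross product available there: a unit \<open>w\<close> in three-space is the normal
  of a plane, and this plane together with \<zeta> spans the subspace \<open>hsub w\<close>.\<close>

locale embedded_space =
  fixes \<zeta> :: "real^'n" and \<iota> :: "real^3 \<Rightarrow> real^'n"
  assumes norm_\<zeta>: "norm \<zeta> = 1" and linear_\<iota>: "linear \<iota>"
    and inner_\<iota>: "\<iota> x \<bullet> \<iota> y = x \<bullet> y" and \<iota>_\<zeta>: "\<iota> x \<bullet> \<zeta> = 0"
begin

lemma \<iota>_simps: "\<iota> (x + y) = \<iota> x + \<iota> y" "\<iota> (x - y) = \<iota> x - \<iota> y" "\<iota> (c *\<^sub>R x) = c *\<^sub>R \<iota> x" "\<iota> (- x) = - \<iota> x" "\<iota> 0 = 0"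
  using linear_\<iota> by (simp_all add: linear_add linear_diff linear_scale linear_neg linear_0)

lemma \<zeta>_simps: "\<zeta> \<bullet> \<zeta> = 1" "\<zeta> \<bullet> \<iota> x = 0"
  using norm_\<zeta> \<iota>_\<zeta>[of x] by (simp_all add: norm_eq_1 inner_commute)

lemma norm_\<iota>: "norm (\<iota> x) = norm x"
  by (simp add: norm_eq_sqrt_inner inner_\<iota>)

lemma \<iota>_eq_iff: "\<iota> x = \<iota> y \<longleftrightarrow> x = y"
  using norm_\<iota>[of "x - y"] by (simp add: \<iota>_simps(2)) (metis eq_iff_diff_eq_0 norm_eq_zero)

lemma \<zeta>_\<iota>_eq_iff: "a *\<^sub>R \<zeta> + \<iota> x = b *\<^sub>R \<zeta> + \<iota> y \<longleftrightarrow> a = b \<and> x = y"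
proof
  assume eq: "a *\<^sub>R \<zeta> + \<iota> x = b *\<^sub>R \<zeta> + \<iota> y"
  then have "(a *\<^sub>R \<zeta> + \<iota> x) \<bullet> \<zeta> = (b *\<^sub>R \<zeta> + \<iota> y) \<bullet> \<zeta>" by simp
  then have "a = b" by (simp add: inner_add_left \<iota>_\<zeta> \<zeta>_simps)
  then show "a = b \<and> x = y" using eq \<iota>_eq_iff by simp
qed simp

definition hsub :: "real^3 \<Rightarrow> (real^'n) set" where
  "hsub w = {v. \<exists>a y. y \<bullet> w = 0 \<and> v = a *\<^sub>R \<zeta> + \<iota> y}"

lemma in_hsub [simp]: "a *\<^sub>R \<zeta> + \<iota> y \<in> hsub w \<longleftrightarrow> y \<bullet> w = 0"
  unfolding hsub_def using \<zeta>_\<iota>_eq_iff by auto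

lemma \<zeta>_in_hsub: "a *\<^sub>R \<zeta> \<in> hsub w" "\<zeta> \<in> hsub w"
  using in_hsub[of a 0 w] in_hsub[of 1 0 w] by (simp_all add: \<iota>_simps del: in_hsub)

lemma \<iota>_in_hsub: "\<iota> y \<in> hsub w \<longleftrightarrow> y \<bullet> w = 0"
  using in_hsub[of 0 y w] by (simp del: in_hsub)

lemma subspace_hsub: "subspace (hsub w)"
  unfolding subspace_def
proof (intro conjI ballI allI)
  show "0 \<in> hsub w" using \<zeta>_in_hsub(1)[of 0] by simp
  fix x y assume "x \<in> hsub w" "y \<in> hsub w"
  then obtain a b p q where "x = a *\<^sub>R \<zeta> + \<iota> p" "y = b *\<^sub>R \<zeta> + \<iota> q" "p \<bullet> w = 0" "q \<bullet> w = 0"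
    by (auto simp: hsub_def)
  then have "x + y = (a + b) *\<^sub>R \<zeta> + \<iota> (p + q)" "(p + q) \<bullet> w = 0"
    by (simp_all add: \<iota>_simps inner_add_left algebra_simps)
  then show "x + y \<in> hsub w" by (simp del: \<zeta>_\<iota>_eq_iff)
next
  fix c x assume "x \<in> hsub w"
  then obtain a p where "x = a *\<^sub>R \<zeta> + \<iota> p" "p \<bullet> w = 0" by (auto simp: hsub_def)
  then have "c *\<^sub>R x = (c * a) *\<^sub>R \<zeta> + \<iota> (c *\<^sub>R p)" "(c *\<^sub>R p) \<bullet> w = 0"
    by (simp_all add: \<iota>_simps algebra_simps)
  then show "c *\<^sub>R x \<in> hsub w" by simp
qed

lemma dim_hsub:
  assumes w: "norm w = 1"
  shows "dim (hsub w) = 3"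
proof -
  obtain u where u: "norm u = 1" "u \<bullet> w = 0" using orthonormal_frame3[OF w] by blast
  let ?v = "cross3 w u"
  have v: "norm ?v = 1" using norm_cross3_orthogonal[OF w u(2)] u by simp
  have n: "norm (\<iota> u) = 1" "norm (\<iota> ?v) = 1" using u v by (simp_all add: norm_\<iota>)
  have o: "\<iota> u \<bullet> \<iota> ?v = 0" "\<iota> ?v \<bullet> \<iota> u = 0" by (simp_all add: inner_\<iota>)
  have ne: "\<zeta> \<noteq> \<iota> u" "\<zeta> \<noteq> \<iota> ?v" "\<iota> u \<noteq> \<iota> ?v"
    using \<zeta>_simps o n by (metis norm_\<zeta> \<iota>_\<zeta> zero_neq_one, metis \<zeta>_simps zero_neq_one, metis norm_eq_1 zero_neq_one)
  have "independent {\<zeta>, \<iota> u, \<iota> ?v}"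
  proof (rule pairwise_orthogonal_independent)
    show "pairwise orthogonal {\<zeta>, \<iota> u, \<iota> ?v}"
      by (auto simp: pairwise_def orthogonal_def \<zeta>_simps \<iota>_\<zeta> o)
    show "0 \<notin> {\<zeta>, \<iota> u, \<iota> ?v}" using n norm_\<zeta> by auto
  qed
  then have "dim (span {\<zeta>, \<iota> u, \<iota> ?v}) = card {\<zeta>, \<iota> u, \<iota> ?v}"
    by (rule dim_span_eq_card_independent)
  also have "\<dots> = 3" using ne by auto
  also have "span {\<zeta>, \<iota> u, \<iota> ?v} = hsub w"
  proof (intro equalityI)
    show "span {\<zeta>, \<iota> u, \<iota> ?v} \<subseteq> hsub w"
      by (rule span_minimal) (use subspace_hsub u in \<open>auto simp: \<zeta>_in_hsub \<iota>_in_hsub\<close>)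
    show "hsub w \<subseteq> span {\<zeta>, \<iota> u, \<iota> ?v}"
    proof
      fix h assume "h \<in> hsub w"
      then obtain a y where h: "h = a *\<^sub>R \<zeta> + \<iota> y" and y: "y \<bullet> w = 0" by (auto simp: hsub_def)
      have "\<iota> y = (y \<bullet> u) *\<^sub>R \<iota> u + (y \<bullet> ?v) *\<^sub>R \<iota> ?v"
        using plane_decomposition[OF w u y] by (metis \<iota>_simps(1,3))
      then show "h \<in> span {\<zeta>, \<iota> u, \<iota> ?v}" unfolding h
        by (simp only:) (intro span_add span_scale span_base; simp)
    qed
  qed
  finally show ?thesis .
qed

lemma reflect_along_simps:
  "reflect_along (\<iota> v) \<zeta> = \<zeta>" "reflect_along (\<iota> v) (\<iota> x) = \<iota> (reflect_along v x)"
  "reflect_along \<zeta> \<zeta> = - \<zeta>" "reflect_along \<zeta> (\<iota> x) = \<iota> x"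
  by (simp_all add: reflect_along_def \<iota>_simps inner_\<iota> \<zeta>_simps \<iota>_\<zeta> scaleR_2)

lemma reflect_along_fixes_complement:
  assumes "\<And>h. h \<in> H \<Longrightarrow> orthogonal k h" "v \<in> H"
  shows "reflect_along v k = k"
  using assms(1)[OF assms(2)] by (simp add: reflect_along_def orthogonal_def)

lemma reflect_along_eq_axial_reflection:
  assumes "norm w = 1" "norm u = 1" "u \<bullet> w = 0" "x \<bullet> w = 0"
  shows "reflect_along (cross3 w u) x = axial_reflection u x"
proof -
  have "x + x = (2 * (x \<bullet> u)) *\<^sub>R u + (2 * (x \<bullet> cross3 w u)) *\<^sub>R cross3 w u"
    using arg_cong[OF plane_decomposition[OF assms], of "\<lambda>y. 2 *\<^sub>R y"]
    by (simp only: scaleR_2[symmetric] scaleR_add_right scaleR_scaleR)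
  then show ?thesis by (simp add: reflect_along_def axial_reflection_def algebra_simps)
qed

text \<open>Preserving the line of \<zeta>, \<phi> restricts to an isometry of the plane, a rotation
  or a reflection according to the sign \<open>s\<close>. The determinant ties this sign to that of
  \<phi> on \<zeta>. Since it is the determinant on the whole space, each excluded combination is
  refuted by writing \<phi> as a product of an odd number of hyperplane reflections.\<close>

lemma SO_on_classification:
  assumes w: "norm w = 1" and \<phi>: "\<phi> \<in> SO_on (hsub w)" and pm: "\<phi> \<zeta> = \<zeta> \<or> \<phi> \<zeta> = - \<zeta>"
  obtains t where "\<phi> \<zeta> = \<zeta>" "\<And>x. x \<bullet> w = 0 \<Longrightarrow> \<phi> (\<iota> x) = \<iota> (rot w t x)"
  | u where "norm u = 1" "u \<bullet> w = 0" "\<phi> \<zeta> = - \<zeta>" "\<And>x. x \<bullet> w = 0 \<Longrightarrow> \<phi> (\<iota> x) = \<iota> (axial_reflection u x)"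
proof -
  have ot: "orthogonal_transformation \<phi>" and det: "det (matrix \<phi>) = 1"
    and fix_compl: "\<And>k. (\<And>h. h \<in> hsub w \<Longrightarrow> orthogonal k h) \<Longrightarrow> \<phi> k = k"
    using \<phi> by (auto simp: SO_on_def)
  have lin: "linear \<phi>" and ip: "\<And>x y. \<phi> x \<bullet> \<phi> y = x \<bullet> y" using ot by (auto simp: orthogonal_transformation_def)
  have into: "\<exists>y. y \<bullet> w = 0 \<and> \<phi> (\<iota> x) = \<iota> y" if "x \<bullet> w = 0" for x
  proof -
    have "\<phi> (\<iota> x) \<in> hsub w" using SO_on_maps_into[OF subspace_hsub \<phi>] that by (simp add: \<iota>_in_hsub)
    then obtain a y where y: "y \<bullet> w = 0" "\<phi> (\<iota> x) = a *\<^sub>R \<zeta> + \<iota> y" by (auto simp: hsub_def)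
    have "\<phi> (\<iota> x) \<bullet> \<phi> \<zeta> = 0" by (simp add: ip \<iota>_\<zeta>)
    then have "a = 0" using pm y(2) by (auto simp: inner_add_left \<zeta>_simps \<iota>_\<zeta>)
    then show ?thesis using y by auto
  qed
  obtain u where u: "norm u = 1" "u \<bullet> w = 0" using orthonormal_frame3[OF w] by blast
  let ?v = "cross3 w u"
  have v: "norm ?v = 1" "?v \<bullet> w = 0" using norm_cross3_orthogonal[OF w u(2)] u by simp_all
  have wv: "cross3 w ?v = - u" using cross3_cross3_orthogonal[OF w u(2)] .
  obtain y where y: "y \<bullet> w = 0" "\<phi> (\<iota> u) = \<iota> y" using into[OF u(2)] by blast
  obtain y' where y': "y' \<bullet> w = 0" "\<phi> (\<iota> ?v) = \<iota> y'" using into[OF v(2)] by blast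
  have ny: "norm y = 1" using ip[of "\<iota> u" "\<iota> u"] u by (simp add: y inner_\<iota> norm_eq_1)
  have ny': "norm y' = 1" using ip[of "\<iota> ?v" "\<iota> ?v"] v by (simp add: y' inner_\<iota> norm_eq_1)
  have yy: "y' \<bullet> y = 0" using ip[of "\<iota> ?v" "\<iota> u"] by (simp add: y y' inner_\<iota>)
  obtain t where t: "y = rot w t u"
  proof -
    have d: "y = (y \<bullet> u) *\<^sub>R u + (y \<bullet> ?v) *\<^sub>R ?v" by (rule plane_decomposition[OF w u y(1)])
    obtain r t where rt: "r = sqrt ((y \<bullet> u)\<^sup>2 + (y \<bullet> ?v)\<^sup>2)" "y \<bullet> u = r * cos t" "y \<bullet> ?v = r * sin t"
      using polar_coordinates_exist by blast
    have yy2: "y \<bullet> y = (y \<bullet> u)\<^sup>2 + (y \<bullet> ?v)\<^sup>2"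
      by (subst (2) d) (simp add: inner_add_right power2_eq_square)
    have "norm y = r" unfolding norm_eq_sqrt_inner yy2 by (rule rt(1)[symmetric])
    then have "r = 1" using ny by simp
    have "y = rot w t u" using d unfolding rt(2,3) \<open>r = 1\<close> rot_def mult_1 .
    then show ?thesis by (rule that)
  qed
  define s where "s = y' \<bullet> cross3 w y"
  have y's: "y' = s *\<^sub>R cross3 w y"
    using plane_decomposition[OF w ny y(1) y'(1)] unfolding yy s_def by simp
  have "\<bar>s\<bar> = 1" using ny' norm_cross3_orthogonal[OF w y(1)] ny unfolding y's by simp
  then have s: "s = 1 \<or> s = -1" by linarith
  have \<phi>x: "\<phi> (\<iota> x) = \<iota> ((x \<bullet> u) *\<^sub>R y + (x \<bullet> ?v) *\<^sub>R y')" if "x \<bullet> w = 0" for x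
  proof -
    have "\<iota> x = (x \<bullet> u) *\<^sub>R \<iota> u + (x \<bullet> ?v) *\<^sub>R \<iota> ?v"
      using plane_decomposition[OF w u that] by (metis \<iota>_simps(1,3))
    then show ?thesis by (simp add: linear_add[OF lin] linear_scale[OF lin] y y' \<iota>_simps)
  qed
  have rotx: "\<phi> (\<iota> x) = \<iota> (rot w t x)" if "s = 1" "x \<bullet> w = 0" for x
  proof -
    have "rot w t x = (x \<bullet> u) *\<^sub>R rot w t u + (x \<bullet> ?v) *\<^sub>R rot w t ?v"
      by (subst plane_decomposition[OF w u that(2)])
        (simp add: rot_def cross_add_right cross_mult_right algebra_simps)
    also have "rot w t ?v = y'" unfolding y's t using that(1)
      by (simp add: rot_def cross_add_right cross_mult_right)
    finally show ?thesis using \<phi>x[OF that(2)] t by simp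
  qed
  let ?u = "rot w (t / 2) u"
  have nu: "norm ?u = 1" "?u \<bullet> w = 0" using norm_rot[OF w u(2)] u rot_orthogonal by auto
  have axx: "\<phi> (\<iota> x) = \<iota> (axial_reflection ?u x)" if "s = -1" "x \<bullet> w = 0" for x
  proof -
    have "axial_reflection ?u x = axial_reflection u (rot w (- t) x)"
      using axial_reflection_rot[OF w u that(2), of "t / 2"] by simp
    also have "rot w (- t) x = (x \<bullet> u) *\<^sub>R rot w (- t) u + (x \<bullet> ?v) *\<^sub>R rot w (- t) ?v"
      by (subst plane_decomposition[OF w u that(2)])
        (simp add: rot_def cross_add_right cross_mult_right algebra_simps)
    also have "axial_reflection u \<dots> = (x \<bullet> u) *\<^sub>R axial_reflection u (rot w (- t) u)
        + (x \<bullet> ?v) *\<^sub>R axial_reflection u (rot w (- t) ?v)"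
      by (simp add: axial_reflection_def inner_add_left algebra_simps)
    also have "axial_reflection u (rot w (- t) u) = y"
      using axial_reflection_combination[OF u(1), of ?v "cos t" "- sin t"] by (simp add: t rot_def)
    also have "axial_reflection u (rot w (- t) ?v) = y'"
      using axial_reflection_combination[OF u(1), of ?v "sin t" "cos t"] \<open>s = -1\<close>
      by (simp add: y's t rot_def wv cross_add_right cross_mult_right add.commute)
    finally show ?thesis using \<phi>x[OF that(2)] by simp
  qed
  have lh: "linear (reflect_along v)" if "norm v = 1" for v :: "real^'n"
    using orthogonal_transformation_reflect_along[OF that] by (simp add: orthogonal_transformation_def)
  have eqI: "\<phi> = \<psi>" if "linear \<psi>" "\<psi> \<zeta> = \<phi> \<zeta>" "\<And>x. x \<bullet> w = 0 \<Longrightarrow> \<psi> (\<iota> x) = \<phi> (\<iota> x)"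
    "\<And>k. (\<And>h. h \<in> hsub w \<Longrightarrow> orthogonal k h) \<Longrightarrow> \<psi> k = k" for \<psi>
  proof (rule linear_eq_if_eq_on_subspace_and_complement[OF subspace_hsub[of w] lin that(1)])
    fix h assume "h \<in> hsub w"
    then obtain a x where "x \<bullet> w = 0" "h = a *\<^sub>R \<zeta> + \<iota> x" by (auto simp: hsub_def)
    then show "\<phi> h = \<psi> h"
      using that(2,3) by (simp add: linear_add[OF lin] linear_scale[OF lin] linear_add[OF that(1)] linear_scale[OF that(1)])
  qed (use fix_compl that(4) in simp)
  have in_h: "\<iota> (cross3 w x) \<in> hsub w" for x by (simp add: \<iota>_in_hsub)
  show ?thesis
  proof (cases "s = 1")
    case True
    have "\<phi> \<zeta> = \<zeta>"
    proof (rule ccontr)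
      assume "\<phi> \<zeta> \<noteq> \<zeta>"
      then have m: "\<phi> \<zeta> = - \<zeta>" using pm by blast
      \<comment> \<open>The rotation by \<open>t\<close> is the product of the plane reflections
        with axes \<open>?u'\<close> and \<open>u\<close>, which are t / 2 apart. Together with the
        reversal of \<zeta> these are three hyperplane reflections.\<close>
      let ?u' = "rot w (- (t / 2)) u"
      have nu': "norm ?u' = 1" "?u' \<bullet> w = 0" using norm_rot[OF w u(2)] u rot_orthogonal by auto
      have nc: "norm (\<iota> (cross3 w u)) = 1" "norm (\<iota> (cross3 w ?u')) = 1"
        using v norm_cross3_orthogonal[OF w nu'(2)] nu' by (simp_all add: norm_\<iota>)
      let ?\<psi>1 = "reflect_along (\<iota> (cross3 w ?u'))"
      let ?\<psi>2 = "reflect_along (\<iota> (cross3 w u)) \<circ> ?\<psi>1"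
      let ?\<psi> = "reflect_along \<zeta> \<circ> ?\<psi>2"
      have l1: "linear ?\<psi>1" "linear ?\<psi>2" "linear ?\<psi>" using lh nc norm_\<zeta> by (auto intro: linear_compose)
      have "\<phi> = ?\<psi>"
      proof (rule eqI[OF l1(3)])
        show "?\<psi> \<zeta> = \<phi> \<zeta>" by (simp add: reflect_along_simps m)
        show "?\<psi> (\<iota> x) = \<phi> (\<iota> x)" if x: "x \<bullet> w = 0" for x
        proof -
          have o: "axial_reflection ?u' x \<bullet> w = 0"
            using x nu'(2) by (simp add: axial_reflection_def inner_diff_left)
          have "?\<psi> (\<iota> x) = \<iota> (axial_reflection u (axial_reflection ?u' x))"
            using reflect_along_eq_axial_reflection[OF w nu' x]
              reflect_along_eq_axial_reflection[OF w u o]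
            by (simp add: reflect_along_simps)
          also have "axial_reflection ?u' x = axial_reflection u (rot w t x)"
            using axial_reflection_rot[OF w u x, of "- (t / 2)"] by simp
          also have "axial_reflection u (axial_reflection u (rot w t x)) = rot w t x"
            by (rule axial_reflection_involution[OF u(1)])
          finally show ?thesis using rotx[OF True x] by simp
        qed
        show "?\<psi> k = k" if "\<And>h. h \<in> hsub w \<Longrightarrow> orthogonal k h" for k
          using reflect_along_fixes_complement[OF that] in_h \<zeta>_in_hsub by simp
      qed
      then have "det (matrix \<phi>) = -1"
        using det_compose_reflect_along[OF norm_\<zeta> l1(2)] det_compose_reflect_along[OF nc(1) l1(1)]
          det_reflect_along[OF nc(2)] by simp
      then show False using det by simp
    qed
    then show ?thesis using rotx[OF True] that(1) by blast
  next
    case False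
    then have sm: "s = -1" using s by blast
    have "\<phi> \<zeta> = - \<zeta>"
    proof (rule ccontr)
      assume "\<phi> \<zeta> \<noteq> - \<zeta>"
      then have p: "\<phi> \<zeta> = \<zeta>" using pm by blast
      have nc: "norm (\<iota> (cross3 w ?u)) = 1"
        using norm_cross3_orthogonal[OF w nu(2)] nu by (simp add: norm_\<iota>)
      \<comment> \<open>A plane reflection that fixes \<zeta> is a single hyperplane reflection,
        along the normal of its axis within the plane.\<close>
      have "\<phi> = reflect_along (\<iota> (cross3 w ?u))"
      proof (rule eqI[OF lh[OF nc]])
        show "reflect_along (\<iota> (cross3 w ?u)) (\<iota> x) = \<phi> (\<iota> x)" if "x \<bullet> w = 0" for x
          using reflect_along_eq_axial_reflection[OF w nu that] axx[OF sm that]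
          by (simp add: reflect_along_simps)
        show "reflect_along (\<iota> (cross3 w ?u)) k = k" if "\<And>h. h \<in> hsub w \<Longrightarrow> orthogonal k h" for k
          using reflect_along_fixes_complement[OF that] in_h by simp
      qed (simp add: reflect_along_simps p)
      then show False using det det_reflect_along[OF nc] by simp
    qed
    then show ?thesis using axx[OF sm] nu that(2) by blast
  qed
qed

lemma double_reflection_in_SO_on:
  assumes "norm v = 1" "norm v' = 1" "v \<in> hsub w" "v' \<in> hsub w"
  shows "reflect_along v \<circ> reflect_along v' \<in> SO_on (hsub w)"
  unfolding SO_on_def
proof (intro CollectI conjI allI impI)
  note o = assms(1,2)[THEN orthogonal_transformation_reflect_along]
  show "orthogonal_transformation (reflect_along v \<circ> reflect_along v')"
    using o by (intro orthogonal_transformation_compose)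
  show "det (matrix (reflect_along v \<circ> reflect_along v')) = 1"
    using det_compose_reflect_along[OF assms(1), of "reflect_along v'"] o(2)
      det_reflect_along[OF assms(2)]
    by (simp add: orthogonal_transformation_def)
  fix k assume "\<forall>h\<in>hsub w. orthogonal k h"
  then show "(reflect_along v \<circ> reflect_along v') k = k"
    using reflect_along_fixes_complement[of "hsub w" k] assms(3,4) by simp
qed

lemma half_turn_about_\<zeta>:
  assumes w: "norm w = 1"
  obtains \<phi> where "\<phi> \<in> SO_on (hsub w)" "\<phi> \<zeta> = \<zeta>" "\<And>x. x \<bullet> w = 0 \<Longrightarrow> \<phi> (\<iota> x) = \<iota> (- x)"
proof -
  obtain u where u: "norm u = 1" "u \<bullet> w = 0" using orthonormal_frame3[OF w] by blast
  let ?\<phi> = "reflect_along (\<iota> u) \<circ> reflect_along (\<iota> (cross3 w u))"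
  show ?thesis
  proof (rule that[of ?\<phi>])
    show "?\<phi> \<in> SO_on (hsub w)"
      using norm_cross3_orthogonal[OF w u(2)] u
      by (intro double_reflection_in_SO_on) (simp_all add: norm_\<iota> \<iota>_in_hsub)
    show "?\<phi> (\<iota> x) = \<iota> (- x)" if x: "x \<bullet> w = 0" for x
    proof -
      have "?\<phi> (\<iota> x) = \<iota> (reflect_along u (axial_reflection u x))"
        using reflect_along_eq_axial_reflection[OF w u x] by (simp add: reflect_along_simps)
      also have "reflect_along u (axial_reflection u x) = - x"
        using u by (simp add: reflect_along_def axial_reflection_def inner_diff_left norm_eq_1)
      finally show ?thesis .
    qed
  qed (simp add: reflect_along_simps)
qed

lemma half_turn_about_\<iota>:
  assumes w: "norm w = 1" and u: "norm u = 1" "u \<bullet> w = 0"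
  obtains \<phi> where "\<phi> \<in> SO_on (hsub w)" "\<phi> \<zeta> = - \<zeta>" "\<And>x. x \<bullet> w = 0 \<Longrightarrow> \<phi> (\<iota> x) = \<iota> (axial_reflection u x)"
proof (rule that[of "reflect_along \<zeta> \<circ> reflect_along (\<iota> (cross3 w u))"])
  show "reflect_along \<zeta> \<circ> reflect_along (\<iota> (cross3 w u)) \<in> SO_on (hsub w)"
    using norm_cross3_orthogonal[OF w u(2)] u
    by (intro double_reflection_in_SO_on) (simp_all add: norm_\<iota> norm_\<zeta> \<iota>_in_hsub \<zeta>_in_hsub)
  show "(reflect_along \<zeta> \<circ> reflect_along (\<iota> (cross3 w u))) (\<iota> x) = \<iota> (axial_reflection u x)"
    if x: "x \<bullet> w = 0" for x
    using reflect_along_eq_axial_reflection[OF w u x] by (simp add: reflect_along_simps)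
qed (simp add: reflect_along_simps)

end

section \<open>Half slices of star bodies\<close>

lemma star_body_0:
  assumes "star_body K"
  shows "0 \<in> K"
proof -
  have "K \<noteq> {}" using assms interior_subset by (auto simp: star_body_def body_def)
  then obtain y where "y \<in> K" by auto
  then have "closed_segment 0 y \<subseteq> K" using assms by (auto simp: star_body_def star_shaped_origin_def)
  then show ?thesis using ends_in_segment(1)[of 0 y] by blast
qed

lemma star_body_scaleR:
  assumes "star_body K" "y \<in> K" "0 \<le> t" "t \<le> 1"
  shows "t *\<^sub>R y \<in> K"
proof -
  have "t *\<^sub>R y \<in> closed_segment 0 y" using assms(3,4) by (auto simp: closed_segment_def)
  then show ?thesis using assms(1,2) unfolding star_body_def star_shaped_origin_def by blast
qed

lemma star_body_radial_iff:
  assumes K: "star_body K" and "x \<noteq> 0" "0 \<le> c"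
  shows "c *\<^sub>R x \<in> K \<longleftrightarrow> c \<le> radial K x"
proof
  assume c: "c \<le> radial K x"
  show "c *\<^sub>R x \<in> K"
  proof (cases "c = 0")
    case False
    then have "radial K x > 0" using c \<open>0 \<le> c\<close> by linarith
    then show ?thesis
      using star_body_scaleR[OF K radial_greatest(1)[OF K \<open>x \<noteq> 0\<close>], of "c / radial K x"] c \<open>0 \<le> c\<close> by simp
  qed (simp add: star_body_0[OF K])
qed (use radial_greatest(2)[OF K \<open>x \<noteq> 0\<close>] in blast)

lemma radial_nonneg:
  assumes "star_body K" "x \<noteq> 0"
  shows "0 \<le> radial K x"
  using star_body_radial_iff[OF assms, of 0] star_body_0[OF assms(1)] by simp

text \<open>By uniform continuity on the compact product, a small change of the parameter moves all
  points of the image by less than e / 2, and the distance to the image changes by at most that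
  much.\<close>

lemma continuous_on_infdist_image:
  fixes m :: "'a::metric_space \<Rightarrow> 'b::metric_space \<Rightarrow> 'c::heine_borel"
  assumes X: "compact X" and C: "compact C" "C \<noteq> {}"
    and cont: "continuous_on (X \<times> C) (\<lambda>(x, c). m x c)"
  shows "continuous_on X (\<lambda>x. infdist p (m x ` C))"
  unfolding continuous_on_iff
proof (intro ballI allI impI)
  fix x e assume x: "x \<in> X" and "(0::real) < e"
  have "uniformly_continuous_on (X \<times> C) (\<lambda>(x, c). m x c)"
    by (intro compact_uniformly_continuous cont compact_Times X C)
  then obtain d where "d > 0" and d: "\<And>y z. y \<in> X \<times> C \<Longrightarrow> z \<in> X \<times> C \<Longrightarrow> dist z y < d \<Longrightarrow>
      dist (case z of (x, c) \<Rightarrow> m x c) (case y of (x, c) \<Rightarrow> m x c) < e / 2"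
    using \<open>0 < e\<close> unfolding uniformly_continuous_on_def by (meson half_gt_zero)
  have le: "infdist p (m x ` C) \<le> infdist p (m y ` C) + e / 2"
    if xy: "x \<in> X" "y \<in> X" "dist x y < d" for x y
  proof -
    have "continuous_on C (m y)"
    proof -
      have "continuous_on C (\<lambda>c. (y, c))" by (intro continuous_intros)
      then show ?thesis using continuous_on_compose2[OF cont, of C "\<lambda>c. (y, c)"] xy(2) by auto
    qed
    then have "closed (m y ` C)" by (intro compact_imp_closed compact_continuous_image C)
    then obtain c where c: "c \<in> C" "infdist p (m y ` C) = dist p (m y c)"
      using infdist_attains_inf[of "m y ` C" p] C(2) by auto
    have "infdist p (m x ` C) \<le> dist p (m x c)" using c(1) by (intro infdist_le) auto
    also have "\<dots> \<le> dist p (m y c) + dist (m x c) (m y c)" by metric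
    also have "dist (m x c) (m y c) < e / 2" using d[of "(y, c)" "(x, c)"] xy c(1) by (simp add: dist_Pair_Pair)
    finally show ?thesis using c(2) by simp
  qed
  show "\<exists>d>0. \<forall>x'\<in>X. dist x' x < d \<longrightarrow> dist (infdist p (m x' ` C)) (infdist p (m x ` C)) < e"
  proof (intro exI conjI ballI impI)
    fix y assume "y \<in> X" "dist y x < d"
    then show "dist (infdist p (m y ` C)) (infdist p (m x ` C)) < e"
      using le[of x y] le[of y x] x \<open>0 < e\<close> by (simp add: dist_real_def dist_commute abs_less_iff)
  qed (rule \<open>d > 0\<close>)
qed

text \<open>The directions form a compact set, so \<open>h\<close> is bounded on them and the factor
  \<open>norm v\<close> forces the limit 0 at the origin.\<close>

lemma continuous_on_homogeneous_extension:
  fixes h :: "'a::euclidean_space \<Rightarrow> real"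
  assumes S: "subspace S" and h: "continuous_on (sphere 0 1 \<inter> S) h"
  shows "continuous_on S (\<lambda>v. norm v * h (v /\<^sub>R norm v))"
  unfolding continuous_on_eq_continuous_within
proof
  fix v assume v: "v \<in> S"
  have dir: "w /\<^sub>R norm w \<in> sphere 0 1 \<inter> S" if "w \<in> S" "w \<noteq> 0" for w
    using that subspace_scale[OF S] by simp
  show "continuous (at v within S) (\<lambda>v. norm v * h (v /\<^sub>R norm v))"
  proof (cases "v = 0")
    case False
    have im: "(\<lambda>v. v /\<^sub>R norm v) ` (S - {0}) \<subseteq> sphere 0 1 \<inter> S" using dir by blast
    have c0: "continuous_on (S - {0}) (\<lambda>v. v /\<^sub>R norm v)" by (intro continuous_intros) auto
    have "continuous_on (S - {0}) (\<lambda>v. norm v * h (v /\<^sub>R norm v))"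
      by (intro continuous_on_mult continuous_on_norm continuous_on_id continuous_on_compose2[OF h c0 im])
    then have "continuous (at v within S - {0}) (\<lambda>v. norm v * h (v /\<^sub>R norm v))"
      using v False by (simp add: continuous_on_eq_continuous_within)
    moreover have "at v within S - {0} = at v within S"
      by (rule at_within_nhd[of _ "- {0}"]) (use False in auto)
    ultimately show ?thesis by simp
  next
    case True
    have "compact (sphere 0 1 \<inter> S)" using closed_subspace[OF S] by (intro compact_Int_closed) auto
    then have "bounded (h ` (sphere 0 1 \<inter> S))" by (intro compact_imp_bounded compact_continuous_image h)
    then obtain B where "\<forall>y \<in> h ` (sphere 0 1 \<inter> S). norm y \<le> B" unfolding bounded_iff by blast
    then have B: "\<And>w. w \<in> sphere 0 1 \<inter> S \<Longrightarrow> \<bar>h w\<bar> \<le> B" by auto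
    have "((\<lambda>v. norm v * h (v /\<^sub>R norm v)) \<longlongrightarrow> 0) (at 0 within S)"
    proof (rule Lim_null_comparison)
      have "norm (norm w * h (w /\<^sub>R norm w)) \<le> norm w * B" if "w \<in> S" for w
        using B[OF dir[OF that]] by (cases "w = 0") (auto simp: abs_mult intro: mult_left_mono)
      then show "eventually (\<lambda>w. norm (norm w * h (w /\<^sub>R norm w)) \<le> norm w * B) (at 0 within S)"
        by (auto simp: eventually_at_filter)
      have "((\<lambda>w. norm w * B) \<longlongrightarrow> norm (0::'a) * B) (at 0 within S)" by (intro tendsto_intros)
      then show "((\<lambda>w. norm w * B) \<longlongrightarrow> 0) (at 0 within S)" by simp
    qed
    then show ?thesis using True by (simp add: continuous_within)
  qed
qed

text \<open>Coordinates in the half plane that is bounded by the axis and contains \<open>v\<close>: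
  the height above the level \<open>c\<close> on the axis, and the distance from the axis in units
  of \<open>v\<close>. Half planes, unlike full planes, distinguish \<open>v\<close> from
  \<open>- v\<close>.\<close>

definition half_slice :: "'a::real_vector \<Rightarrow> 'a set \<Rightarrow> real \<Rightarrow> 'a \<Rightarrow> (real \<times> real) set" where
  "half_slice \<zeta> K c v = {q. 0 \<le> snd q \<and> (c + fst q) *\<^sub>R \<zeta> + snd q *\<^sub>R v \<in> K}"

text \<open>The distances from all \<open>p\<close> determine a half slice; the factor \<open>norm v\<close> extends them
  continuously to \<open>v = 0\<close>.\<close>

definition section_dist :: "'a::real_normed_vector \<Rightarrow> 'a set \<Rightarrow> real \<Rightarrow> real \<times> real \<Rightarrow> 'a \<Rightarrow> real" where
  "section_dist \<zeta> K c p v = norm v * infdist p (half_slice \<zeta> K c (v /\<^sub>R norm v))"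

lemma half_slice_nonempty: "star_body K \<Longrightarrow> half_slice \<zeta> K c v \<noteq> {}"
  using star_body_0[of K] by (intro ex_in_conv[THEN iffD1] exI[of _ "(- c, 0)"]) (simp add: half_slice_def)

lemma closed_half_slice:
  assumes "star_body K"
  shows "closed (half_slice \<zeta> K c v)"
proof -
  have "closed K" using assms by (auto simp: star_body_def body_def compact_imp_closed)
  then have "closed ((\<lambda>q. (c + fst q) *\<^sub>R \<zeta> + snd q *\<^sub>R v) -` K)"
    by (rule closed_vimage) (intro continuous_intros)
  moreover have "closed {q :: real \<times> real. 0 \<le> snd q}" by (intro closed_Collect_le continuous_intros)
  ultimately have "closed ({q. 0 \<le> snd q} \<inter> (\<lambda>q. (c + fst q) *\<^sub>R \<zeta> + snd q *\<^sub>R v) -` K)"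
    by (rule closed_Int[rotated])
  then show ?thesis by (simp add: half_slice_def vimage_def Collect_conj_eq)
qed

text \<open>For the continuity of \<open>section_dist\<close>: the half slice becomes the image of a
  fixed rectangle under a map in which \<open>v\<close> enters only through the radial
  function.\<close>

lemma half_slice_polar:
  fixes \<zeta> v :: "'a::euclidean_space"
  assumes K: "star_body K" and \<zeta>: "norm \<zeta> = 1" and v: "norm v = 1" "v \<bullet> \<zeta> = 0"
  defines "u \<equiv> \<lambda>\<psi>. cos \<psi> *\<^sub>R \<zeta> + sin \<psi> *\<^sub>R v"
  shows "half_slice \<zeta> K c v = (\<lambda>(l, \<psi>). (l * radial K (u \<psi>) * cos \<psi> - c, l * radial K (u \<psi>) * sin \<psi>)) ` ({0..1} \<times> {0..pi})"
    (is "_ = ?m ` ?C")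
proof -
  have u1: "norm (u \<psi>) = 1" for \<psi>
  proof -
    have "u \<psi> \<bullet> u \<psi> = 1"
      using \<zeta> v unfolding u_def by (simp add: inner_add_left inner_add_right norm_eq_1 inner_commute[of \<zeta> v])
    then show ?thesis by (simp add: norm_eq_1)
  qed
  then have u0: "u \<psi> \<noteq> 0" for \<psi> by (metis norm_zero zero_neq_one)
  show ?thesis
  proof (intro equalityI subsetI)
    fix q assume "q \<in> ?m ` ?C"
    then obtain l \<psi> where l: "0 \<le> l" "l \<le> 1" and \<psi>: "0 \<le> \<psi>" "\<psi> \<le> pi" and q: "q = ?m (l, \<psi>)" by auto
    have "(c + fst q) *\<^sub>R \<zeta> + snd q *\<^sub>R v = l *\<^sub>R (radial K (u \<psi>) *\<^sub>R u \<psi>)"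
      by (simp add: q) (simp add: u_def algebra_simps)
    also have "\<dots> \<in> K" by (intro star_body_scaleR K radial_greatest u0 l)
    finally show "q \<in> half_slice \<zeta> K c v"
      using l \<psi> radial_nonneg[OF K u0] by (auto simp: half_slice_def q sin_ge_zero)
  next
    fix q assume "q \<in> half_slice \<zeta> K c v"
    then have q: "0 \<le> snd q" "(c + fst q) *\<^sub>R \<zeta> + snd q *\<^sub>R v \<in> K" by (auto simp: half_slice_def)
    define R where "R = sqrt ((c + fst q)\<^sup>2 + (snd q)\<^sup>2)"
    have R2: "R\<^sup>2 = (c + fst q)\<^sup>2 + (snd q)\<^sup>2" by (simp add: R_def)
    have "\<exists>\<psi>. 0 \<le> \<psi> \<and> \<psi> \<le> pi \<and> c + fst q = R * cos \<psi> \<and> snd q = R * sin \<psi>"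
    proof (cases "R = 0")
      case True
      then show ?thesis using R2 by (intro exI[of _ 0]) simp
    next
      case False
      then have R: "R > 0" by (simp add: R_def sum_power2_gt_zero_iff)
      have "\<bar>c + fst q\<bar> \<le> R" unfolding R_def by (rule real_sqrt_ge_abs1)
      then have b: "\<bar>(c + fst q) / R\<bar> \<le> 1" using R by simp
      let ?\<psi> = "arccos ((c + fst q) / R)"
      have "sin ?\<psi> = sqrt (1 - ((c + fst q) / R)\<^sup>2)" using b by (intro sin_arccos_abs)
      also have "1 - ((c + fst q) / R)\<^sup>2 = (snd q / R)\<^sup>2"
      proof -
        have "((c + fst q) / R)\<^sup>2 + (snd q / R)\<^sup>2 = ((c + fst q)\<^sup>2 + (snd q)\<^sup>2) / R\<^sup>2"
          unfolding power_divide by (rule add_divide_distrib[symmetric])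
        then show ?thesis using R unfolding R2[symmetric] by simp
      qed
      finally have "snd q = R * sin ?\<psi>" using q(1) R by simp
      moreover have "c + fst q = R * cos ?\<psi>" using b R by (simp add: cos_arccos_abs)
      moreover have "0 \<le> ?\<psi>" "?\<psi> \<le> pi"
      proof -
        have "-1 \<le> (c + fst q) / R" "(c + fst q) / R \<le> 1" using b unfolding abs_le_iff by linarith+
        then show "0 \<le> ?\<psi>" "?\<psi> \<le> pi" by (simp_all add: arccos_lbound arccos_ubound)
      qed
      ultimately show ?thesis by blast
    qed
    then obtain \<psi> where \<psi>: "0 \<le> \<psi>" "\<psi> \<le> pi" "c + fst q = R * cos \<psi>" "snd q = R * sin \<psi>" by blast
    have "R *\<^sub>R u \<psi> \<in> K" using q(2) unfolding \<psi> by (simp add: u_def algebra_simps)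
    then have Rle: "R \<le> radial K (u \<psi>)" by (rule radial_greatest(2)[OF K u0])
    have "R \<ge> 0" by (simp add: R_def)
    \<comment> \<open>The origin need not be an interior point, so the radial function may vanish;
      then R = 0 and the factor 0 is taken.\<close>
    obtain l where l: "0 \<le> l" "l \<le> 1" "R = l * radial K (u \<psi>)"
    proof (cases "radial K (u \<psi>) = 0")
      case True
      then show ?thesis using that[of 0] Rle \<open>R \<ge> 0\<close> by simp
    next
      case False
      then show ?thesis using that[of "R / radial K (u \<psi>)"] Rle \<open>R \<ge> 0\<close> radial_nonneg[OF K u0[of \<psi>]] by simp
    qed
    have "q = ?m (l, \<psi>)" using \<psi>(3,4) l(3) by (simp add: prod_eq_iff)
    then show "q \<in> ?m ` ?C" using l \<psi> by auto
  qed
qed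

lemma continuous_on_section_dist:
  fixes \<zeta> :: "'a::euclidean_space"
  assumes K: "star_body K" and \<zeta>: "norm \<zeta> = 1"
  shows "continuous_on {v. v \<bullet> \<zeta> = 0} (section_dist \<zeta> K c p)"
  unfolding section_dist_def
proof (rule continuous_on_homogeneous_extension)
  let ?S = "{v. v \<bullet> \<zeta> = 0}"
  show sub: "subspace ?S" by (simp add: subspace_def inner_add_left)
  let ?X = "sphere 0 1 \<inter> ?S"
  let ?u = "\<lambda>v \<psi>. cos \<psi> *\<^sub>R \<zeta> + sin \<psi> *\<^sub>R v"
  let ?m = "\<lambda>v (l, \<psi>). (l * radial K (?u v \<psi>) * cos \<psi> - c, l * radial K (?u v \<psi>) * sin \<psi>)"
  have u0: "?u v \<psi> \<noteq> 0" if "v \<in> ?X" for v \<psi>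
  proof
    assume "?u v \<psi> = 0"
    then have "?u v \<psi> \<bullet> \<zeta> = 0" "?u v \<psi> \<bullet> v = 0" by simp_all
    then have "cos \<psi> = 0" "sin \<psi> = 0"
      using that \<zeta> by (auto simp: inner_add_left norm_eq_1 inner_commute[of \<zeta> v])
    then show False using sin_cos_squared_add[of \<psi>] by simp
  qed
  have "continuous_on ?X (\<lambda>v. infdist p (?m v ` ({0..1} \<times> {0..pi})))"
  proof (rule continuous_on_infdist_image)
    show "compact ?X" using closed_subspace[OF sub] by (intro compact_Int_closed) auto
    have r: "continuous_on (-{0}) (radial K)" using K by (simp add: star_body_def)
    have "continuous_on (?X \<times> {0..1::real} \<times> {0..pi}) (\<lambda>x. radial K (?u (fst x) (snd (snd x))))"
      by (rule continuous_on_compose2[OF r]) (use u0 in \<open>auto intro!: continuous_intros\<close>)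
    then show "continuous_on (?X \<times> {0..1::real} \<times> {0..pi}) (\<lambda>(v, q). ?m v q)"
      unfolding split_beta by (intro continuous_intros)
  qed (auto intro: compact_Times)
  then show "continuous_on ?X (\<lambda>v. infdist p (half_slice \<zeta> K c v))"
    by (rule continuous_on_eq) (use half_slice_polar[OF K \<zeta>] in auto)
qed

lemma section_dist_cong:
  assumes "norm v = norm v'" "v \<noteq> 0 \<Longrightarrow> half_slice \<zeta> K c (v /\<^sub>R norm v) = half_slice \<zeta> L c' (v' /\<^sub>R norm v')"
  shows "section_dist \<zeta> K c p v = section_dist \<zeta> L c' p v'"
  using assms by (cases "v = 0") (auto simp: section_dist_def)

lemma half_slice_eq_if_section_dist_eq:
  assumes "star_body K" "star_body L" "norm v = 1" "norm v' = 1"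
    and "\<And>p. section_dist \<zeta> K c p v = section_dist \<zeta> L c' p v'"
  shows "half_slice \<zeta> K c v = half_slice \<zeta> L c' v'"
proof -
  have "infdist p (half_slice \<zeta> K c v) = infdist p (half_slice \<zeta> L c' v')" for p
    using assms(3-5) by (simp add: section_dist_def)
  then show ?thesis
    using in_closed_iff_infdist_zero[OF closed_half_slice half_slice_nonempty] assms(1,2) by (metis subsetI subset_antisym)
qed

text \<open>The reversal of \<zeta> in the coordinates of a half slice.\<close>

definition mirror :: "real \<times> real \<Rightarrow> real \<times> real" where
  "mirror q = (- fst q, snd q)"

lemma mirror_mirror [simp]: "mirror (mirror q) = q"
  by (simp add: mirror_def)

lemma infdist_mirror: "infdist (mirror p) (mirror ` A) = infdist p A"
proof -
  have "dist (mirror p) (mirror a) = dist p a" for a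
    by (simp add: mirror_def dist_prod_def dist_real_def power2_commute[of "fst a"])
  then show ?thesis by (simp add: infdist_def image_image)
qed

section \<open>Congruences of sections expressed by half slices\<close>

context embedded_space
begin

text \<open>The translation is chosen so that the level \<open>c\<close> of \<open>K\<close> goes to
  the level \<open>c'\<close> of \<open>L\<close>. Heights relative to these levels are then merely
  multiplied by \<epsilon>.\<close>

lemma half_slice_transport:
  assumes \<phi>: "linear \<phi>" "inj \<phi>" "\<phi> \<zeta> = \<epsilon> *\<^sub>R \<zeta>" and \<rho>: "\<phi> (\<iota> x) = \<iota> y" "x \<bullet> w = 0" "y \<bullet> w = 0"
    and eq: "\<phi> ` (K \<inter> hsub w) = (+) ((\<epsilon> * c - c') *\<^sub>R \<zeta>) ` (L \<inter> hsub w)"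
  shows "(c + s) *\<^sub>R \<zeta> + r *\<^sub>R \<iota> x \<in> K \<longleftrightarrow> (c' + \<epsilon> * s) *\<^sub>R \<zeta> + r *\<^sub>R \<iota> y \<in> L"
proof -
  let ?P = "(c + s) *\<^sub>R \<zeta> + r *\<^sub>R \<iota> x" and ?Q = "(c' + \<epsilon> * s) *\<^sub>R \<zeta> + r *\<^sub>R \<iota> y"
  have PH: "?P \<in> hsub w" using in_hsub[of "c + s" "r *\<^sub>R x" w] \<rho>(2) by (simp add: \<iota>_simps del: in_hsub)
  have QH: "?Q \<in> hsub w" using in_hsub[of "c' + \<epsilon> * s" "r *\<^sub>R y" w] \<rho>(3) by (simp add: \<iota>_simps del: in_hsub)
  have \<phi>P: "\<phi> ?P = (\<epsilon> * c - c') *\<^sub>R \<zeta> + ?Q"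
    by (simp add: linear_add[OF \<phi>(1)] linear_scale[OF \<phi>(1)] \<phi>(3) \<rho>(1) algebra_simps)
  have "?P \<in> K \<longleftrightarrow> \<phi> ?P \<in> \<phi> ` (K \<inter> hsub w)" using PH inj_image_mem_iff[OF \<phi>(2)] by auto
  also have "\<dots> \<longleftrightarrow> ?Q \<in> L" unfolding eq \<phi>P using QH by auto
  finally show ?thesis .
qed

text \<open>The way back from half slices to a symmetry of the section. Followed by the inverse
  translation, \<phi> is an involution \<open>T\<close> of \<open>hsub w\<close>, so mapping the
  section into itself already means mapping it onto itself.\<close>

lemma section_symmetric:
  assumes w: "norm w = 1" and \<phi>: "linear \<phi>" "\<phi> \<zeta> = \<epsilon> *\<^sub>R \<zeta>" "\<epsilon> * \<epsilon> = 1" "\<And>x. x \<bullet> w = 0 \<Longrightarrow> \<phi> (\<iota> x) = \<iota> (\<rho> x)"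
    and \<rho>: "\<And>x. x \<bullet> w = 0 \<Longrightarrow> \<rho> x \<bullet> w = 0" "\<And>x. x \<bullet> w = 0 \<Longrightarrow> \<rho> (\<rho> x) = x"
    and sym: "\<And>x s r. norm x = 1 \<Longrightarrow> x \<bullet> w = 0 \<Longrightarrow> 0 \<le> r \<Longrightarrow> (c + s) *\<^sub>R \<zeta> + r *\<^sub>R \<iota> x \<in> L \<Longrightarrow>
      (c + \<epsilon> * s) *\<^sub>R \<zeta> + r *\<^sub>R \<iota> (\<rho> x) \<in> L"
  shows "\<phi> ` (L \<inter> hsub w) = (+) ((\<epsilon> * c - c) *\<^sub>R \<zeta>) ` (L \<inter> hsub w)"
proof -
  let ?a = "(\<epsilon> * c - c) *\<^sub>R \<zeta>"
  define T where "T y = \<phi> y - ?a" for y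
  have into: "T y \<in> L \<inter> hsub w" if y: "y \<in> L \<inter> hsub w" for y
  proof -
    obtain b z where z: "y = b *\<^sub>R \<zeta> + \<iota> z" "z \<bullet> w = 0" using y by (auto simp: hsub_def)
    obtain x r where x: "norm x = 1" "x \<bullet> w = 0" "0 \<le> r" "z = r *\<^sub>R x"
    proof (cases "z = 0")
      case True
      obtain a where "norm a = 1" "a \<bullet> w = 0" using orthonormal_frame3[OF w] by blast
      then show ?thesis using that[of a 0] True by simp
    next
      case False
      then show ?thesis using that[of "z /\<^sub>R norm z" "norm z"] z(2) by simp
    qed
    have Ty: "T y = (c + \<epsilon> * (b - c)) *\<^sub>R \<zeta> + r *\<^sub>R \<iota> (\<rho> x)"
      unfolding T_def z(1) x(4)
      by (simp add: linear_add[OF \<phi>(1)] linear_scale[OF \<phi>(1)] \<phi>(2) \<phi>(4)[OF x(2)] \<iota>_simps algebra_simps)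
    have "(c + (b - c)) *\<^sub>R \<zeta> + r *\<^sub>R \<iota> x \<in> L" using y by (simp add: z x(4) \<iota>_simps)
    then have "T y \<in> L" unfolding Ty by (rule sym[OF x(1-3)])
    moreover have "T y \<in> hsub w"
      using in_hsub[of "c + \<epsilon> * (b - c)" "r *\<^sub>R \<rho> x" w] \<rho>(1)[OF x(2)] by (simp add: Ty \<iota>_simps del: in_hsub)
    ultimately show ?thesis by blast
  qed
  have TT: "T (T y) = y" if y: "y \<in> hsub w" for y
  proof -
    obtain b z where z: "y = b *\<^sub>R \<zeta> + \<iota> z" "z \<bullet> w = 0" using y by (auto simp: hsub_def)
    have T: "T (a *\<^sub>R \<zeta> + \<iota> x) = (\<epsilon> * a - \<epsilon> * c + c) *\<^sub>R \<zeta> + \<iota> (\<rho> x)" if "x \<bullet> w = 0" for a x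
      unfolding T_def
      by (simp add: linear_add[OF \<phi>(1)] linear_scale[OF \<phi>(1)] \<phi>(2) \<phi>(4)[OF that] algebra_simps)
    have "T (T y) = (\<epsilon> * (\<epsilon> * b - \<epsilon> * c + c) - \<epsilon> * c + c) *\<^sub>R \<zeta> + \<iota> (\<rho> (\<rho> z))"
      unfolding z(1) T[OF z(2)] T[OF \<rho>(1)[OF z(2)]] ..
    also have "\<epsilon> * (\<epsilon> * b - \<epsilon> * c + c) - \<epsilon> * c + c = (\<epsilon> * \<epsilon>) * b - (\<epsilon> * \<epsilon>) * c + c"
      by (simp add: algebra_simps)
    finally show ?thesis using z \<rho>(2)[OF z(2)] \<phi>(3) by simp
  qed
  have "T ` (L \<inter> hsub w) = L \<inter> hsub w"
    using into TT by (auto simp: image_iff) (metis IntI into TT IntD2)+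
  then have "(+) ?a ` (T ` (L \<inter> hsub w)) = (+) ?a ` (L \<inter> hsub w)" by simp
  then show ?thesis by (simp add: image_image T_def)
qed

lemma not_pi_symmetric_imp_not_even:
  assumes w: "norm w = 1" and L: "star_body L" and nosym: "\<not> pi_symmetry (hsub w) \<zeta> (L \<inter> hsub w)"
  shows "\<exists>p x. x \<bullet> w = 0 \<and> section_dist \<zeta> L c p (\<iota> (- x)) \<noteq> section_dist \<zeta> L c p (\<iota> x)"
proof (rule ccontr)
  assume "\<not> ?thesis"
  then have eq: "section_dist \<zeta> L c p (\<iota> (- x)) = section_dist \<zeta> L c p (\<iota> x)" if "x \<bullet> w = 0" for p x
    using that by blast
  obtain \<phi> where \<phi>: "\<phi> \<in> SO_on (hsub w)" "\<phi> \<zeta> = \<zeta>" "\<And>x. x \<bullet> w = 0 \<Longrightarrow> \<phi> (\<iota> x) = \<iota> (- x)"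
    by (rule half_turn_about_\<zeta>[OF w]) (rule that)
  have lin: "linear \<phi>" using \<phi>(1) by (simp add: SO_on_def orthogonal_transformation_def)
  have hs: "half_slice \<zeta> L c (\<iota> (- x)) = half_slice \<zeta> L c (\<iota> x)" if "norm x = 1" "x \<bullet> w = 0" for x
    by (rule half_slice_eq_if_section_dist_eq[OF L L]) (use that eq in \<open>simp_all add: norm_\<iota>\<close>)
  have "\<phi> ` (L \<inter> hsub w) = (+) ((1 * c - c) *\<^sub>R \<zeta>) ` (L \<inter> hsub w)"
  proof (rule section_symmetric[OF w lin _ _ \<phi>(3)])
    fix x s r assume x: "norm x = 1" "x \<bullet> w = 0" and "0 \<le> r" "(c + s) *\<^sub>R \<zeta> + r *\<^sub>R \<iota> x \<in> L"
    then have "(s, r) \<in> half_slice \<zeta> L c (\<iota> x)" by (simp add: half_slice_def)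
    then have "(s, r) \<in> half_slice \<zeta> L c (\<iota> (- x))" using hs[OF x] by simp
    then show "(c + 1 * s) *\<^sub>R \<zeta> + r *\<^sub>R \<iota> (- x) \<in> L" by (simp add: half_slice_def)
  qed (use \<phi> in simp_all)
  moreover have "\<phi> x = - x" if x: "x \<in> hsub w" "orthogonal x \<zeta>" for x
  proof -
    obtain a y where y: "y \<bullet> w = 0" "x = a *\<^sub>R \<zeta> + \<iota> y" using x(1) by (auto simp: hsub_def)
    then have "a = 0" using x(2) by (simp add: orthogonal_def inner_add_left \<zeta>_simps \<iota>_\<zeta>)
    then show ?thesis using y \<phi>(3) by (simp add: \<iota>_simps)
  qed
  moreover have "(1 * c - c) *\<^sub>R \<zeta> \<in> hsub w" by (rule \<zeta>_in_hsub)
  ultimately have "pi_symmetry (hsub w) \<zeta> (L \<inter> hsub w)" unfolding pi_symmetry_def using \<phi>(1,2) by blast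
  then show False using nosym by blast
qed

text \<open>A half turn about an axis in the plane carries the level \<open>c\<close> to
  \<open>- c\<close>. The translation by - 2 c along \<zeta>, which \<open>pi_symmetry\<close>
  admits, compensates for this, so \<open>c\<close> can be arbitrary.\<close>

lemma not_pi_symmetric_imp_not_flip_invariant:
  assumes w: "norm w = 1" and u: "norm u = 1" "u \<bullet> w = 0" and L: "star_body L"
    and nosym: "\<not> pi_symmetry (hsub w) (\<iota> u) (L \<inter> hsub w)"
  shows "\<exists>p x. x \<bullet> w = 0 \<and> section_dist \<zeta> L c p (\<iota> (axial_reflection u x)) \<noteq> section_dist \<zeta> L c (mirror p) (\<iota> x)"
proof (rule ccontr)
  assume "\<not> ?thesis"
  then have eq: "section_dist \<zeta> L c p (\<iota> (axial_reflection u x)) = section_dist \<zeta> L c (mirror p) (\<iota> x)"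
    if "x \<bullet> w = 0" for p x
    using that by blast
  obtain \<phi> where \<phi>: "\<phi> \<in> SO_on (hsub w)" "\<phi> \<zeta> = - \<zeta>" "\<And>x. x \<bullet> w = 0 \<Longrightarrow> \<phi> (\<iota> x) = \<iota> (axial_reflection u x)"
    by (rule half_turn_about_\<iota>[OF w u]) (rule that)
  have lin: "linear \<phi>" using \<phi>(1) by (simp add: SO_on_def orthogonal_transformation_def)
  have ax: "axial_reflection u x \<bullet> w = 0" if "x \<bullet> w = 0" for x
    using that u(2) by (simp add: axial_reflection_def inner_diff_left)
  note axax = axial_reflection_involution[OF u(1)]
  note nax = norm_axial_reflection[OF u(1)]
  have hs: "mirror q \<in> half_slice \<zeta> L c (\<iota> (axial_reflection u x))"
    if x: "norm x = 1" "x \<bullet> w = 0" and q: "q \<in> half_slice \<zeta> L c (\<iota> x)" for x q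
  proof -
    have "infdist (mirror q) (half_slice \<zeta> L c (\<iota> (axial_reflection u x))) = infdist q (half_slice \<zeta> L c (\<iota> x))"
      using eq[OF x(2), of "mirror q"] x(1) by (simp add: section_dist_def norm_\<iota> nax)
    also have "\<dots> = 0" using q by simp
    finally show ?thesis
      using in_closed_iff_infdist_zero[OF closed_half_slice[OF L] half_slice_nonempty[OF L]] by blast
  qed
  have "\<phi> ` (L \<inter> hsub w) = (+) ((-1 * c - c) *\<^sub>R \<zeta>) ` (L \<inter> hsub w)"
  proof (rule section_symmetric[OF w lin _ _ \<phi>(3)])
    fix x s r assume x: "norm x = 1" "x \<bullet> w = 0" and "0 \<le> r" "(c + s) *\<^sub>R \<zeta> + r *\<^sub>R \<iota> x \<in> L"
    then have "(s, r) \<in> half_slice \<zeta> L c (\<iota> x)" by (simp add: half_slice_def)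
    from hs[OF x this] show "(c + -1 * s) *\<^sub>R \<zeta> + r *\<^sub>R \<iota> (axial_reflection u x) \<in> L"
      by (simp add: half_slice_def mirror_def)
  qed (use \<phi> ax axax in simp_all)
  moreover have "\<phi> x = - x" if x: "x \<in> hsub w" "orthogonal x (\<iota> u)" for x
  proof -
    obtain a y where y: "y \<bullet> w = 0" "x = a *\<^sub>R \<zeta> + \<iota> y" using x(1) by (auto simp: hsub_def)
    then have "y \<bullet> u = 0" using x(2) by (simp add: orthogonal_def inner_add_left \<zeta>_simps inner_\<iota>)
    then have "axial_reflection u y = - y" by (simp add: axial_reflection_def)
    then show ?thesis using y \<phi>(2,3) by (simp add: \<iota>_simps linear_add[OF lin] linear_scale[OF lin])
  qed
  moreover have "(-1 * c - c) *\<^sub>R \<zeta> \<in> hsub w" by (rule \<zeta>_in_hsub)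
  moreover have "\<phi> (\<iota> u) = \<iota> u"
    using \<phi>(3)[OF u(2)] u(1) by (simp add: axial_reflection_def norm_eq_1 scaleR_2)
  ultimately have "pi_symmetry (hsub w) (\<iota> u) (L \<inter> hsub w)" unfolding pi_symmetry_def using \<phi>(1) by blast
  then show False using nosym by blast
qed

text \<open>For \<epsilon> = -1 heights are reversed, so the half slices are mirror images. The
  distance to a mirrored set is the distance of the mirrored point, which is how
  \<open>mirror\<close> comes to act on the index \<open>p\<close>.\<close>

lemma related_if_axis_preserved:
  assumes w: "norm w = 1" and \<phi>: "\<phi> \<in> SO_on (hsub w)" "\<phi> \<zeta> = \<epsilon> *\<^sub>R \<zeta>" "\<epsilon> = 1 \<or> \<epsilon> = -1"
    and eq: "\<phi> ` (K \<inter> hsub w) = (+) ((\<epsilon> * c - c') *\<^sub>R \<zeta>) ` (L \<inter> hsub w)"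
  shows "(\<exists>t. rot_related (\<lambda>p x. section_dist \<zeta> L c' p (\<iota> x)) (\<lambda>p x. section_dist \<zeta> K c p (\<iota> x)) w t) \<or>
    (\<exists>u. norm u = 1 \<and> u \<bullet> w = 0 \<and>
      flip_related (\<lambda>p x. section_dist \<zeta> L c' p (\<iota> x)) (\<lambda>p x. section_dist \<zeta> K c (mirror p) (\<iota> x)) w u)"
proof -
  have ot: "orthogonal_transformation \<phi>" using \<phi>(1) by (simp add: SO_on_def)
  then have lin: "linear \<phi>" and inj: "inj \<phi>"
    using orthogonal_transformation_inj by (auto simp: orthogonal_transformation_def)
  have pm: "\<phi> \<zeta> = \<zeta> \<or> \<phi> \<zeta> = - \<zeta>" using \<phi>(2,3) by auto
  have z0: "\<zeta> \<noteq> - \<zeta>" using \<zeta>_simps(1) by (metis inner_minus_left one_neq_neg_one)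
  show ?thesis
  proof (rule SO_on_classification[OF w \<phi>(1) pm])
    fix t assume t: "\<phi> \<zeta> = \<zeta>" "\<And>x. x \<bullet> w = 0 \<Longrightarrow> \<phi> (\<iota> x) = \<iota> (rot w t x)"
    have "\<epsilon> = 1" using t(1) \<phi>(2,3) z0 by auto
    have "section_dist \<zeta> L c' p (\<iota> (rot w t x)) = section_dist \<zeta> K c p (\<iota> x)" if x: "x \<bullet> w = 0" for p x
    proof (rule section_dist_cong)
      have nr: "norm (rot w t x) = norm x" by (rule norm_rot[OF w x])
      then show "norm (\<iota> (rot w t x)) = norm (\<iota> x)" by (simp add: norm_\<iota>)
      have *: "(c + s) *\<^sub>R \<zeta> + r *\<^sub>R \<iota> x \<in> K \<longleftrightarrow> (c' + 1 * s) *\<^sub>R \<zeta> + r *\<^sub>R \<iota> (rot w t x) \<in> L" for s r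
        using half_slice_transport[OF lin inj \<phi>(2) t(2)[OF x] x rot_orthogonal[OF x] eq] \<open>\<epsilon> = 1\<close> by simp
      show "half_slice \<zeta> L c' (\<iota> (rot w t x) /\<^sub>R norm (\<iota> (rot w t x))) = half_slice \<zeta> K c (\<iota> x /\<^sub>R norm (\<iota> x))"
        unfolding half_slice_def norm_\<iota> nr scaleR_scaleR * by simp
    qed
    then show ?thesis unfolding rot_related_def by blast
  next
    fix u assume u: "norm u = 1" "u \<bullet> w = 0" "\<phi> \<zeta> = - \<zeta>" "\<And>x. x \<bullet> w = 0 \<Longrightarrow> \<phi> (\<iota> x) = \<iota> (axial_reflection u x)"
    have "\<epsilon> = -1" using u(3) \<phi>(2,3) z0 by auto
    note nax = norm_axial_reflection[OF u(1)]
    have "section_dist \<zeta> L c' p (\<iota> (axial_reflection u x)) = section_dist \<zeta> K c (mirror p) (\<iota> x)" if x: "x \<bullet> w = 0" for p x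
    proof -
      have ax: "axial_reflection u x \<bullet> w = 0" using x u(2) by (simp add: axial_reflection_def inner_diff_left)
      have *: "(c + s) *\<^sub>R \<zeta> + r *\<^sub>R \<iota> x \<in> K \<longleftrightarrow> (c' + (-1) * s) *\<^sub>R \<zeta> + r *\<^sub>R \<iota> (axial_reflection u x) \<in> L" for s r
        using half_slice_transport[OF lin inj \<phi>(2) u(4)[OF x] x ax eq] \<open>\<epsilon> = -1\<close> by simp
      have "half_slice \<zeta> K c (\<iota> x /\<^sub>R norm x) = mirror ` half_slice \<zeta> L c' (\<iota> (axial_reflection u x) /\<^sub>R norm x)"
      proof (intro set_eqI iffI)
        fix q assume "q \<in> half_slice \<zeta> K c (\<iota> x /\<^sub>R norm x)"
        then have "mirror q \<in> half_slice \<zeta> L c' (\<iota> (axial_reflection u x) /\<^sub>R norm x)"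
          unfolding half_slice_def mem_Collect_eq scaleR_scaleR * by (simp add: mirror_def)
        then show "q \<in> mirror ` half_slice \<zeta> L c' (\<iota> (axial_reflection u x) /\<^sub>R norm x)"
          by (intro image_eqI[of _ _ "mirror q"]) simp_all
      next
        fix q assume "q \<in> mirror ` half_slice \<zeta> L c' (\<iota> (axial_reflection u x) /\<^sub>R norm x)"
        then show "q \<in> half_slice \<zeta> K c (\<iota> x /\<^sub>R norm x)"
          unfolding half_slice_def mem_Collect_eq scaleR_scaleR * by (auto simp: mirror_def)
      qed
      then show ?thesis
        using infdist_mirror by (simp add: section_dist_def norm_\<iota> nax)
    qed
    then show ?thesis unfolding flip_related_def using u by blast
  qed
qed

end

section \<open>Diameters\<close>

text \<open>Baire's theorem: each nonzero \<open>y\<close> excludes one great circle, and a normal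
  on that circle leaves it when tilted slightly towards \<open>y\<close>.\<close>

lemma dense_avoiding_great_circles:
  fixes Z :: "(real^3) set"
  assumes "countable Z" "0 \<notin> Z"
  shows "sphere 0 1 \<subseteq> closure {w \<in> sphere 0 1. \<forall>y\<in>Z. w \<bullet> y \<noteq> 0}"
proof -
  let ?S = "sphere 0 1 :: (real^3) set"
  define T where "T y = {w \<in> ?S. w \<bullet> y \<noteq> 0}" for y
  have "?S \<subseteq> closure (\<Inter>(insert ?S (T ` Z)))"
  proof (rule Baire)
    fix V assume "V \<in> insert ?S (T ` Z)"
    then consider "V = ?S" | y where "y \<in> Z" "V = T y" by blast
    then show "openin (top_of_set ?S) V \<and> ?S \<subseteq> closure V"
    proof cases
      case 1
      then show ?thesis using closure_subset by auto
    next
      case 2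
      have "closed {w. w \<bullet> y = 0}" by (intro closed_Collect_eq continuous_intros)
      then have "openin (top_of_set ?S) (?S \<inter> - {w. w \<bullet> y = 0})" by (intro openin_open_Int) auto
      moreover have T: "T y = ?S \<inter> - {w. w \<bullet> y = 0}" by (auto simp: T_def)
      moreover have "w \<in> closure (T y)" if w: "w \<in> ?S" for w
      proof (cases "w \<bullet> y = 0")
        case False
        then show ?thesis using w closure_subset[of "T y"] by (auto simp: T_def)
      next
        case True
        have "y \<noteq> 0" using 2(1) assms(2) by auto
        define v where "v = y /\<^sub>R norm y"
        have v: "v \<bullet> v = 1" "w \<bullet> v = 0" "v \<bullet> w = 0" "w \<bullet> w = 1" "v \<bullet> y \<noteq> 0"
          using \<open>y \<noteq> 0\<close> True w by (simp_all add: v_def inner_commute norm_eq_1 dot_square_norm power2_eq_square)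
        define k where "k d = cos d *\<^sub>R w + sin d *\<^sub>R v" for d
        have k1: "norm (k d) = 1" for d
          by (simp add: k_def norm_eq_1 inner_add_left inner_add_right v)
        have ky: "k d \<bullet> y = sin d * (v \<bullet> y)" for d by (simp add: k_def inner_add_left True)
        have "isCont k 0" unfolding k_def by (intro continuous_intros)
        then have lim: "(k \<longlongrightarrow> w) (at_right 0)"
          using filterlim_at_split[of k "nhds w" 0] by (simp add: continuous_at k_def[of 0] isCont_def)
        have "eventually (\<lambda>d. d \<in> {0<..<pi}) (at_right 0)"
          by (rule eventually_at_right_real) simp
        then have "eventually (\<lambda>d. k d \<in> closure (T y)) (at_right 0)"
        proof eventually_elim
          case (elim d)
          then have "sin d > 0" by (auto intro: sin_gt_zero)
          then have "k d \<in> T y" using k1 ky v(5) by (simp add: T_def)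
          then show ?case using closure_subset by blast
        qed
        then show ?thesis
          by (rule Lim_in_closed_set[OF closed_closure _ trivial_limit_at_right_real lim])
      qed
      ultimately show ?thesis using 2(2) by auto
    qed
  qed (use assms(1) in simp_all)
  moreover have "\<Inter>(insert ?S (T ` Z)) = {w \<in> ?S. \<forall>y\<in>Z. w \<bullet> y \<noteq> 0}" by (auto simp: T_def)
  ultimately show ?thesis by simp
qed

lemma subspace_of_dim_containing:
  fixes S :: "'a::euclidean_space set"
  assumes "dim S \<le> k" "k \<le> DIM('a)"
  obtains T where "subspace T" "S \<subseteq> T" "dim T = k"
proof -
  have "\<exists>T. subspace T \<and> S \<subseteq> T \<and> dim T = k"
    using assms
  proof (induction "k - dim S" arbitrary: S)
    case 0
    then show ?case by (intro exI[of _ "span S"]) (simp add: span_superset)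
  next
    case (Suc m)
    then have "dim S < DIM('a)" by linarith
    then have "span S \<noteq> UNIV" using dim_span[of S] dim_UNIV by (metis less_irrefl)
    then obtain x where x: "x \<notin> span S" by blast
    have d: "dim (insert x S) = Suc (dim S)" using x by (simp add: dim_insert)
    have "\<exists>T. subspace T \<and> insert x S \<subseteq> T \<and> dim T = k"
      by (rule Suc.hyps(1)) (use Suc.hyps(2) Suc.prems d in linarith)+
    then show ?case by blast
  qed
  then show ?thesis using that by blast
qed

lemma axis_points:
  assumes K: "star_body K" and "\<zeta> \<noteq> 0"
  shows "b *\<^sub>R \<zeta> \<in> K \<longleftrightarrow> - radial K (- \<zeta>) \<le> b \<and> b \<le> radial K \<zeta>"
proof (cases "0 \<le> b")
  case True
  then show ?thesis
    using star_body_radial_iff[OF K assms(2) True] radial_nonneg[OF K, of "- \<zeta>"] assms(2) by auto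
next
  case False
  have "b *\<^sub>R \<zeta> = (- b) *\<^sub>R (- \<zeta>)" by simp
  then show ?thesis
    using star_body_radial_iff[OF K, of "- \<zeta>" "- b"] radial_nonneg[OF K assms(2)] assms(2) False by auto
qed

lemma axis_segment_subset:
  assumes K: "star_body K" and \<zeta>: "\<zeta> \<noteq> 0" and ab: "a *\<^sub>R \<zeta> \<in> K" "b *\<^sub>R \<zeta> \<in> K"
  shows "closed_segment (a *\<^sub>R \<zeta>) (b *\<^sub>R \<zeta>) \<subseteq> K"
proof
  fix x assume "x \<in> closed_segment (a *\<^sub>R \<zeta>) (b *\<^sub>R \<zeta>)"
  then obtain u where u: "0 \<le> u" "u \<le> 1" "x = ((1 - u) * a + u * b) *\<^sub>R \<zeta>"
    by (auto simp: closed_segment_def algebra_simps)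
  let ?I = "{- radial K (- \<zeta>)..radial K \<zeta>}"
  have "(1 - u) *\<^sub>R a + u *\<^sub>R b \<in> ?I"
    using ab u axis_points[OF K \<zeta>] by (intro convexD) auto
  then show "x \<in> K" using u(3) axis_points[OF K \<zeta>] by simp
qed

lemma dist_scaleR_unit:
  assumes "norm \<zeta> = 1"
  shows "dist (b *\<^sub>R \<zeta>) (c *\<^sub>R \<zeta>) = \<bar>b - c\<bar>"
  using assms by (simp add: dist_norm flip: scaleR_left_diff_distrib)

text \<open>The given diameter lies on the axis, hence within the chord that \<open>K\<close> cuts
  out of it. This chord is itself a segment in \<open>K\<close>, so it cannot be longer and is the
  diameter.\<close>

lemma axis_diameter:
  assumes K: "star_body K" and \<zeta>: "norm \<zeta> = 1" and d: "diameter_through_origin K \<zeta>"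
  shows "is_diameter K ((- radial K (- \<zeta>)) *\<^sub>R \<zeta>) (radial K \<zeta> *\<^sub>R \<zeta>)"
proof -
  let ?lo = "- radial K (- \<zeta>)" and ?hi = "radial K \<zeta>"
  have \<zeta>0: "\<zeta> \<noteq> 0" using \<zeta> by auto
  have lohi: "?lo \<le> ?hi" using radial_nonneg[OF K \<zeta>0] radial_nonneg[OF K, of "- \<zeta>"] \<zeta>0 by simp
  obtain z y c where zy: "is_diameter K z y" "0 \<in> closed_segment z y" "y - z = c *\<^sub>R \<zeta>"
    using d by (auto simp: diameter_through_origin_def)
  then obtain u where "0 = (1 - u) *\<^sub>R z + u *\<^sub>R y" by (auto simp: closed_segment_def)
  moreover have y: "y = z + c *\<^sub>R \<zeta>" using zy(3) by (simp add: algebra_simps)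
  ultimately have z: "z = (- u * c) *\<^sub>R \<zeta>" by (simp add: algebra_simps add_eq_0_iff)
  then have y: "y = (c - u * c) *\<^sub>R \<zeta>" using y by (simp add: algebra_simps)
  have "z \<in> K" "y \<in> K" using zy(1) by (auto simp: is_diameter_def)
  then have "\<bar>c\<bar> \<le> ?hi - ?lo" unfolding z y axis_points[OF K \<zeta>0] by linarith
  moreover have "dist z y = \<bar>c\<bar>" using zy(3) \<zeta> by (metis dist_commute dist_norm norm_scaleR mult.right_neutral real_norm_def)
  moreover have "dist (?lo *\<^sub>R \<zeta>) (?hi *\<^sub>R \<zeta>) = ?hi - ?lo"
    unfolding dist_scaleR_unit[OF \<zeta>] using lohi by linarith
  moreover have "closed_segment (?lo *\<^sub>R \<zeta>) (?hi *\<^sub>R \<zeta>) \<subseteq> K"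
  proof (rule axis_segment_subset[OF K \<zeta>0])
    show "?lo *\<^sub>R \<zeta> \<in> K" "?hi *\<^sub>R \<zeta> \<in> K" unfolding axis_points[OF K \<zeta>0] using lohi by simp_all
  qed
  moreover have "dist a b \<le> dist z y" if "closed_segment a b \<subseteq> K" for a b
    using zy(1) that unfolding is_diameter_def by blast
  ultimately show ?thesis unfolding is_diameter_def by (metis order_trans)
qed

lemma diameter_nondegenerate:
  fixes K :: "'a::euclidean_space set"
  assumes "star_body K" "is_diameter K z y"
  shows "z \<noteq> y"
proof -
  obtain x where "x \<in> interior K" using assms(1) by (auto simp: star_body_def body_def)
  then obtain e where e: "e > 0" "ball x e \<subseteq> K"
    by (metis mem_interior)
  obtain v :: 'a where v: "norm v = 1" using vector_choose_size[of 1] by auto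
  let ?y = "x + (e / 2) *\<^sub>R v"
  have "closed_segment x ?y \<subseteq> ball x e"
    using e(1) v by (intro closed_segment_subset) (auto simp: dist_norm)
  then have "dist x ?y \<le> dist z y" using assms(2) e(2) by (auto simp: is_diameter_def)
  moreover have "dist x ?y > 0" using e(1) v by (simp add: dist_norm)
  ultimately show ?thesis by auto
qed

lemma congruent_closed_segment:
  assumes \<phi>: "orthogonal_transformation \<phi>" and eq: "\<phi> ` A = (+) a ` B" and pq: "closed_segment p q \<subseteq> A"
  shows "closed_segment (\<phi> p - a) (\<phi> q - a) \<subseteq> B" "dist (\<phi> p - a) (\<phi> q - a) = dist p q"
proof -
  have lin: "linear \<phi>" using \<phi> by (simp add: orthogonal_transformation_def)
  have "closed_segment (\<phi> p) (\<phi> q) = \<phi> ` closed_segment p q"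
    by (simp add: closed_segment_linear_image[OF lin])
  then have sub: "closed_segment (\<phi> p) (\<phi> q) \<subseteq> (+) a ` B" using pq eq by blast
  have "closed_segment (- a + \<phi> p) (- a + \<phi> q) = (+) (- a) ` closed_segment (\<phi> p) (\<phi> q)"
    by (rule closed_segment_translation)
  then have "closed_segment (- a + \<phi> p) (- a + \<phi> q) \<subseteq> B" using sub by auto
  then show "closed_segment (\<phi> p - a) (\<phi> q - a) \<subseteq> B" by simp
  show "dist (\<phi> p - a) (\<phi> q - a) = dist p q"
    using \<phi> by (simp add: dist_norm orthogonal_transformation flip: linear_diff[OF lin])
qed

lemma congruent_sym:
  fixes \<phi> :: "'a::euclidean_space \<Rightarrow> 'a"
  assumes \<phi>: "orthogonal_transformation \<phi>" and eq: "\<phi> ` A = (+) a ` B"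
  obtains \<psi> where "orthogonal_transformation \<psi>" "\<psi> ` B = (+) (- \<psi> a) ` A"
proof -
  let ?\<psi> = "inv \<phi>"
  have o: "orthogonal_transformation ?\<psi>" using \<phi> by (rule orthogonal_transformation_inv)
  then have lin: "linear ?\<psi>" by (simp add: orthogonal_transformation_def)
  have "?\<psi> ` (\<phi> ` A) = A" using orthogonal_transformation_inj[OF \<phi>] by (simp add: image_inv_f_f)
  then have "A = ?\<psi> ` ((+) a ` B)" using eq by simp
  also have "\<dots> = (+) (?\<psi> a) ` ?\<psi> ` B" by (simp add: image_image linear_add[OF lin])
  finally have "(+) (- ?\<psi> a) ` A = ?\<psi> ` B" by (simp add: image_image)
  then show ?thesis using that[OF o] by simp
qed

text \<open>The endpoints and \<zeta> lie in a common three-dimensional subspace, where the inverse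
  of the congruence carries the segment of \<open>L\<close> to a segment of \<open>K\<close> of
  equal length.\<close>

lemma segment_length_le_diameter:
  fixes K L :: "(real^'n) set"
  assumes card: "CARD('n) \<ge> 3" and K: "is_diameter K z y"
    and cong: "\<And>H. subspace H \<Longrightarrow> dim H = 3 \<Longrightarrow> \<zeta> \<in> H \<Longrightarrow> directly_congruent H (K \<inter> H) (L \<inter> H)"
    and seg: "closed_segment p q \<subseteq> L"
  shows "dist p q \<le> dist z y"
proof -
  have "dim {\<zeta>, p, q} \<le> card {\<zeta>, p, q}" by (rule dim_le_card') simp
  also have "\<dots> \<le> 3" by (simp add: card_insert_if)
  finally obtain H where H: "subspace H" "{\<zeta>, p, q} \<subseteq> H" "dim H = 3"
    using subspace_of_dim_containing[of "{\<zeta>, p, q}" 3] card by auto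
  obtain \<phi> a where \<phi>: "\<phi> \<in> SO_on H" "\<phi> ` (K \<inter> H) = (+) a ` (L \<inter> H)"
    using cong[OF H(1,3)] H(2) by (auto simp: directly_congruent_def)
  then have "orthogonal_transformation \<phi>" by (simp add: SO_on_def)
  then obtain \<psi> where \<psi>: "orthogonal_transformation \<psi>" "\<psi> ` (L \<inter> H) = (+) (- \<psi> a) ` (K \<inter> H)"
    using \<phi>(2) by (rule congruent_sym)
  have "closed_segment p q \<subseteq> L \<inter> H"
    using seg H(2) closed_segment_subset[OF _ _ subspace_imp_convex[OF H(1)], of p q] by blast
  note S = congruent_closed_segment[OF \<psi> this]
  have "dist (\<psi> p - - \<psi> a) (\<psi> q - - \<psi> a) \<le> dist z y" using K S(1) unfolding is_diameter_def by blast
  then show ?thesis using S(2) by simp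
qed

text \<open>The midpoint of the chord on the axis, in coordinates along \<zeta>. Measured from the
  midpoints, congruences that match the chords involve no further translation.\<close>

definition axis_center :: "'a::real_vector \<Rightarrow> 'a set \<Rightarrow> real" where
  "axis_center \<zeta> K = (radial K \<zeta> - radial K (- \<zeta>)) / 2"

context embedded_space
begin

text \<open>The image of the diameter of \<open>K\<close> is by \<open>bound\<close> a longest
  segment of \<open>L\<close>, hence a diameter, and by \<open>only\<close> it lies on the axis.
  This gives \<phi> \<zeta> up to sign; comparing midpoints of the two chords gives
  \<open>a\<close>.\<close>

lemma axis_preserved_if_no_other_diameter:
  assumes K: "star_body K" and L: "star_body L" and dK: "diameter_through_origin K \<zeta>"
    and \<phi>: "\<phi> \<in> SO_on (hsub w)" "\<phi> ` (K \<inter> hsub w) = (+) a ` (L \<inter> hsub w)"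
    and bound: "\<And>p q. closed_segment p q \<subseteq> L \<Longrightarrow>
      dist p q \<le> dist ((- radial K (- \<zeta>)) *\<^sub>R \<zeta>) (radial K \<zeta> *\<^sub>R \<zeta>)"
    and only: "\<And>S. S \<in> diameters L \<Longrightarrow> S \<subseteq> hsub w \<Longrightarrow> S \<subseteq> range (\<lambda>b. b *\<^sub>R \<zeta>)"
  obtains \<epsilon> where "\<epsilon> = 1 \<or> \<epsilon> = -1" "\<phi> \<zeta> = \<epsilon> *\<^sub>R \<zeta>" "a = (\<epsilon> * axis_center \<zeta> K - axis_center \<zeta> L) *\<^sub>R \<zeta>"
proof -
  let ?lo = "- radial K (- \<zeta>)" and ?hi = "radial K \<zeta>"
  let ?lo' = "- radial L (- \<zeta>)" and ?hi' = "radial L \<zeta>"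
  have \<zeta>0: "\<zeta> \<noteq> 0" using norm_\<zeta> by auto
  have lohi: "?lo \<le> ?hi" "?lo' \<le> ?hi'"
    using radial_nonneg[OF K \<zeta>0] radial_nonneg[OF K, of "- \<zeta>"] radial_nonneg[OF L \<zeta>0] radial_nonneg[OF L, of "- \<zeta>"] \<zeta>0
    by simp_all
  have d: "is_diameter K (?lo *\<^sub>R \<zeta>) (?hi *\<^sub>R \<zeta>)" by (rule axis_diameter[OF K norm_\<zeta> dK])
  have "?lo \<noteq> ?hi"
  proof
    assume "?lo = ?hi"
    then have "?lo *\<^sub>R \<zeta> = ?hi *\<^sub>R \<zeta>" by (rule arg_cong)
    then show False using diameter_nondegenerate[OF K d] by blast
  qed
  have ot: "orthogonal_transformation \<phi>" using \<phi>(1) by (simp add: SO_on_def)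
  then have lin: "linear \<phi>" by (simp add: orthogonal_transformation_def)
  have seg: "closed_segment (?lo *\<^sub>R \<zeta>) (?hi *\<^sub>R \<zeta>) \<subseteq> K \<inter> hsub w"
    using d closed_segment_subset[OF \<zeta>_in_hsub(1) \<zeta>_in_hsub(1) subspace_imp_convex[OF subspace_hsub]]
    unfolding is_diameter_def by blast
  let ?P = "\<phi> (?lo *\<^sub>R \<zeta>) - a" and ?Q = "\<phi> (?hi *\<^sub>R \<zeta>) - a"
  note S = congruent_closed_segment[OF ot \<phi>(2) seg]
  note dist_axis = dist_scaleR_unit[OF norm_\<zeta>]
  have dL: "is_diameter L ?P ?Q"
    unfolding is_diameter_def S(2) using S(1) bound by blast
  then have "closed_segment ?P ?Q \<in> diameters L" by (auto simp: diameters_def)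
  then have "closed_segment ?P ?Q \<subseteq> range (\<lambda>b. b *\<^sub>R \<zeta>)" using only S(1) by blast
  then obtain p q where pq: "?P = p *\<^sub>R \<zeta>" "?Q = q *\<^sub>R \<zeta>"
    using ends_in_segment[of ?P ?Q] by blast
  have "p *\<^sub>R \<zeta> \<in> L" "q *\<^sub>R \<zeta> \<in> L" using S(1) ends_in_segment[of ?P ?Q] unfolding pq by blast+
  then have pqL: "?lo' \<le> p" "p \<le> ?hi'" "?lo' \<le> q" "q \<le> ?hi'" using axis_points[OF L \<zeta>0] by auto
  have "closed_segment (?lo' *\<^sub>R \<zeta>) (?hi' *\<^sub>R \<zeta>) \<subseteq> L"
  proof (rule axis_segment_subset[OF L \<zeta>0])
    show "?lo' *\<^sub>R \<zeta> \<in> L" "?hi' *\<^sub>R \<zeta> \<in> L" unfolding axis_points[OF L \<zeta>0] using lohi by simp_all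
  qed
  then have "dist (?lo' *\<^sub>R \<zeta>) (?hi' *\<^sub>R \<zeta>) \<le> dist ?P ?Q" using dL by (auto simp: is_diameter_def)
  then have le: "?hi' - ?lo' \<le> \<bar>p - q\<bar>" unfolding pq dist_axis using lohi(2) by linarith
  have len: "\<bar>p - q\<bar> = ?hi - ?lo" using S(2) lohi(1) unfolding pq dist_axis by linarith
  have diff: "(?hi - ?lo) *\<^sub>R \<phi> \<zeta> = (q - p) *\<^sub>R \<zeta>"
  proof -
    have "?Q - ?P = (?hi - ?lo) *\<^sub>R \<phi> \<zeta>" by (simp add: linear_scale[OF lin] linear_neg[OF lin] algebra_simps)
    then show ?thesis unfolding pq by (simp add: algebra_simps)
  qed
  have sum: "(?lo + ?hi) *\<^sub>R \<phi> \<zeta> - 2 *\<^sub>R a = (p + q) *\<^sub>R \<zeta>"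
  proof -
    have "?P + ?Q = (?lo + ?hi) *\<^sub>R \<phi> \<zeta> - 2 *\<^sub>R a" by (simp add: linear_scale[OF lin] linear_neg[OF lin] scaleR_2 algebra_simps)
    then show ?thesis unfolding pq by (simp add: algebra_simps)
  qed
  define \<epsilon> where "\<epsilon> = (q - p) / (?hi - ?lo)"
  have \<epsilon>: "\<epsilon> = 1 \<or> \<epsilon> = -1"
    using len \<open>?lo \<noteq> ?hi\<close> lohi(1) by (auto simp: \<epsilon>_def abs_if field_simps split: if_splits)
  have "(?hi - ?lo) *\<^sub>R \<phi> \<zeta> = (?hi - ?lo) *\<^sub>R (\<epsilon> *\<^sub>R \<zeta>)"
    unfolding diff using \<open>?lo \<noteq> ?hi\<close> by (simp add: \<epsilon>_def)
  then have "\<phi> \<zeta> = \<epsilon> *\<^sub>R \<zeta> \<or> ?hi - ?lo = 0" unfolding scaleR_cancel_left .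
  then have \<phi>\<zeta>: "\<phi> \<zeta> = \<epsilon> *\<^sub>R \<zeta>" using \<open>?lo \<noteq> ?hi\<close> by (metis eq_iff_diff_eq_0)
  \<comment> \<open>By \<open>le\<close> the points \<open>p\<close> and \<open>q\<close>, both
    inside the chord of \<open>L\<close>, are at least its length apart, so they are its ends in one
    order or the other.\<close>
  have "p + q = ?lo' + ?hi'" using pqL le by linarith
  moreover have "2 *\<^sub>R a = ((?lo + ?hi) * \<epsilon> - (p + q)) *\<^sub>R \<zeta>"
    using sum unfolding \<phi>\<zeta> by (simp add: algebra_simps)
  ultimately have "2 *\<^sub>R a = ((?lo + ?hi) * \<epsilon> - (?lo' + ?hi')) *\<^sub>R \<zeta>" by (simp only:)
  then have "(1/2) *\<^sub>R (2 *\<^sub>R a) = (1/2) *\<^sub>R (((?lo + ?hi) * \<epsilon> - (?lo' + ?hi')) *\<^sub>R \<zeta>)" by simp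
  then have "a = (((?lo + ?hi) * \<epsilon> - (?lo' + ?hi')) / 2) *\<^sub>R \<zeta>" by simp
  also have "((?lo + ?hi) * \<epsilon> - (?lo' + ?hi')) / 2 = \<epsilon> * axis_center \<zeta> K - axis_center \<zeta> L"
    by (simp add: axis_center_def field_simps)
  finally show ?thesis using that[OF \<epsilon> \<phi>\<zeta>] by blast
qed

text \<open>A diameter with a point off the axis, with component \<open>y\<close> in three-space,
  lies in \<open>hsub w\<close> only if \<open>w\<close> is orthogonal to \<open>y\<close>. So each
  diameter excludes at most one great circle of normals.\<close>

lemma generic_sections_contain_no_other_diameter:
  assumes "countable (diameters L)"
  obtains D where "D \<subseteq> sphere 0 1" "sphere 0 1 \<subseteq> closure D"
    "\<And>w S. w \<in> D \<Longrightarrow> S \<in> diameters L \<Longrightarrow> S \<subseteq> hsub w \<Longrightarrow> S \<subseteq> range (\<lambda>b. b *\<^sub>R \<zeta>)"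
proof -
  \<comment> \<open>For diameters on the axis or leaving the subspace spanned by \<zeta> and the
    image of \<iota>, the values of \<open>pt\<close> or \<open>co\<close> may be arbitrary. They
    only add members to the countable set \<open>Z\<close>; the value 0, which no normal could
    avoid, is removed.\<close>
  define pt where "pt S = (SOME x. x \<in> S \<and> x \<notin> range (\<lambda>b. b *\<^sub>R \<zeta>))" for S
  define co where "co x = (THE y. \<exists>a. x = a *\<^sub>R \<zeta> + \<iota> y)" for x
  have co: "co (a *\<^sub>R \<zeta> + \<iota> y) = y" for a y
    unfolding co_def by (rule the_equality) (use \<zeta>_\<iota>_eq_iff in auto)
  define Z where "Z = (\<lambda>S. co (pt S)) ` diameters L - {0}"
  have "countable Z" unfolding Z_def using assms by (intro countable_Diff countable_image)
  moreover have "0 \<notin> Z" by (simp add: Z_def)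
  ultimately have dense: "sphere 0 1 \<subseteq> closure {w \<in> sphere 0 1. \<forall>y\<in>Z. w \<bullet> y \<noteq> 0}"
    by (rule dense_avoiding_great_circles)
  show ?thesis
  proof (rule that[OF _ dense])
    fix w S assume w: "w \<in> {w \<in> sphere 0 1. \<forall>y\<in>Z. w \<bullet> y \<noteq> 0}" and S: "S \<in> diameters L" "S \<subseteq> hsub w"
    show "S \<subseteq> range (\<lambda>b. b *\<^sub>R \<zeta>)"
    proof (rule ccontr)
      assume "\<not> S \<subseteq> range (\<lambda>b. b *\<^sub>R \<zeta>)"
      then have "\<exists>x. x \<in> S \<and> x \<notin> range (\<lambda>b. b *\<^sub>R \<zeta>)" by blast
      then have "pt S \<in> S \<and> pt S \<notin> range (\<lambda>b. b *\<^sub>R \<zeta>)" unfolding pt_def by (rule someI_ex)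
      then have pt: "pt S \<in> hsub w" "pt S \<notin> range (\<lambda>b. b *\<^sub>R \<zeta>)" using S(2) by blast+
      from pt(1) obtain a y where y: "y \<bullet> w = 0" "pt S = a *\<^sub>R \<zeta> + \<iota> y" unfolding hsub_def by blast
      have "y \<noteq> 0" using pt(2) y(2) by (auto simp: \<iota>_simps)
      moreover have "co (pt S) = y" unfolding y(2) by (rule co)
      ultimately have "y \<in> Z" using S(1) unfolding Z_def by blast
      then show False using w y(1) by (auto simp: inner_commute)
    qed
  qed blast
qed

theorem sections_agree:
  assumes card: "CARD('n) \<ge> 4" and K: "star_body K" and L: "star_body L"
    and countable: "countable (diameters L)" and dK: "diameter_through_origin K \<zeta>"
    and cong: "\<And>H. subspace H \<Longrightarrow> dim H = 3 \<Longrightarrow> \<zeta> \<in> H \<Longrightarrow> directly_congruent H (K \<inter> H) (L \<inter> H)"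
    and nosym: "\<And>H. subspace H \<Longrightarrow> dim H = 3 \<Longrightarrow> \<zeta> \<in> H \<Longrightarrow> \<not> pi_symmetry H \<zeta> (L \<inter> H)"
    and nosym': "\<And>H u. subspace H \<Longrightarrow> dim H = 3 \<Longrightarrow> \<zeta> \<in> H \<Longrightarrow> u \<in> H \<Longrightarrow> u \<in> sphere 0 1 \<Longrightarrow> orthogonal u \<zeta> \<Longrightarrow>
      \<not> pi_symmetry H u (L \<inter> H)"
  shows "(\<forall>p x. section_dist \<zeta> L (axis_center \<zeta> L) p (\<iota> x) = section_dist \<zeta> K (axis_center \<zeta> K) p (\<iota> x)) \<or>
    (\<forall>p x. section_dist \<zeta> L (axis_center \<zeta> L) p (\<iota> (- x)) = section_dist \<zeta> K (axis_center \<zeta> K) p (\<iota> x))"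
proof -
  obtain D where D: "D \<subseteq> sphere 0 1" "sphere 0 1 \<subseteq> closure D"
    "\<And>w S. w \<in> D \<Longrightarrow> S \<in> diameters L \<Longrightarrow> S \<subseteq> hsub w \<Longrightarrow> S \<subseteq> range (\<lambda>b. b *\<^sub>R \<zeta>)"
    using generic_sections_contain_no_other_diameter[OF countable] by blast
  have c: "continuous_on UNIV (\<lambda>x. section_dist \<zeta> M c p (\<iota> x))" if "star_body M" for M c p
    by (rule continuous_on_compose2[OF continuous_on_section_dist[OF that norm_\<zeta>]])
      (use \<iota>_\<zeta> linear_continuous_on[OF linear_conv_bounded_linear[THEN iffD1, OF linear_\<iota>]] in auto)
  have h: "subspace (hsub w)" "dim (hsub w) = 3" "\<zeta> \<in> hsub w" if "norm w = 1" for w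
    using that by (simp_all add: subspace_hsub dim_hsub \<zeta>_in_hsub)
  have bound: "dist p q \<le> dist ((- radial K (- \<zeta>)) *\<^sub>R \<zeta>) (radial K \<zeta> *\<^sub>R \<zeta>)" if "closed_segment p q \<subseteq> L" for p q
    by (rule segment_length_le_diameter[OF _ axis_diameter[OF K norm_\<zeta> dK] cong that]) (use card in simp)
  let ?f = "\<lambda>p x. section_dist \<zeta> L (axis_center \<zeta> L) p (\<iota> x)"
  let ?g = "\<lambda>p x. section_dist \<zeta> K (axis_center \<zeta> K) p (\<iota> x)"
  have related: "(\<exists>t. rot_related ?f ?g w t) \<or>
      (\<exists>u. norm u = 1 \<and> u \<bullet> w = 0 \<and> flip_related ?f (\<lambda>p. ?g (mirror p)) w u)" if wD: "w \<in> D" for w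
  proof -
    have w: "norm w = 1" using D(1) wD by auto
    obtain \<phi> a where \<phi>: "\<phi> \<in> SO_on (hsub w)" "\<phi> ` (K \<inter> hsub w) = (+) a ` (L \<inter> hsub w)"
      using cong[OF h[OF w]] by (auto simp: directly_congruent_def)
    obtain \<epsilon> where \<epsilon>: "\<epsilon> = 1 \<or> \<epsilon> = -1" "\<phi> \<zeta> = \<epsilon> *\<^sub>R \<zeta>"
        "a = (\<epsilon> * axis_center \<zeta> K - axis_center \<zeta> L) *\<^sub>R \<zeta>"
      using axis_preserved_if_no_other_diameter[OF K L dK \<phi> bound D(3)[OF wD]] by blast
    show ?thesis
      using related_if_axis_preserved[OF w \<phi>(1) \<epsilon>(2,1)] \<phi>(2) unfolding \<epsilon>(3) by blast
  qed
  have not_even: "\<exists>p x. x \<bullet> w = 0 \<and> ?f p (- x) \<noteq> ?f p x" if w: "norm w = 1" for w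
    by (rule not_pi_symmetric_imp_not_even[OF w L nosym[OF h[OF w]]])
  have not_flip: "\<exists>p x. x \<bullet> w = 0 \<and> ?f p (axial_reflection u x) \<noteq> ?f (mirror p) x"
    if w: "norm w = 1" and u: "norm u = 1" "u \<bullet> w = 0" for w u
  proof (rule not_pi_symmetric_imp_not_flip_invariant[OF w u L])
    show "\<not> pi_symmetry (hsub w) (\<iota> u) (L \<inter> hsub w)"
      by (rule nosym'[OF h[OF w]]) (use u in \<open>simp_all add: \<iota>_in_hsub norm_\<iota> orthogonal_def \<iota>_\<zeta>\<close>)
  qed
  show ?thesis
    by (rule rotated_or_flipped_sections[where f = ?f and g = ?g,
      OF c[OF L] c[OF K] mirror_mirror D(2,1) related not_even not_flip])
qed

end

section \<open>From three-dimensional subspaces to the whole hyperplane\<close>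

lemma embedded_space_of_orthonormal:
  fixes \<zeta> b1 b2 b3 :: "real^'n"
  assumes "norm \<zeta> = 1" "norm b1 = 1" "norm b2 = 1" "norm b3 = 1"
    "b1 \<bullet> \<zeta> = 0" "b2 \<bullet> \<zeta> = 0" "b3 \<bullet> \<zeta> = 0" "b1 \<bullet> b2 = 0" "b1 \<bullet> b3 = 0" "b2 \<bullet> b3 = 0"
  shows "embedded_space \<zeta> (\<lambda>x. (x $ 1) *\<^sub>R b1 + (x $ 2) *\<^sub>R b2 + (x $ 3) *\<^sub>R b3)"
proof (rule embedded_space.intro)
  show "linear (\<lambda>x :: real^3. (x $ 1) *\<^sub>R b1 + (x $ 2) *\<^sub>R b2 + (x $ 3) *\<^sub>R b3)"
    by (rule linearI) (simp_all add: algebra_simps)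
  have "x \<bullet> y = x $ 1 * y $ 1 + x $ 2 * y $ 2 + x $ 3 * y $ 3" for x y :: "real^3"
    by (simp add: inner_vec_def sum_3)
  then show "((x $ 1) *\<^sub>R b1 + (x $ 2) *\<^sub>R b2 + (x $ 3) *\<^sub>R b3) \<bullet> ((y $ 1) *\<^sub>R b1 + (y $ 2) *\<^sub>R b2 + (y $ 3) *\<^sub>R b3) = x \<bullet> y"
    for x y :: "real^3"
    using assms by (simp add: inner_add_left inner_add_right norm_eq_1 inner_commute[of b2 b1]
        inner_commute[of b3 b1] inner_commute[of b3 b2])
qed (use assms in \<open>simp_all add: inner_add_left\<close>)

lemma unit_vector_orthogonal_to:
  fixes S :: "'a::euclidean_space set"
  assumes "finite S" "card S < DIM('a)"
  obtains v where "norm v = 1" "\<And>s. s \<in> S \<Longrightarrow> v \<bullet> s = 0"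
proof -
  have "dim S < DIM('a)" using dim_le_card'[OF assms(1)] assms(2) by linarith
  then obtain x where x: "x \<noteq> 0" "\<And>y. y \<in> span S \<Longrightarrow> orthogonal x y"
    using orthogonal_to_subspace_exists by blast
  then show ?thesis
    by (intro that[of "x /\<^sub>R norm x"]) (auto simp: orthogonal_def span_base)
qed

theorem corollary2:
  fixes K L :: "(real^'n) set" and \<zeta> :: "real^'n"
  assumes "CARD('n) \<ge> 4"
    and "star_body K" and "star_body L"
    and "countable (diameters K)" and "countable (diameters L)"
    and "\<zeta> \<in> sphere 0 1"
    and "diameter_through_origin K \<zeta>"
    and "\<And>H. subspace H \<Longrightarrow> dim H = 3 \<Longrightarrow> \<zeta> \<in> H \<Longrightarrow> directly_congruent H (K \<inter> H) (L \<inter> H)"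
    and "\<And>H. subspace H \<Longrightarrow> dim H = 3 \<Longrightarrow> \<zeta> \<in> H \<Longrightarrow>
           \<not> pi_symmetry H \<zeta> (K \<inter> H) \<and> \<not> pi_symmetry H \<zeta> (L \<inter> H)"
    and "\<And>H u. subspace H \<Longrightarrow> dim H = 3 \<Longrightarrow> \<zeta> \<in> H \<Longrightarrow> u \<in> H \<Longrightarrow> u \<in> sphere 0 1 \<Longrightarrow> orthogonal u \<zeta> \<Longrightarrow>
           \<not> pi_symmetry H u (K \<inter> H) \<and> \<not> pi_symmetry H u (L \<inter> H)"
  shows "\<exists>t. K = (+) (t *\<^sub>R \<zeta>) ` L \<or> K = (+) (t *\<^sub>R \<zeta>) ` axial_reflection \<zeta> ` L"
proof -
  note K = assms(2) and L = assms(3)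
  have \<zeta>: "norm \<zeta> = 1" using assms(6) by simp
  define c d where "c = axis_center \<zeta> K" and "d = axis_center \<zeta> L"
  let ?F = "\<lambda>p v. section_dist \<zeta> L d p v" and ?G = "\<lambda>p v. section_dist \<zeta> K c p v"
  let ?\<iota> = "\<lambda>b1 b2 b3 x :: real^3. (x $ 1) *\<^sub>R b1 + (x $ 2) *\<^sub>R b2 + (x $ 3) *\<^sub>R b3"
  have card: "DIM(real^'n) \<ge> 4" using assms(1) by simp
  have c1: "card {a} < DIM(real^'n)" "card {a, b} < DIM(real^'n)" "card {a, b, e} < DIM(real^'n)" for a b e :: "real^'n"
    using card by (auto simp: card_insert_if)
  obtain b1 where b1: "norm b1 = 1" "b1 \<bullet> \<zeta> = 0"
    using unit_vector_orthogonal_to[OF _ c1(1)[of \<zeta>]] by (metis finite.intros insertI1)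
  obtain b2 where b2: "norm b2 = 1" "b2 \<bullet> \<zeta> = 0" "b2 \<bullet> b1 = 0"
    using unit_vector_orthogonal_to[OF _ c1(2)[of \<zeta> b1]] by (metis finite.intros insertI1 insertI2)
  have b12: "b1 \<bullet> b2 = 0" using b2(3) by (simp add: inner_commute)
  \<comment> \<open>\<open>b1\<close> and \<open>b2\<close> stay fixed and only \<open>b3\<close>
    varies. The resulting subspaces cover the hyperplane orthogonal to \<zeta>, and all contain the
    plane of \<open>b1\<close> and \<open>b2\<close>.\<close>
  define good where "good b3 \<longleftrightarrow> norm b3 = 1 \<and> b3 \<bullet> \<zeta> = 0 \<and> b1 \<bullet> b3 = 0 \<and> b2 \<bullet> b3 = 0" for b3
  define A where "A b3 \<longleftrightarrow> (\<forall>p x. ?F p (?\<iota> b1 b2 b3 x) = ?G p (?\<iota> b1 b2 b3 x))" for b3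
  define B where "B b3 \<longleftrightarrow> (\<forall>p x. ?F p (?\<iota> b1 b2 b3 (- x)) = ?G p (?\<iota> b1 b2 b3 x))" for b3
  have emb: "embedded_space \<zeta> (?\<iota> b1 b2 b3)" if "good b3" for b3
    by (rule embedded_space_of_orthonormal) (use that \<zeta> b1 b2 b12 in \<open>auto simp: good_def\<close>)
  have AB: "A b3 \<or> B b3" if "good b3" for b3
    unfolding A_def B_def c_def d_def
    by (rule embedded_space.sections_agree[OF emb[OF that] assms(1-3,5,7,8)]) (use assms(9,10) in blast)+
  \<comment> \<open>On the common plane, where the third coordinate is 0, both alternatives would
    hold. There the functions of \<open>L\<close> would be even, giving a half-turn symmetry about
    \<zeta> of the section with normal \<open>axis 3 1\<close>.\<close>
  have same_type: False if g: "good b3" "good b3'" and "A b3" "B b3'" for b3 b3'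
  proof -
    have w: "norm (axis 3 1 :: real^3) = 1" by (simp add: norm_axis_1)
    let ?H = "embedded_space.hsub \<zeta> (?\<iota> b1 b2 b3) (axis 3 1)"
    have "\<not> pi_symmetry ?H \<zeta> (L \<inter> ?H)"
      using assms(9)[of ?H] embedded_space.subspace_hsub[OF emb[OF g(1)]]
        embedded_space.dim_hsub[OF emb[OF g(1)] w] embedded_space.\<zeta>_in_hsub(2)[OF emb[OF g(1)]] by blast
    then obtain p x where px: "x \<bullet> axis 3 1 = 0" "?F p (?\<iota> b1 b2 b3 (- x)) \<noteq> ?F p (?\<iota> b1 b2 b3 x)"
      using embedded_space.not_pi_symmetric_imp_not_even[OF emb[OF g(1)] w L] by blast
    have "x $ 3 = 0" using px(1) by (simp add: inner_axis)
    then have e: "?\<iota> b1 b2 b3 x = ?\<iota> b1 b2 b3' x" "?\<iota> b1 b2 b3 (- x) = ?\<iota> b1 b2 b3' (- x)" by simp_all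
    have "?F p (?\<iota> b1 b2 b3 (- x)) = ?G p (?\<iota> b1 b2 b3 x)" using \<open>B b3'\<close> unfolding e B_def by blast
    moreover have "?F p (?\<iota> b1 b2 b3 x) = ?G p (?\<iota> b1 b2 b3 x)" using \<open>A b3\<close> unfolding A_def by blast
    ultimately show False using px(2) by (simp only:)
  qed
  have cover: "\<exists>b3 x. good b3 \<and> v = ?\<iota> b1 b2 b3 x" if v: "v \<bullet> \<zeta> = 0" for v
  proof -
    define r where "r = v - (v \<bullet> b1) *\<^sub>R b1 - (v \<bullet> b2) *\<^sub>R b2"
    have r: "r \<bullet> \<zeta> = 0" "b1 \<bullet> r = 0" "b2 \<bullet> r = 0"
      using v b1 b2 b12 by (simp_all add: r_def inner_diff_left inner_diff_right norm_eq_1 inner_commute)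
    show ?thesis
    proof (cases "r = 0")
      case True
      obtain b3 where b3: "norm b3 = 1" "\<And>s. s \<in> {\<zeta>, b1, b2} \<Longrightarrow> b3 \<bullet> s = 0"
        using unit_vector_orthogonal_to[OF _ c1(3)[of \<zeta> b1 b2]] by (metis finite.intros)
      then have "good b3" by (simp add: good_def inner_commute)
      moreover have "v = ?\<iota> b1 b2 b3 (vector [v \<bullet> b1, v \<bullet> b2, 0])" using True by (simp add: r_def diff_eq_eq add.commute)
      ultimately show ?thesis by blast
    next
      case False
      have "good (r /\<^sub>R norm r)" using False r by (simp add: good_def)
      moreover have "v = ?\<iota> b1 b2 (r /\<^sub>R norm r) (vector [v \<bullet> b1, v \<bullet> b2, norm r])" using False by (simp add: r_def)
      ultimately show ?thesis by blast
    qed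
  qed
  obtain b where b: "good b" using cover[of 0] by auto
  have neg: "?\<iota> b1 b2 b3 (- x) = - ?\<iota> b1 b2 b3 x" for b3 x by simp
  have global: "(\<forall>v p. v \<bullet> \<zeta> = 0 \<longrightarrow> ?F p v = ?G p v) \<or> (\<forall>v p. v \<bullet> \<zeta> = 0 \<longrightarrow> ?F p (- v) = ?G p v)"
    using AB[OF b]
  proof
    assume "A b"
    then have "A b3" if "good b3" for b3 using AB[OF that] same_type[OF b that] by blast
    then have "?F p v = ?G p v" if "v \<bullet> \<zeta> = 0" for v p using cover[OF that] unfolding A_def by metis
    then show ?thesis by blast
  next
    assume "B b"
    then have "B b3" if "good b3" for b3 using AB[OF that] same_type[OF that b] by blast
    then have "?F p (- v) = ?G p v" if "v \<bullet> \<zeta> = 0" for v p using cover[OF that] unfolding B_def neg by metis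
    then show ?thesis by blast
  qed
  have decomp: "\<exists>s r v. norm v = 1 \<and> v \<bullet> \<zeta> = 0 \<and> 0 \<le> r \<and> x = (c + s) *\<^sub>R \<zeta> + r *\<^sub>R v" for x
  proof -
    let ?y = "x - (x \<bullet> \<zeta>) *\<^sub>R \<zeta>"
    have y: "?y \<bullet> \<zeta> = 0" using \<zeta> by (simp add: inner_diff_left norm_eq_1)
    show ?thesis
    proof (cases "?y = 0")
      case True
      \<comment> \<open>A point on the axis has distance r = 0 from it and may be placed in the half
        plane of any direction.\<close>
      then show ?thesis using b1 by (intro exI[of _ "x \<bullet> \<zeta> - c"] exI[of _ 0] exI[of _ b1]) simp
    next
      case False
      then show ?thesis using y
        by (intro exI[of _ "x \<bullet> \<zeta> - c"] exI[of _ "norm ?y"] exI[of _ "?y /\<^sub>R norm ?y"]) simp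
    qed
  qed
  have translate: "x \<in> (+) a ` M \<longleftrightarrow> x - a \<in> M" for x a and M :: "(real^'n) set"
  proof
    show "x \<in> (+) a ` M" if "x - a \<in> M" by (rule image_eqI[OF _ that]) simp
  qed auto
  from global show ?thesis
  proof
    assume eq: "\<forall>v p. v \<bullet> \<zeta> = 0 \<longrightarrow> ?F p v = ?G p v"
    \<comment> \<open>Equal half slices at the levels \<open>c\<close> and \<open>d\<close> mean
      that the bodies agree after a translation matching the midpoints of their chords on the
      axis.\<close>
    have "x \<in> K \<longleftrightarrow> x - (c - d) *\<^sub>R \<zeta> \<in> L" for x
    proof -
      obtain s r v where x: "norm v = 1" "v \<bullet> \<zeta> = 0" "0 \<le> r" "x = (c + s) *\<^sub>R \<zeta> + r *\<^sub>R v" using decomp by blast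
      have "half_slice \<zeta> L d v = half_slice \<zeta> K c v"
        by (rule half_slice_eq_if_section_dist_eq[OF L K x(1,1)]) (use eq x(2) in blast)
      then have "(s, r) \<in> half_slice \<zeta> L d v \<longleftrightarrow> (s, r) \<in> half_slice \<zeta> K c v" by simp
      then show ?thesis using x(3) by (simp add: half_slice_def x(4) algebra_simps)
    qed
    then have "K = (+) ((c - d) *\<^sub>R \<zeta>) ` L"
      unfolding set_eq_iff translate by simp
    then show ?thesis by blast
  next
    assume eq: "\<forall>v p. v \<bullet> \<zeta> = 0 \<longrightarrow> ?F p (- v) = ?G p v"
    have flip: "y \<in> axial_reflection \<zeta> ` L \<longleftrightarrow> axial_reflection \<zeta> y \<in> L" for y
      using axial_reflection_involution[OF \<zeta>] by (metis image_eqI imageE)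
    have "x \<in> K \<longleftrightarrow> axial_reflection \<zeta> (x - (c - d) *\<^sub>R \<zeta>) \<in> L" for x
    proof -
      obtain s r v where x: "norm v = 1" "v \<bullet> \<zeta> = 0" "0 \<le> r" "x = (c + s) *\<^sub>R \<zeta> + r *\<^sub>R v" using decomp by blast
      have "half_slice \<zeta> L d (- v) = half_slice \<zeta> K c v"
        by (rule half_slice_eq_if_section_dist_eq[OF L K]) (use eq x in auto)
      then have "(s, r) \<in> half_slice \<zeta> L d (- v) \<longleftrightarrow> (s, r) \<in> half_slice \<zeta> K c v" by simp
      moreover have "axial_reflection \<zeta> (x - (c - d) *\<^sub>R \<zeta>) = (d + s) *\<^sub>R \<zeta> + r *\<^sub>R (- v)"
        using axial_reflection_combination[OF \<zeta> x(2), of "d + s" r] by (simp add: x(4) algebra_simps)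
      ultimately show ?thesis using x(3) unfolding half_slice_def x(4) by simp
    qed
    then have "K = (+) ((c - d) *\<^sub>R \<zeta>) ` axial_reflection \<zeta> ` L"
      unfolding set_eq_iff translate flip by simp
    then show ?thesis by blast
  qed
qed

end
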